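(* Let $\ell,n,s,t\in\mathbb{N}$ with $n,s\ge3$ and $\ell\ge2$, and let $\mathcal{H}$ be a finite set of graphs. Then: (i) $\mathcal{G}_{\mathcal{H}}$ has bounded underlying treewidth if and only if $\mathcal{H}$ contains a spider-forest; (ii) the underlying treewidth of $\mathcal{G}_{P_n}$ equals $\lfloor\log_2 n\rfloor-1$; (iii) the underlying treewidth of $\mathcal{G}_{\ell P_n}$ equals $\lfloor\log_2 n\rfloor$; (iv) the underlying treewidth of $\mathcal{G}_{S_{s,t}}$ equals $\lfloor\log_2 t\rfloor+1$; (v) the underlying treewidth of $\mathcal{G}_{\ell S_{s,t}}$ equals $\lfloor\log_2 t\rfloor+2$.
   Context: Graphs are finite, simple and undirected; $\mathrm{tw}$ denotes treewidth. For a graph $H$, $\mathcal{G}_H$ is the class of graphs containing no subgraph (not necessarily induced) isomorphic to $H$; for a finite set $\mathcal{H}$ of graphs, $\mathcal{G}_{\mathcal{H}}$ is the class of graphs containing no subgraph isomorphic to any member of $\mathcal{H}$. $P_n$ is the $n$-vertex path; $\ell H$ denotes the disjoint union of $\ell$ copies of $H$. A spider-forest is a graph obtained from a star-forest (a forest each of whose components is a star) by subdividing edges. For $s\ge2$, $t\ge1$, the $(s,t)$-spider $S_{s,t}$ is obtained from $K_{1,s}$ by replacing each edge by a path with $t-1$ internal vertices. For graphs $G,H$, an $H$-partition of $G$ is a partition $(V_x : x\in V(H))$ of $V(G)$ such that for every edge $vw$ of $G$ with $v\in V_x$, $w\in V_y$, either $x=y$ or $xy\in E(H)$; its width is $\max_x|V_x|$.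 $\mathrm{tpw}_c(G)$ is the minimum width of an $H$-partition of $G$ over all graphs $H$ with $\mathrm{tw}(H)\le c$. The underlying treewidth of a graph class $\mathcal{G}$ is the minimum $c\in\mathbb{N}_0$ for which there is a function $f$ with $\mathrm{tpw}_c(G)\le f(\mathrm{tw}(G))$ for all $G\in\mathcal{G}$; it is bounded if such a $c$ exists. *)

theory Defs
  imports Complex_Main
begin

type_synonym 'a graph = "'a set \<times> 'a set set"

definition graph :: "'a graph \<Rightarrow> bool" where
  "graph G \<longleftrightarrow> finite (fst G) \<and>
     (\<forall>e\<in>snd G. \<exists>u v. e = {u, v} \<and> u \<noteq> v \<and> u \<in> fst G \<and> v \<in> fst G)"

definition contains_subgraph :: "'a graph \<Rightarrow> 'b graph \<Rightarrow> bool" where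
  "contains_subgraph G H \<longleftrightarrow> (\<exists>f. inj_on f (fst H) \<and> f ` fst H \<subseteq> fst G \<and>
     (\<forall>u v. {u, v} \<in> snd H \<longrightarrow> {f u, f v} \<in> snd G))"

definition isomorphic :: "'a graph \<Rightarrow> 'b graph \<Rightarrow> bool" where
  "isomorphic G H \<longleftrightarrow> (\<exists>f. bij_betw f (fst G) (fst H) \<and>
     (\<forall>u\<in>fst G. \<forall>v\<in>fst G. {u, v} \<in> snd G \<longleftrightarrow> {f u, f v} \<in> snd H))"

definition reach :: "'a set set \<Rightarrow> 'a set \<Rightarrow> 'a \<Rightarrow> 'a \<Rightarrow> bool" where
  "reach E S = (\<lambda>x y. x \<in> S \<and> y \<in> S \<and> {x, y} \<in> E)\<^sup>*\<^sup>*"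

definition connected_in :: "'a set set \<Rightarrow> 'a set \<Rightarrow> bool" where
  "connected_in E S \<longleftrightarrow> (\<forall>u\<in>S. \<forall>v\<in>S. reach E S u v)"

text \<open>A tree: nonempty connected graph in which every edge is a bridge (i.e. acyclic).\<close>
definition is_tree :: "'a graph \<Rightarrow> bool" where
  "is_tree T \<longleftrightarrow> graph T \<and> fst T \<noteq> {} \<and> connected_in (snd T) (fst T) \<and>
     (\<forall>e\<in>snd T. \<forall>u v. e = {u, v} \<longrightarrow> \<not> reach (snd T - {e}) (fst T) u v)"

definition tree_decomposition :: "'a graph \<Rightarrow> nat graph \<Rightarrow> (nat \<Rightarrow> 'a set) \<Rightarrow> bool" where
  "tree_decomposition G T B \<longleftrightarrow> is_tree T \<and>
     (\<forall>i\<in>fst T. B i \<subseteq> fst G) \<and>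
     (\<forall>v\<in>fst G. \<exists>i\<in>fst T. v \<in> B i) \<and>
     (\<forall>u v. {u, v} \<in> snd G \<longrightarrow> (\<exists>i\<in>fst T. u \<in> B i \<and> v \<in> B i)) \<and>
     (\<forall>v\<in>fst G. connected_in (snd T) {i \<in> fst T. v \<in> B i})"

text \<open>Treewidth (the empty graph gets treewidth 0 instead of -1).\<close>
definition tw :: "'a graph \<Rightarrow> nat" where
  "tw G = (LEAST k. \<exists>T B. tree_decomposition G T B \<and> (\<forall>i\<in>fst T. card (B i) \<le> k + 1))"

text \<open>An H-partition of G, given by the map sending each vertex of G to its part index;
  the part V_x is the preimage of x.\<close>
definition H_partition :: "'a graph \<Rightarrow> 'b graph \<Rightarrow> ('a \<Rightarrow> 'b) \<Rightarrow> bool" where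
  "H_partition G H \<phi> \<longleftrightarrow> (\<forall>v\<in>fst G. \<phi> v \<in> fst H) \<and>
     (\<forall>v w. {v, w} \<in> snd G \<longrightarrow> \<phi> v = \<phi> w \<or> {\<phi> v, \<phi> w} \<in> snd H)"

definition partition_width :: "'a graph \<Rightarrow> 'b graph \<Rightarrow> ('a \<Rightarrow> 'b) \<Rightarrow> nat" where
  "partition_width G H \<phi> = Max ((\<lambda>x. card {v \<in> fst G. \<phi> v = x}) ` fst H \<union> {0})"

definition tpw :: "nat \<Rightarrow> 'a graph \<Rightarrow> nat" where
  "tpw c G = (LEAST k. \<exists>(H :: nat graph) \<phi>. graph H \<and> tw H \<le> c \<and> H_partition G H \<phi> \<and>
     partition_width G H \<phi> \<le> k)"

definition utw_bounded_by :: "nat graph set \<Rightarrow> nat \<Rightarrow> bool" where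
  "utw_bounded_by C c \<longleftrightarrow> (\<exists>f :: nat \<Rightarrow> nat. \<forall>G\<in>C. tpw c G \<le> f (tw G))"

definition bounded_underlying_tw :: "nat graph set \<Rightarrow> bool" where
  "bounded_underlying_tw C \<longleftrightarrow> (\<exists>c. utw_bounded_by C c)"

definition is_underlying_tw :: "nat graph set \<Rightarrow> nat \<Rightarrow> bool" where
  "is_underlying_tw C c \<longleftrightarrow> utw_bounded_by C c \<and> (\<forall>c'<c. \<not> utw_bounded_by C c')"

text \<open>Graph classes excluding subgraphs (graphs of the class are taken on vertex type nat;
  every finite graph is isomorphic to one of them).\<close>
definition excl_set :: "'b graph set \<Rightarrow> nat graph set" where
  "excl_set \<H> = {G. graph G \<and> (\<forall>H\<in>\<H>. \<not> contains_subgraph G H)}"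

definition excl :: "'b graph \<Rightarrow> nat graph set" where
  "excl H = {G. graph G \<and> \<not> contains_subgraph G H}"

definition path_graph :: "nat \<Rightarrow> nat graph" where
  "path_graph n = ({0..<n}, {{i, Suc i} | i. Suc i < n})"

definition copies :: "nat \<Rightarrow> 'a graph \<Rightarrow> (nat \<times> 'a) graph" where
  "copies l G = ({(i, v). i < l \<and> v \<in> fst G}, {(\<lambda>v. (i, v)) ` e | i e. i < l \<and> e \<in> snd G})"

text \<open>Subdivided star forest: component c has centre (c,0,0) and, for each leg j
  (1-based) of length L = legs!c!(j-1), leg vertices (c,j,1),...,(c,j,L) forming a path
  attached to the centre. A leg of length L is a star edge subdivided L-1 times.\<close>
definition spider_forest_graph :: "nat list list \<Rightarrow> (nat \<times> nat \<times> nat) graph" where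
  "spider_forest_graph legs =
    ({(c, 0, 0) | c. c < length legs} \<union>
     {(c, j, i) | c j i. c < length legs \<and> 1 \<le> j \<and> j \<le> length (legs ! c) \<and>
                        1 \<le> i \<and> i \<le> legs ! c ! (j - 1)},
     {{(c, 0, 0), (c, j, 1)} | c j. c < length legs \<and> 1 \<le> j \<and> j \<le> length (legs ! c) \<and>
                        1 \<le> legs ! c ! (j - 1)} \<union>
     {{(c, j, i), (c, j, Suc i)} | c j i. c < length legs \<and> 1 \<le> j \<and> j \<le> length (legs ! c) \<and>
                        1 \<le> i \<and> Suc i \<le> legs ! c ! (j - 1)})"

definition spider_forest :: "'a graph \<Rightarrow> bool" where
  "spider_forest H \<longleftrightarrow> graph H \<and> (\<exists>legs. isomorphic H (spider_forest_graph legs))"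

definition spider :: "nat \<Rightarrow> nat \<Rightarrow> (nat \<times> nat \<times> nat) graph" where
  "spider s t = spider_forest_graph [replicate s t]"

end

theory Submission
  imports Defs "HOL-Library.Countable" "HOL-Library.Nat_Bijection"
begin

text \<open>
  Upper bounds. The partition is built top-down: a component of the unplaced vertices that sees at
  most \<open>c\<close> parts receives a new part \<open>Q\<close> such that every remaining component sees at most \<open>c\<close> of
  the old parts and \<open>Q\<close>. If all paths are short, the graph has bounded treedepth. Call \<open>S\<close>
  \<open>0\<close>-attached to \<open>Y\<close> if all of \<open>S\<close> has neighbours in \<open>Y\<close>, and \<open>(i + 1)\<close>-attached if for some
  \<open>v\<close> in \<open>Y\<close> the set \<open>S\<close> with \<open>v\<close> is \<open>i\<close>-attached to two disjoint connected subsets of \<open>Y - {v}\<close>.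
  An \<open>i\<close>-attached set gives a path on \<open>2 ^ (i + 1) - 1\<close> vertices, hence a path on \<open>n\<close> vertices bounds
  the depth of nested attachments by a logarithm, and this depth bounds \<open>c\<close>. In a spider-free graph,
  few disjoint connected sets contain a long leg starting next to a given vertex, so a bounded part,
  closed under joining bags of a tree decomposition, hits them all; the components that still
  see the previous part then have only short paths. For several copies, delete a maximal family of disjoint
  copies and put its vertices into one part adjacent to all others.

  Lower bounds. Adding an apex to many copies of a graph forces one more pairwise adjacent part and
  roughly doubles the longest path; a long path with many such graphs attached to each of its
  edges forces two more and contains no long spider with three legs. If no excluded graph is a
  spider-forest, take the bipartite graph between the leaves of a deep tree and their proper ancestors and
  subdivide its edges so often that small subgraphs are spider-forests; it still forces large treewidth.
\<close>

section \<open>Connected vertex sets\<close>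

text \<open>The binary logarithm has the same origin on both sides. A path passes an apex only once,
  so an apex turns at most q path vertices into at most 2q + 1 while the forced clique grows by one.
  Conversely, vertices chosen from j of the parts that a component sees are kept from being (c + 1 -
  j)-attached to it, so seeing c + 1 parts would contradict level 0. For spiders the obstacle is
  that arbitrarily many steps may pass before paths become short, so neither the part size nor the
  number of neighbours in a part may grow from step to step. Joining the marked bags bounds these
  neighbours by twice the bag size, whatever the size of the part, and this bound together with s
  fixes the size of the next part. Once a component sees two parts, the absence of a long leg next
  to the older one makes up for the attachment levels that two parts use up. Subdivided edges leave
  no large cliques to force. The lower bound for the spider-forest criterion therefore produces a
  set of host vertices that c + 1 others cannot separate, and such a set still lies in one
  bag.\<close>

definition conn :: "'a set set \<Rightarrow> 'a set \<Rightarrow> bool" where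
  "conn E S \<longleftrightarrow> S \<noteq> {} \<and> connected_in E S"

lemma reach_refl [simp]: "reach E S x x"
  by (simp add: reach_def)

lemma reach_step: "reach E S x y \<Longrightarrow> y \<in> S \<Longrightarrow> z \<in> S \<Longrightarrow> {y, z} \<in> E \<Longrightarrow> reach E S x z"
  unfolding reach_def by (rule rtranclp.rtrancl_into_rtrancl) auto

lemma reach_trans: "reach E S x y \<Longrightarrow> reach E S y z \<Longrightarrow> reach E S x z"
  unfolding reach_def by (rule rtranclp_trans)

lemma reach_induct [consumes 1, case_names base step]:
  assumes "reach E S x y" and "P x"
    and "\<And>y z. reach E S x y \<Longrightarrow> P y \<Longrightarrow> y \<in> S \<Longrightarrow> z \<in> S \<Longrightarrow> {y, z} \<in> E \<Longrightarrow> P z"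
  shows "P y"
  using assms(1) unfolding reach_def
  by (induction rule: rtranclp_induct) (use assms(2,3) in \<open>auto simp: reach_def\<close>)

lemma reach_sym: "reach E S x y \<Longrightarrow> reach E S y x"
proof (induction rule: reach_induct)
  case (step y z)
  then have "reach E S z y"
    by (intro reach_step[OF reach_refl]) (auto simp: insert_commute)
  then show ?case using step reach_trans by fast
qed simp

lemma reach_mono: "reach E S x y \<Longrightarrow> E \<subseteq> E' \<Longrightarrow> S \<subseteq> S' \<Longrightarrow> reach E' S' x y"
  by (induction rule: reach_induct) (auto intro: reach_step)

lemma reach_cross:
  assumes "reach E S x y" and "x \<in> A" and "y \<notin> A"
  obtains u v where "u \<in> A" "u \<in> S" "v \<in> S" "v \<notin> A" "{u, v} \<in> E"
proof -
  have "y \<notin> A \<longrightarrow> (\<exists>u v. u \<in> A \<and> u \<in> S \<and> v \<in> S \<and> v \<notin> A \<and> {u, v} \<in> E)"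
    using assms(1) by (induction rule: reach_induct) (use assms(2) in blast)+
  then show ?thesis using assms(3) that by blast
qed

text \<open>The set reachable from \<open>u\<close> is left by no edge, hence is everything.
  Connectedness is proved and used mostly through an edge leaving a subset, which avoids
  constructing walks.\<close>

lemma connected_inI_cut:
  assumes "\<And>A. A \<subseteq> S \<Longrightarrow> A \<noteq> {} \<Longrightarrow> A \<noteq> S \<Longrightarrow> \<exists>u\<in>A. \<exists>v\<in>S - A. {u, v} \<in> E"
  shows "connected_in E S"
  unfolding connected_in_def
proof (intro ballI)
  fix u v assume uv: "u \<in> S" "v \<in> S"
  let ?A = "{w \<in> S. reach E S u w}"
  have "?A = S"
  proof (rule ccontr)
    assume "?A \<noteq> S"
    then obtain a b where "a \<in> ?A" "b \<in> S - ?A" "{a, b} \<in> E"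
      using assms[of ?A] uv by fastforce
    then show False using reach_step[of E S u a b] by blast
  qed
  then show "reach E S u v" using uv by blast
qed

lemma connected_in_cut:
  assumes "connected_in E S" "a \<in> S" "a \<in> A" "b \<in> S" "b \<notin> A"
  obtains u v where "u \<in> A" "u \<in> S" "v \<in> S" "v \<notin> A" "{u, v} \<in> E"
  using assms reach_cross[of E S a b A] unfolding connected_in_def by blast

lemma conn_cut:
  assumes "conn E S" "a \<in> S" "a \<in> A" "b \<in> S" "b \<notin> A"
  obtains u v where "u \<in> A" "u \<in> S" "v \<in> S" "v \<notin> A" "{u, v} \<in> E"
  using assms connected_in_cut[of E S a A b] unfolding conn_def by blast

lemma conn_singleton [simp]: "conn E {x}"
  by (simp add: conn_def connected_in_def)

lemma conn_ne: "conn E S \<Longrightarrow> S \<noteq> {}"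
  by (simp add: conn_def)

lemma conn_Un:
  assumes "conn E A" "conn E B" and "A \<inter> B \<noteq> {} \<or> (\<exists>a\<in>A. \<exists>b\<in>B. {a, b} \<in> E)"
  shows "conn E (A \<union> B)"
proof -
  have AB: "reach E (A \<union> B) x y" if "x \<in> A" "y \<in> A" for x y
    using that assms(1) unfolding conn_def connected_in_def by (blast intro: reach_mono)
  have BB: "reach E (A \<union> B) x y" if "x \<in> B" "y \<in> B" for x y
    using that assms(2) unfolding conn_def connected_in_def by (blast intro: reach_mono)
  obtain a b where ab: "a \<in> A" "b \<in> B" "reach E (A \<union> B) a b"
  proof (cases "A \<inter> B = {}")
    case True
    then obtain a b where "a \<in> A" "b \<in> B" "{a, b} \<in> E" using assms(3) by blast
    then show ?thesis using that reach_step[of E "A \<union> B" a a b] by auto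
  next
    case False
    then obtain a where "a \<in> A" "a \<in> B" by blast
    then show ?thesis using that[of a a] by simp
  qed
  have "reach E (A \<union> B) x y" if "x \<in> A" "y \<in> B" for x y
    using reach_trans[OF AB[OF that(1) ab(1)] reach_trans[OF ab(3) BB[OF ab(2) that(2)]]] .
  then have "reach E (A \<union> B) x y" if "x \<in> A \<union> B" "y \<in> A \<union> B" for x y
    using AB BB that reach_sym[of E "A \<union> B" y x] by blast
  then show ?thesis
    using conn_ne[OF assms(1)] unfolding conn_def connected_in_def by simp
qed

lemma conn_insert:
  assumes "conn E A" "a \<in> A" "{a, b} \<in> E"
  shows "conn E (insert b A)"
  using conn_Un[OF assms(1) conn_singleton[of E b]] assms by auto

lemma conn_subset_edges:
  assumes "conn E A" "\<And>u v. u \<in> A \<Longrightarrow> v \<in> A \<Longrightarrow> {u, v} \<in> E \<Longrightarrow> {u, v} \<in> E'"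
  shows "conn E' A"
proof -
  have "connected_in E' A"
  proof (rule connected_inI_cut)
    fix B assume B: "B \<subseteq> A" "B \<noteq> {}" "B \<noteq> A"
    then obtain a b where "a \<in> A" "a \<in> B" "b \<in> A" "b \<notin> B" by blast
    then obtain u v where "u \<in> B" "u \<in> A" "v \<in> A" "v \<notin> B" "{u, v} \<in> E"
      using conn_cut[OF assms(1)] by metis
    then show "\<exists>u\<in>B. \<exists>v\<in>A - B. {u, v} \<in> E'" using assms(2) by blast
  qed
  then show ?thesis using assms(1) by (simp add: conn_def)
qed

lemma conn_image:
  assumes "conn E A" "\<And>u v. u \<in> A \<Longrightarrow> v \<in> A \<Longrightarrow> {u, v} \<in> E \<Longrightarrow> f u = f v \<or> {f u, f v} \<in> E'"
  shows "conn E' (f ` A)"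
proof -
  have "connected_in E' (f ` A)"
  proof (rule connected_inI_cut)
    fix B assume B: "B \<subseteq> f ` A" "B \<noteq> {}" "B \<noteq> f ` A"
    then obtain a b where "a \<in> A" "f a \<in> B" "b \<in> A" "f b \<notin> B" by blast
    then obtain u v where "u \<in> f -` B" "u \<in> A" "v \<in> A" "v \<notin> f -` B" "{u, v} \<in> E"
      using conn_cut[OF assms(1), of a "f -` B" b] by auto
    then show "\<exists>u\<in>B. \<exists>v\<in>f ` A - B. {u, v} \<in> E'" using assms(2)[of u v] by auto
  qed
  then show ?thesis using assms(1) by (simp add: conn_def)
qed

section \<open>Connected components\<close>

definition comp_of :: "'a set set \<Rightarrow> 'a set \<Rightarrow> 'a \<Rightarrow> 'a set" where
  "comp_of E S x = {y \<in> S. reach E S x y}"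

definition comps :: "'a set set \<Rightarrow> 'a set \<Rightarrow> 'a set set" where
  "comps E S = comp_of E S ` S"

lemma comps_subset: "C \<in> comps E S \<Longrightarrow> C \<subseteq> S"
  by (auto simp: comps_def comp_of_def)

lemma Union_comps [simp]: "\<Union> (comps E S) = S"
  by (auto simp: comps_def comp_of_def)

lemma finite_comps: "finite S \<Longrightarrow> finite (comps E S)"
  by (simp add: comps_def)

lemma comps_closed: "C \<in> comps E S \<Longrightarrow> y \<in> C \<Longrightarrow> z \<in> S \<Longrightarrow> {y, z} \<in> E \<Longrightarrow> z \<in> C"
  by (auto simp: comps_def comp_of_def intro: reach_step)

lemma conn_comps: "C \<in> comps E S \<Longrightarrow> conn E C"
proof -
  assume "C \<in> comps E S"
  then obtain x where x: "x \<in> S" and C: "C = comp_of E S x" by (auto simp: comps_def)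
  have *: "reach E C x y" if "reach E S x y" for y
    using that
  proof (induction rule: reach_induct)
    case (step y z)
    then have "y \<in> C" "z \<in> C" unfolding C comp_of_def using reach_step by fastforce+
    then show ?case using step reach_step by fast
  qed simp
  have "connected_in E C"
    unfolding connected_in_def
    by (metis * C comp_of_def mem_Collect_eq reach_sym reach_trans)
  moreover have "x \<in> C" using x by (simp add: C comp_of_def)
  ultimately show ?thesis by (auto simp: conn_def)
qed

lemma conn_subset_comp:
  assumes "C \<in> comps E S" "conn E Y" "Y \<subseteq> S" "Y \<inter> C \<noteq> {}"
  shows "Y \<subseteq> C"
proof (rule ccontr)
  assume "\<not> Y \<subseteq> C"
  then obtain a b where "a \<in> Y" "a \<in> C" "b \<in> Y" "b \<notin> C" using assms(4) by blast
  then obtain u v where "u \<in> C" "v \<in> Y" "v \<notin> C" "{u, v} \<in> E"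
    using conn_cut[OF assms(2)] by metis
  then show False using comps_closed[OF assms(1), of u v] assms(3) by blast
qed

lemma comps_disjoint: "C \<in> comps E S \<Longrightarrow> D \<in> comps E S \<Longrightarrow> C \<noteq> D \<Longrightarrow> C \<inter> D = {}"
  using conn_subset_comp[of C E S D] conn_subset_comp[of D E S C] conn_comps comps_subset by blast

lemma conn_in_comp:
  assumes "conn E Y" "Y \<subseteq> S"
  obtains C where "C \<in> comps E S" "Y \<subseteq> C"
proof -
  obtain y where "y \<in> Y" using conn_ne[OF assms(1)] by blast
  then have "y \<in> comp_of E S y" "comp_of E S y \<in> comps E S"
    using assms(2) by (auto simp: comp_of_def comps_def)
  then show ?thesis using that conn_subset_comp[OF _ assms] \<open>y \<in> Y\<close> by blast
qed

text \<open>Otherwise no edge inside \<open>C\<close> would leave \<open>Z\<close>. This is what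
  makes every remaining component see the newly chosen part.\<close>

lemma comps_attached:
  assumes "conn E C" "Z \<in> comps E (C - Q)" "Q \<inter> C \<noteq> {}"
  obtains q z where "q \<in> Q" "q \<in> C" "z \<in> Z" "{q, z} \<in> E"
proof -
  obtain a where "a \<in> Z" using conn_comps[OF assms(2)] conn_ne by blast
  moreover have "Z \<subseteq> C - Q" using assms(2) comps_subset by blast
  moreover obtain b where "b \<in> Q" "b \<in> C" using assms(3) by blast
  ultimately obtain u v where "u \<in> Z" "v \<in> C" "v \<notin> Z" "{u, v} \<in> E"
    using conn_cut[OF assms(1), of a Z b] by blast
  then show ?thesis using that[of v u] comps_closed[OF assms(2), of u v]
    by (auto simp: insert_commute)
qed

section \<open>Rooted decompositions\<close>

text \<open>This is a nice tree decomposition of width \<open>k\<close> of the graph on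
  \<open>W \<union> X\<close> with root bag \<open>W\<close>; \<open>X\<close> holds the vertices
  that occur only below the root. Read downwards, \<open>intro\<close> adds \<open>v\<close> to the
  bag, \<open>shrink\<close> drops \<open>W - W'\<close>, and \<open>union\<close> branches with an
  unchanged bag. Rule induction then replaces the handling of tree graphs.\<close>

inductive rd :: "nat \<Rightarrow> 'a set set \<Rightarrow> 'a set \<Rightarrow> 'a set \<Rightarrow> bool" for k E where
  nil: "finite W \<Longrightarrow> card W \<le> Suc k \<Longrightarrow> rd k E W {}"
| union: "rd k E W X \<Longrightarrow> rd k E W Y \<Longrightarrow> X \<inter> Y = {} \<Longrightarrow>
    (\<And>x y. x \<in> X \<Longrightarrow> y \<in> Y \<Longrightarrow> {x, y} \<notin> E) \<Longrightarrow> rd k E W (X \<union> Y)"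
| shrink: "rd k E W' X \<Longrightarrow> W' \<subseteq> W \<Longrightarrow> finite W \<Longrightarrow> card W \<le> Suc k \<Longrightarrow> W \<inter> X = {} \<Longrightarrow>
    (\<And>x w. x \<in> X \<Longrightarrow> w \<in> W - W' \<Longrightarrow> {x, w} \<notin> E) \<Longrightarrow> rd k E W X"
| intro: "rd k E (insert v W) X \<Longrightarrow> v \<notin> W \<Longrightarrow> rd k E W (insert v X)"

lemma rd_finite: "rd k E W X \<Longrightarrow> finite W \<and> finite X \<and> card W \<le> Suc k \<and> W \<inter> X = {}"
  by (induction rule: rd.induct) (auto simp: card_insert_if)

lemma rd_intro_set:
  assumes "rd k E W X" "A \<subseteq> W"
  shows "rd k E (W - A) (A \<union> X)"
proof -
  have "finite A" using assms rd_finite finite_subset by blast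
  then show ?thesis using assms(2)
  proof (induction A)
    case empty
    then show ?case using assms(1) by simp
  next
    case (insert a A)
    then have "rd k E (W - A) (A \<union> X)" by simp
    moreover have "W - A = insert a (W - insert a A)" using insert by auto
    ultimately show ?case using rd.intro[of k E a "W - insert a A" "A \<union> X"] by simp
  qed
qed

lemma rd_small:
  assumes "finite W" "finite X" "W \<inter> X = {}" "card W + card X \<le> Suc k"
  shows "rd k E W X"
proof -
  have "rd k E (W \<union> X) {}"
    using assms by (intro rd.nil) (auto simp: card_Un_disjoint)
  from rd_intro_set[OF this, of X] show ?thesis
    using assms(3) by (simp add: Un_Diff Int_commute Diff_triv)
qed

lemma rd_mono:
  assumes "rd k E W X" "k \<le> k'"
  shows "rd k' E W X"
  using assms(1)
proof (induction rule: rd.induct)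
  case (nil W)
  then show ?case using assms(2) by (intro rd.nil) auto
next
  case (shrink W' X W)
  then show ?case using assms(2) rd.shrink[of k' E W' X W] by auto
qed (auto intro: rd.union rd.intro)

lemma rd_restrict: "rd k E W X \<Longrightarrow> rd k E (W \<inter> C) (X \<inter> C)"
proof (induction rule: rd.induct)
  case (nil W)
  then show ?case using card_mono[of W "W \<inter> C"] by (auto intro: rd.nil)
next
  case (union W X Y)
  then have "rd k E (W \<inter> C) ((X \<inter> C) \<union> (Y \<inter> C))"
    by (intro rd.union) auto
  then show ?case by (simp add: Int_Un_distrib2)
next
  case (shrink W' X W)
  have "card (W \<inter> C) \<le> Suc k"
    using shrink.hyps(3,4) card_mono[of W "W \<inter> C"] by auto
  moreover have "W' \<inter> C \<subseteq> W \<inter> C" "finite (W \<inter> C)" "(W \<inter> C) \<inter> (X \<inter> C) = {}"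
    using shrink.hyps(2,3,5) by blast+
  moreover have *: "{x, w} \<notin> E" if "x \<in> X \<inter> C" "w \<in> W \<inter> C - W' \<inter> C" for x w
    using that shrink.hyps(6)[of x w] by blast
  ultimately show ?case
    by (rule_tac rd.shrink[OF shrink.IH])
next
  case (intro v W X)
  show ?case
  proof (cases "v \<in> C")
    case True
    then have "rd k E (insert v (W \<inter> C)) (X \<inter> C)" using intro.IH by simp
    then show ?thesis using rd.intro[of k E v "W \<inter> C" "X \<inter> C"] intro.hyps(2) True by simp
  next
    case False
    then show ?thesis using intro.IH by simp
  qed
qed

lemma rd_mono_edges:
  "rd k E W X \<Longrightarrow> (\<And>u v. u \<in> W \<union> X \<Longrightarrow> v \<in> W \<union> X \<Longrightarrow> {u, v} \<in> E' \<Longrightarrow> {u, v} \<in> E) \<Longrightarrow> rd k E' W X"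
proof (induction rule: rd.induct)
  case (union W X Y)
  have "rd k E' W X" "rd k E' W Y"
    by (rule union.IH; use union.prems in blast)+
  then show ?case
    by (rule rd.union) (use union.hyps(3,4) union.prems in blast)+
next
  case (shrink W' X W)
  have "rd k E' W' X"
    by (rule shrink.IH) (use shrink.hyps(2) shrink.prems in blast)
  then show ?case
    by (rule rd.shrink) (use shrink.hyps shrink.prems in blast)+
next
  case (intro v W X)
  have "rd k E' (insert v W) X"
    by (rule intro.IH) (use intro.prems in blast)
  then show ?case using intro.hyps(2) by (rule rd.intro)
qed (auto intro: rd.nil)

lemma rd_image:
  assumes "rd k E W X" "inj_on f (W \<union> X)"
    and "\<And>u v. u \<in> W \<union> X \<Longrightarrow> v \<in> W \<union> X \<Longrightarrow> {f u, f v} \<in> E' \<Longrightarrow> {u, v} \<in> E"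
  shows "rd k E' (f ` W) (f ` X)"
  using assms
proof (induction rule: rd.induct)
  case (nil W)
  then show ?case using card_image_le[of W f] by (auto intro: rd.nil)
next
  case (union W X Y)
  have "rd k E' (f ` W) (f ` X)" "rd k E' (f ` W) (f ` Y)"
    using union.IH union.prems by (auto simp: inj_on_def)
  moreover have "f ` X \<inter> f ` Y = {}"
    using union.hyps(3) union.prems(1) by (auto simp: inj_on_def)
  moreover have "{x, y} \<notin> E'" if xy: "x \<in> f ` X" "y \<in> f ` Y" for x y
  proof -
    obtain u v where "u \<in> X" "v \<in> Y" "x = f u" "y = f v" using xy by blast
    then show ?thesis using union.hyps(4)[of u v] union.prems(2)[of u v] by blast
  qed
  ultimately show ?case
    unfolding image_Un by (intro rd.union)
next
  case (shrink W' X W)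
  have "rd k E' (f ` W') (f ` X)"
  proof (rule shrink.IH)
    show "inj_on f (W' \<union> X)"
      using shrink.prems(1) by (rule inj_on_subset) (use shrink.hyps(2) in blast)
    show "{u, v} \<in> E" if "u \<in> W' \<union> X" "v \<in> W' \<union> X" "{f u, f v} \<in> E'" for u v
      using shrink.prems(2)[of u v] that shrink.hyps(2) by blast
  qed
  moreover have "f ` W \<inter> f ` X = {}"
    using shrink.hyps(5) shrink.prems(1) by (auto simp: inj_on_def)
  moreover have "{x, y} \<notin> E'" if xy: "x \<in> f ` X" "y \<in> f ` W - f ` W'" for x y
  proof -
    obtain u v where "u \<in> X" "v \<in> W - W'" "x = f u" "y = f v" using xy by blast
    then show ?thesis using shrink.hyps(6)[of u v] shrink.prems(2)[of u v] by blast
  qed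
  moreover have "card (f ` W) \<le> Suc k" "finite (f ` W)"
    using shrink.hyps(3,4) card_image_le[of W f] by auto
  moreover have "f ` W' \<subseteq> f ` W" using shrink.hyps(2) by blast
  ultimately show ?case
    by (rule_tac rd.shrink[of k E' "f ` W'"])
next
  case (intro v W X)
  have "v \<notin> X" using rd_finite[OF intro.hyps(1)] by auto
  have "rd k E' (insert (f v) (f ` W)) (f ` X)"
    using intro.IH intro.prems by (simp add: insert_commute)
  moreover have "f v \<notin> f ` W" using intro.hyps(2) intro.prems(1) by (auto simp: inj_on_def)
  ultimately show ?case by (simp add: rd.intro)
qed

text \<open>The vertex \<open>a\<close> joins every bag, which costs one in the width and leaves the
  edges at \<open>a\<close> unrestricted.\<close>

lemma rd_insert_apex:
  assumes "rd k E W X" "a \<notin> W \<union> X"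
    and "\<And>u v. u \<in> W \<union> X \<Longrightarrow> v \<in> W \<union> X \<Longrightarrow> {u, v} \<in> E' \<Longrightarrow> {u, v} \<in> E"
  shows "rd (Suc k) E' (insert a W) X"
  using assms
proof (induction rule: rd.induct)
  case (nil W)
  then show ?case by (intro rd.nil) auto
next
  case (union W X Y)
  have "rd (Suc k) E' (insert a W) X" "rd (Suc k) E' (insert a W) Y"
    by (rule union.IH; use union.prems in blast)+
  then show ?case
    by (rule rd.union) (use union.hyps(3,4) union.prems in blast)+
next
  case (shrink W' X W)
  have "rd (Suc k) E' (insert a W') X"
    by (rule shrink.IH) (use shrink.hyps(2) shrink.prems in blast)+
  then show ?case
  proof (rule rd.shrink)
    show "card (insert a W) \<le> Suc (Suc k)" using shrink.hyps(3,4) by (simp add: card_insert_if)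
    show "{x, w} \<notin> E'" if "x \<in> X" "w \<in> insert a W - insert a W'" for x w
    proof -
      have "{x, w} \<notin> E" using that shrink.hyps(6) by blast
      then show ?thesis using that shrink.prems(2)[of x w] by blast
    qed
  qed (use shrink.hyps shrink.prems in auto)
next
  case (intro v W X)
  then have "rd (Suc k) E' (insert a (insert v W)) X" by auto
  then show ?case using intro by (auto simp: insert_commute intro: rd.intro)
qed

lemma rd_UNION:
  assumes "finite I" "finite W" "card W \<le> Suc k"
    and "\<And>i. i \<in> I \<Longrightarrow> rd k E W (X i)"
    and "\<And>i j. i \<in> I \<Longrightarrow> j \<in> I \<Longrightarrow> i \<noteq> j \<Longrightarrow> X i \<inter> X j = {}"
    and "\<And>i j x y. i \<in> I \<Longrightarrow> j \<in> I \<Longrightarrow> i \<noteq> j \<Longrightarrow> x \<in> X i \<Longrightarrow> y \<in> X j \<Longrightarrow> {x, y} \<notin> E"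
  shows "rd k E W (\<Union>i\<in>I. X i)"
  using assms
proof (induction I)
  case empty
  then show ?case by (simp add: rd.nil)
next
  case (insert i I)
  have "rd k E W (X i \<union> (\<Union>i\<in>I. X i))"
  proof (rule rd.union)
    show "rd k E W (X i)" using insert.prems(3) by simp
    show "rd k E W (\<Union>i\<in>I. X i)"
      by (rule insert.IH; use insert.prems in \<open>meson insertI2\<close>)
    show "X i \<inter> (\<Union>i\<in>I. X i) = {}"
      using insert.prems(4)[of i] insert.hyps(2) by fastforce
    show "{x, y} \<notin> E" if "x \<in> X i" "y \<in> (\<Union>i\<in>I. X i)" for x y
      using that insert.prems(5)[of i] insert.hyps(2) by fastforce
  qed
  then show ?case by simp
qed

text \<open>A set that no \<open>k + 1\<close> vertices separate lies in a single bag.\<close>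

lemma rd_linked_card:
  assumes "rd k E W X" "K \<subseteq> W \<union> X" "W \<union> X \<subseteq> V"
    and closed: "\<forall>x\<in>X. \<forall>y\<in>V. {x, y} \<in> E \<longrightarrow> y \<in> W \<union> X"
    and linked: "\<And>Z x y. finite Z \<Longrightarrow> card Z \<le> Suc k \<Longrightarrow> x \<in> K - Z \<Longrightarrow> y \<in> K - Z \<Longrightarrow> reach E (V - Z) x y"
  shows "card K \<le> Suc k"
  using assms(1-4)
proof (induction rule: rd.induct)
  case (nil W)
  then show ?case using card_mono[of W K] by simp
next
  case (union W X Y)
  have W: "finite W" "card W \<le> Suc k" "W \<inter> X = {}" "W \<inter> Y = {}"
    using rd_finite union.hyps(1,2) by blast+
  have XY: "{y, x} \<notin> E" if "x \<in> X" "y \<in> Y" for x y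
    using union.hyps(4)[OF that] by (simp add: insert_commute)
  have cX: "\<forall>x\<in>X. \<forall>y\<in>V. {x, y} \<in> E \<longrightarrow> y \<in> W \<union> X"
    using union.prems(3) union.hyps(4) by blast
  have cY: "\<forall>x\<in>Y. \<forall>y\<in>V. {x, y} \<in> E \<longrightarrow> y \<in> W \<union> Y"
    using union.prems(3) XY by blast
  \<comment> \<open>With vertices of \<open>K\<close> in both branches, the root bag
    \<open>W\<close> would separate them.\<close>
  have "K \<inter> X = {} \<or> K \<inter> Y = {}"
  proof (rule ccontr)
    assume "\<not> ?thesis"
    then obtain x y where xy: "x \<in> K" "x \<in> X" "y \<in> K" "y \<in> Y" by blast
    then have "reach E (V - W) x y" using linked[OF W(1,2)] W(3,4) by blast
    then obtain u v where "u \<in> X" "v \<in> V - W" "v \<notin> X" "{u, v} \<in> E"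
      by (rule reach_cross[of _ _ _ _ X]) (use xy union.hyps(3) in auto)
    then show False using cX by blast
  qed
  then show ?case
  proof
    assume "K \<inter> Y = {}"
    then show ?thesis using union.IH(1) union.prems(1,2) cX by blast
  next
    assume "K \<inter> X = {}"
    then show ?thesis using union.IH(2) union.prems(1,2) cY by blast
  qed
next
  case (shrink W' X W)
  have closed': "\<forall>x\<in>X. \<forall>y\<in>V. {x, y} \<in> E \<longrightarrow> y \<in> W' \<union> X"
    using shrink.prems(3) shrink.hyps(6) by blast
  show ?case
  proof (cases "K \<subseteq> W' \<union> X")
    case True
    moreover have "W' \<union> X \<subseteq> V" using shrink.prems(2) shrink.hyps(2) by blast
    ultimately show ?thesis using shrink.IH closed' by blast
  next
    case False
    then obtain w where w: "w \<in> K" "w \<in> W" "w \<notin> W'" using shrink.prems(1) by blast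
    have W': "finite W'" "card W' \<le> Suc k" "W' \<inter> X = {}"
      using rd_finite[OF shrink.hyps(1)] by auto
    have wX: "w \<notin> X" using w shrink.hyps(5) by blast
    \<comment> \<open>The smaller bag \<open>W'\<close> separates the dropped vertex
      \<open>w\<close> from everything in \<open>X\<close>.\<close>
    have "K \<subseteq> W"
    proof (rule ccontr)
      assume "\<not> K \<subseteq> W"
      then obtain x where x: "x \<in> K" "x \<in> X" using shrink.prems(1) by blast
      then have "reach E (V - W') x w" using linked[OF W'(1,2)] w W'(3) by blast
      then obtain u v where "u \<in> X" "v \<in> V - W'" "v \<notin> X" "{u, v} \<in> E"
        by (rule reach_cross[of _ _ _ _ X]) (use x wX in auto)
      then show False using closed' by blast
    qed
    then show ?thesis using shrink.hyps(3,4) card_mono[of W K] by simp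
  qed
next
  case (intro v W X)
  have "\<forall>x\<in>X. \<forall>y\<in>V. {x, y} \<in> E \<longrightarrow> y \<in> insert v W \<union> X"
    using intro.prems(3) by blast
  then show ?case using intro.IH intro.prems(1,2) by simp
qed

section \<open>Treewidth and rooted decompositions\<close>

lemma graph_edgeD: "graph G \<Longrightarrow> {u, v} \<in> snd G \<Longrightarrow> u \<in> fst G \<and> v \<in> fst G \<and> u \<noteq> v"
  unfolding graph_def by (metis doubleton_eq_iff)

lemma is_tree_edgeD: "is_tree T \<Longrightarrow> {u, v} \<in> snd T \<Longrightarrow> u \<in> fst T \<and> v \<in> fst T \<and> u \<noteq> v"
  unfolding is_tree_def by (meson graph_edgeD)

lemma is_tree_singleton: "is_tree ({r}, {})"
  by (simp add: is_tree_def graph_def connected_in_def)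

text \<open>The map may let a walk stand still. It is used to contract one of two joined trees to
  its root.\<close>

lemma reach_project:
  assumes "reach F V u v"
    and "\<And>y z. {y, z} \<in> F \<Longrightarrow> p y = p z \<or> p y \<in> V' \<and> p z \<in> V' \<and> {p y, p z} \<in> F'"
  shows "reach F' V' (p u) (p v)"
  using assms(1)
proof (induction rule: reach_induct)
  case (step y z)
  then show ?case using assms(2)[of y z] reach_step[of F' V' "p u" "p y" "p z"] by auto
qed simp

lemma is_tree_join:
  assumes T1: "is_tree T1" and T2: "is_tree T2" and disj: "fst T1 \<inter> fst T2 = {}"
    and r1: "r1 \<in> fst T1" and r2: "r2 \<in> fst T2"
  shows "is_tree (fst T1 \<union> fst T2, insert {r1, r2} (snd T1 \<union> snd T2))" (is "is_tree (?V, ?E)")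
proof -
  have ed1: "u \<in> fst T1 \<and> v \<in> fst T1" if "{u, v} \<in> snd T1" for u v
    using is_tree_edgeD[OF T1 that] by simp
  have ed2: "u \<in> fst T2 \<and> v \<in> fst T2" if "{u, v} \<in> snd T2" for u v
    using is_tree_edgeD[OF T2 that] by simp
  have g: "graph (?V, ?E)"
    unfolding graph_def fst_conv snd_conv
  proof (intro conjI ballI)
    show "finite ?V" using T1 T2 by (simp add: is_tree_def graph_def)
    fix e assume "e \<in> ?E"
    then consider "e = {r1, r2}" | "e \<in> snd T1" | "e \<in> snd T2" by blast
    then show "\<exists>u v. e = {u, v} \<and> u \<noteq> v \<and> u \<in> ?V \<and> v \<in> ?V"
    proof cases
      case 1
      then show ?thesis using r1 r2 disj by blast
    next
      case 2
      then show ?thesis using T1 unfolding is_tree_def graph_def by (meson UnI1)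
    next
      case 3
      then show ?thesis using T2 unfolding is_tree_def graph_def by (meson UnI2)
    qed
  qed
  have "conn ?E (fst T1)"
    by (rule conn_subset_edges[of "snd T1"]) (use T1 in \<open>auto simp: is_tree_def conn_def\<close>)
  moreover have "conn ?E (fst T2)"
    by (rule conn_subset_edges[of "snd T2"]) (use T2 in \<open>auto simp: is_tree_def conn_def\<close>)
  ultimately have c: "connected_in ?E ?V"
    using conn_Un[of ?E "fst T1" "fst T2"] r1 r2 by (auto simp: conn_def)
  have br: "\<not> reach (?E - {{u, v}}) ?V u v" if e: "{u, v} \<in> ?E" for u v
  proof
    assume re: "reach (?E - {{u, v}}) ?V u v"
    consider "{u, v} = {r1, r2}" | "{u, v} \<in> snd T1" | "{u, v} \<in> snd T2"
      using e by blast
    then show False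
    proof cases
      case 1
      then have re': "reach (?E - {{r1, r2}}) ?V r1 r2"
        using re reach_sym[OF re] by (auto simp: doubleton_eq_iff insert_commute)
      then obtain a b where "a \<in> fst T1" "b \<notin> fst T1" "b \<in> ?V" "{a, b} \<in> ?E - {{r1, r2}}"
        by (rule reach_cross[of _ _ _ _ "fst T1"]) (use r1 r2 disj in auto)
      then show False using ed1[of a b] ed2[of a b] disj by blast
    next
      case 2
      \<comment> \<open>Contracting the second tree to \<open>r1\<close> would turn a walk around
        the edge into such a walk in the first tree, where the edge is a bridge.\<close>
      let ?p = "\<lambda>x. if x \<in> fst T1 then x else r1"
      have "reach (snd T1 - {{u, v}}) (fst T1) (?p u) (?p v)"
      proof (rule reach_project[OF re])
        fix y z assume yz: "{y, z} \<in> ?E - {{u, v}}"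
        then consider "{y, z} = {r1, r2}" | "{y, z} \<in> snd T1" | "{y, z} \<in> snd T2" by blast
        then show "?p y = ?p z \<or> ?p y \<in> fst T1 \<and> ?p z \<in> fst T1 \<and> {?p y, ?p z} \<in> snd T1 - {{u, v}}"
        proof cases
          case 1
          then show ?thesis using r1 r2 disj by (auto simp: doubleton_eq_iff)
        next
          case b: 2
          then show ?thesis using yz ed1[OF b] by simp
        next
          case 3
          then have "y \<notin> fst T1" "z \<notin> fst T1" using ed2[OF 3] disj by auto
          then show ?thesis by simp
        qed
      qed
      then show False using T1 2 ed1[OF 2] unfolding is_tree_def by auto
    next
      case 3
      let ?p = "\<lambda>x. if x \<in> fst T2 then x else r2"
      have "reach (snd T2 - {{u, v}}) (fst T2) (?p u) (?p v)"
      proof (rule reach_project[OF re])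
        fix y z assume yz: "{y, z} \<in> ?E - {{u, v}}"
        then consider "{y, z} = {r1, r2}" | "{y, z} \<in> snd T2" | "{y, z} \<in> snd T1" by blast
        then show "?p y = ?p z \<or> ?p y \<in> fst T2 \<and> ?p z \<in> fst T2 \<and> {?p y, ?p z} \<in> snd T2 - {{u, v}}"
        proof cases
          case 1
          then show ?thesis using r1 r2 disj by (auto simp: doubleton_eq_iff)
        next
          case b: 2
          then show ?thesis using yz ed2[OF b] by simp
        next
          case 3
          then have "y \<notin> fst T2" "z \<notin> fst T2" using ed1[OF 3] disj by auto
          then show ?thesis by simp
        qed
      qed
      then show False using T2 3 ed2[OF 3] unfolding is_tree_def by auto
    qed
  qed
  show ?thesis
    unfolding is_tree_def fst_conv snd_conv using g c br r1 by blast
qed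

text \<open>Node labels above an arbitrary bound \<open>m\<close> make disjoint unions of trees free of relabelling.\<close>

definition rooted_td :: "nat \<Rightarrow> 'a set set \<Rightarrow> 'a set \<Rightarrow> 'a set \<Rightarrow> nat \<Rightarrow> nat graph \<Rightarrow> (nat \<Rightarrow> 'a set) \<Rightarrow> nat \<Rightarrow> bool" where
  "rooted_td k E W U m T B r \<longleftrightarrow> is_tree T \<and> r \<in> fst T \<and> (\<forall>i\<in>fst T. m \<le> i) \<and> B r = W \<and>
     (\<forall>i\<in>fst T. B i \<subseteq> U \<and> card (B i) \<le> Suc k) \<and>
     (\<forall>v\<in>U. \<exists>i\<in>fst T. v \<in> B i) \<and>
     (\<forall>u\<in>U. \<forall>v\<in>U. {u, v} \<in> E \<longrightarrow> (\<exists>i\<in>fst T. u \<in> B i \<and> v \<in> B i)) \<and>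
     (\<forall>v\<in>U. connected_in (snd T) {i \<in> fst T. v \<in> B i})"

lemma rooted_td_singleton:
  assumes "card W \<le> Suc k"
  shows "rooted_td k E W W m ({m}, {}) (\<lambda>_. W) m"
proof -
  have "{i \<in> {m}. v \<in> W} = (if v \<in> W then {m} else {})" for v by auto
  then show ?thesis
    using assms by (auto simp: rooted_td_def is_tree_singleton connected_in_def)
qed

text \<open>Keeping the root of the first tree serves all rules of \<open>rd\<close>: two equal root
  bags give \<open>union\<close>, and a one-node first tree puts a new root bag on top, as in
  \<open>shrink\<close> and \<open>intro\<close>. A vertex occurring on both sides lies in both root
  bags, so its two node sets are connected through the new edge.\<close>

lemma rooted_td_join:
  assumes D1: "rooted_td k E W1 U1 m1 T1 B1 r1" and D2: "rooted_td k E W2 U2 m2 T2 B2 r2"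
    and m: "m1 \<le> m2" "\<forall>i\<in>fst T1. i < m2" and U: "U1 \<inter> U2 \<subseteq> W1 \<inter> W2"
    and e: "\<And>u v. u \<in> U1 - U2 \<Longrightarrow> v \<in> U2 - U1 \<Longrightarrow> {u, v} \<notin> E"
  shows "\<exists>T B. rooted_td k E W1 (U1 \<union> U2) m1 T B r1"
proof -
  define T where "T = (fst T1 \<union> fst T2, insert {r1, r2} (snd T1 \<union> snd T2))"
  define B where "B = (\<lambda>i. if i < m2 then B1 i else B2 i)"
  have t1: "is_tree T1" "r1 \<in> fst T1" "B1 r1 = W1" "\<forall>i\<in>fst T1. m1 \<le> i"
    "\<forall>i\<in>fst T1. B1 i \<subseteq> U1 \<and> card (B1 i) \<le> Suc k" "\<forall>v\<in>U1. \<exists>i\<in>fst T1. v \<in> B1 i"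
    "\<forall>u\<in>U1. \<forall>v\<in>U1. {u, v} \<in> E \<longrightarrow> (\<exists>i\<in>fst T1. u \<in> B1 i \<and> v \<in> B1 i)"
    "\<forall>v\<in>U1. connected_in (snd T1) {i \<in> fst T1. v \<in> B1 i}"
    using D1 unfolding rooted_td_def by blast+
  have t2: "is_tree T2" "r2 \<in> fst T2" "B2 r2 = W2" "\<forall>i\<in>fst T2. m2 \<le> i"
    "\<forall>i\<in>fst T2. B2 i \<subseteq> U2 \<and> card (B2 i) \<le> Suc k" "\<forall>v\<in>U2. \<exists>i\<in>fst T2. v \<in> B2 i"
    "\<forall>u\<in>U2. \<forall>v\<in>U2. {u, v} \<in> E \<longrightarrow> (\<exists>i\<in>fst T2. u \<in> B2 i \<and> v \<in> B2 i)"
    "\<forall>v\<in>U2. connected_in (snd T2) {i \<in> fst T2. v \<in> B2 i}"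
    using D2 unfolding rooted_td_def by blast+
  have disj: "fst T1 \<inter> fst T2 = {}" using m(2) t2(4) by fastforce
  have T: "is_tree T" unfolding T_def by (rule is_tree_join[OF t1(1) t2(1) disj t1(2) t2(2)])
  have Bi1: "B i = B1 i" if "i \<in> fst T1" for i using that m(2) by (simp add: B_def)
  have Bi2: "B i = B2 i" if "i \<in> fst T2" for i using that t2(4) by (auto simp: B_def)
  have fT: "fst T = fst T1 \<union> fst T2" by (simp add: T_def)
  have S: "{i \<in> fst T. v \<in> B i} = {i \<in> fst T1. v \<in> B1 i} \<union> {i \<in> fst T2. v \<in> B2 i}" for v
    using Bi1 Bi2 fT by auto
  have con: "connected_in (snd T) {i \<in> fst T. v \<in> B i}" if v: "v \<in> U1 \<union> U2" for v
  proof -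
    have c1: "conn (snd T) {i \<in> fst T1. v \<in> B1 i}" if "v \<in> U1"
      by (rule conn_subset_edges[of "snd T1"])
        (use that t1(6,8) in \<open>auto simp: conn_def T_def\<close>)
    have c2: "conn (snd T) {i \<in> fst T2. v \<in> B2 i}" if "v \<in> U2"
      by (rule conn_subset_edges[of "snd T2"])
        (use that t2(6,8) in \<open>auto simp: conn_def T_def\<close>)
    consider "v \<in> U1" "v \<notin> U2" | "v \<notin> U1" "v \<in> U2" | "v \<in> U1" "v \<in> U2" using v by blast
    then show ?thesis
    proof cases
      case 1
      then have "{i \<in> fst T2. v \<in> B2 i} = {}" using t2(5) by blast
      then show ?thesis using c1 1 unfolding S conn_def by (simp only: Un_empty_right)
    next
      case 2
      then have "{i \<in> fst T1. v \<in> B1 i} = {}" using t1(5) by blast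
      then show ?thesis using c2 2 unfolding S conn_def by (simp only: Un_empty_left)
    next
      case 3
      then have "v \<in> B1 r1" "v \<in> B2 r2" using U t1(3) t2(3) by auto
      then show ?thesis
        using conn_Un[OF c1 c2] 3 t1(2) t2(2) unfolding S conn_def by (auto simp: T_def)
    qed
  qed
  have "\<exists>i\<in>fst T. u \<in> B i \<and> v \<in> B i" if uv: "u \<in> U1 \<union> U2" "v \<in> U1 \<union> U2" "{u, v} \<in> E" for u v
  proof -
    have "\<not> (u \<in> U1 - U2 \<and> v \<in> U2 - U1)" "\<not> (v \<in> U1 - U2 \<and> u \<in> U2 - U1)"
      using e[of u v] e[of v u] uv(3) by (auto simp: insert_commute)
    then have "u \<in> U1 \<and> v \<in> U1 \<or> u \<in> U2 \<and> v \<in> U2" using uv by blast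
    then show ?thesis using t1(7) t2(7) uv(3) Bi1 Bi2 fT by (metis Un_iff)
  qed
  moreover have "\<forall>i\<in>fst T. B i \<subseteq> U1 \<union> U2 \<and> card (B i) \<le> Suc k"
    using t1(5) t2(5) Bi1 Bi2 fT by (metis Un_iff le_supI1 le_supI2)
  moreover have "\<forall>v\<in>U1 \<union> U2. \<exists>i\<in>fst T. v \<in> B i"
    using t1(6) t2(6) Bi1 Bi2 fT by (metis Un_iff)
  moreover have "\<forall>i\<in>fst T. m1 \<le> i" using t1(4) t2(4) m(1) fT by fastforce
  ultimately have "rooted_td k E W1 (U1 \<union> U2) m1 T B r1"
    unfolding rooted_td_def using T con t1(2,3) Bi1 fT by auto
  then show ?thesis by blast
qed

lemma rd_rooted_td:
  assumes "rd k E W X"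
  shows "\<exists>T B r. rooted_td k E W (W \<union> X) m T B r"
  using assms
proof (induction arbitrary: m rule: rd.induct)
  case (nil W)
  then show ?case using rooted_td_singleton[of W k E m] by auto
next
  case (union W X Y)
  obtain T1 B1 r1 where 1: "rooted_td k E W (W \<union> X) m T1 B1 r1" using union.IH(1) by blast
  have "finite (fst T1)" using 1 by (simp add: rooted_td_def is_tree_def graph_def)
  then obtain m2 where m2: "m \<le> m2" "\<forall>i\<in>fst T1. i < m2"
    by (metis finite_nat_set_iff_bounded le_add1 trans_less_add2)
  obtain T2 B2 r2 where 2: "rooted_td k E W (W \<union> Y) m2 T2 B2 r2" using union.IH(2) by blast
  have "\<exists>T B. rooted_td k E W ((W \<union> X) \<union> (W \<union> Y)) m T B r1"
    by (rule rooted_td_join[OF 1 2 m2]) (use union.hyps(3,4) in auto)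
  moreover have "(W \<union> X) \<union> (W \<union> Y) = W \<union> (X \<union> Y)" by blast
  ultimately show ?case by auto
next
  case (shrink W' X W)
  have 1: "rooted_td k E W W m ({m}, {}) (\<lambda>_. W) m"
    using rooted_td_singleton shrink.hyps by blast
  obtain T2 B2 r2 where 2: "rooted_td k E W' (W' \<union> X) (Suc m) T2 B2 r2" using shrink.IH by blast
  have "\<exists>T B. rooted_td k E W (W \<union> (W' \<union> X)) m T B m"
  proof (rule rooted_td_join[OF 1 2])
    show "{u, v} \<notin> E" if "u \<in> W - (W' \<union> X)" "v \<in> (W' \<union> X) - W" for u v
      using that shrink.hyps(2) shrink.hyps(6)[of v u] by (auto simp: insert_commute)
  qed (use shrink.hyps in auto)
  moreover have "W \<union> (W' \<union> X) = W \<union> X" using shrink.hyps(2) by blast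
  ultimately show ?case by auto
next
  case (intro v W X)
  have W: "finite (insert v W)" "card (insert v W) \<le> Suc k" "insert v W \<inter> X = {}"
    using rd_finite[OF intro.hyps(1)] by auto
  then have "card W \<le> Suc k" using intro.hyps(2) by simp
  then have 1: "rooted_td k E W W m ({m}, {}) (\<lambda>_. W) m"
    using rooted_td_singleton by blast
  obtain T2 B2 r2 where 2: "rooted_td k E (insert v W) (insert v W \<union> X) (Suc m) T2 B2 r2"
    using intro.IH by blast
  have "\<exists>T B. rooted_td k E W (W \<union> (insert v W \<union> X)) m T B m"
    by (rule rooted_td_join[OF 1 2]) auto
  moreover have "W \<union> (insert v W \<union> X) = W \<union> insert v X" by blast
  ultimately show ?case by auto
qed

lemma tw_le_if_rd:
  assumes "graph G" "rd k (snd G) {} (fst G)"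
  shows "tw G \<le> k"
proof -
  obtain T B r where "rooted_td k (snd G) {} ({} \<union> fst G) 0 T B r"
    using rd_rooted_td[OF assms(2)] by blast
  then have D: "rooted_td k (snd G) {} (fst G) 0 T B r" by simp
  have "tree_decomposition G T B"
    using D graph_edgeD[OF assms(1)] unfolding tree_decomposition_def rooted_td_def by blast
  moreover have "\<forall>i\<in>fst T. card (B i) \<le> k + 1" using D by (simp add: rooted_td_def)
  ultimately show ?thesis unfolding tw_def by (intro Least_le) blast
qed

text \<open>Edges to the other side leave \<open>Va\<close> only at \<open>a\<close>, so a detour of
  \<open>S\<close> through \<open>Vb\<close> returns to \<open>a\<close> and can be cut out.\<close>

lemma connected_in_bridge_side:
  assumes S: "connected_in E S" "S \<subseteq> Va \<union> Vb" and disj: "Va \<inter> Vb = {}"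
    and cross: "\<And>u v. {u, v} \<in> E \<Longrightarrow> u \<in> Va \<Longrightarrow> v \<in> Vb \<Longrightarrow> u = a"
    and same: "\<And>u v. {u, v} \<in> E \<Longrightarrow> u \<in> Va \<Longrightarrow> v \<in> Va \<Longrightarrow> {u, v} \<in> Ea"
  shows "connected_in Ea (S \<inter> Va)"
proof (rule connected_inI_cut)
  fix A assume A: "A \<subseteq> S \<inter> Va" "A \<noteq> {}" "A \<noteq> S \<inter> Va"
  \<comment> \<open>Placing \<open>S \<inter> Vb\<close> on the side of \<open>a\<close> forces the
    crossing edge to lie inside \<open>Va\<close>.\<close>
  define A' where "A' = (if a \<in> A then A \<union> (S \<inter> Vb) else A)"
  obtain x where x: "x \<in> A" using A by blast
  obtain y where y: "y \<in> S \<inter> Va" "y \<notin> A" using A by blast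
  have "x \<in> A'" "x \<in> S" "y \<notin> A'" "y \<in> S" using x y A disj by (auto simp: A'_def)
  then obtain u v where uv: "u \<in> A'" "u \<in> S" "v \<in> S" "v \<notin> A'" "{u, v} \<in> E"
    using connected_in_cut[OF S(1)] by metis
  have vu: "{v, u} \<in> E" using uv(5) by (simp add: insert_commute)
  have "u \<in> Va \<and> v \<in> Va"
  proof (rule ccontr)
    assume no: "\<not> ?thesis"
    show False
    proof (cases "u \<in> Va")
      case True
      then have v: "v \<in> Vb" using no uv(3) S(2) by blast
      then have "u = a" using cross[OF uv(5)] True by simp
      then have "a \<in> A" using uv(1) True disj by (auto simp: A'_def split: if_splits)
      then show False using uv(3,4) v by (auto simp: A'_def)
    next
      case False
      then have aA: "a \<in> A" "u \<in> Vb" using uv(1) A S(2) uv(2) by (auto simp: A'_def split: if_splits)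
      then have "v \<in> Va" using uv(3,4) S(2) by (auto simp: A'_def)
      then have "v = a" using cross[OF vu] aA(2) by simp
      then show False using aA uv(4) by (auto simp: A'_def)
    qed
  qed
  then have "{u, v} \<in> Ea" "u \<in> A" "v \<in> S \<inter> Va - A"
    using same uv A disj by (auto simp: A'_def split: if_splits)
  then show "\<exists>u\<in>A. \<exists>v\<in>S \<inter> Va - A. {u, v} \<in> Ea" by blast
qed

text \<open>Applied to the set of nodes whose bags contain a given vertex, the last property gives
  decompositions on both halves that share vertices only inside the bags of \<open>r\<close> and
  \<open>x\<close>.\<close>

lemma tree_split:
  assumes T: "is_tree T" and e: "{r, x} \<in> snd T"
  obtains T1 T2 where "is_tree T1" "is_tree T2" "fst T1 \<union> fst T2 = fst T" "fst T1 \<inter> fst T2 = {}"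
    "r \<in> fst T1" "x \<in> fst T2" "snd T1 \<subseteq> snd T" "snd T2 \<subseteq> snd T"
    "\<And>S. connected_in (snd T) S \<Longrightarrow> S \<subseteq> fst T \<Longrightarrow> connected_in (snd T1) (S \<inter> fst T1) \<and>
       connected_in (snd T2) (S \<inter> fst T2) \<and>
       (S \<inter> fst T1 \<noteq> {} \<longrightarrow> S \<inter> fst T2 \<noteq> {} \<longrightarrow> r \<in> S \<and> x \<in> S)"
proof -
  define V where "V = fst T"
  define E where "E = snd T"
  have rx: "r \<in> V" "x \<in> V" "r \<noteq> x" using is_tree_edgeD[OF T e] by (auto simp: V_def)
  have edge: "u \<in> V \<and> v \<in> V" if "{u, v} \<in> E" for u v
    using is_tree_edgeD[OF T] that by (auto simp: V_def E_def)
  have bridge: "\<not> reach (E - {{u, v}}) V u v" if "{u, v} \<in> E" for u v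
    using T that unfolding is_tree_def V_def E_def by blast
  define E' where "E' = E - {{r, x}}"
  define V1 where "V1 = {v \<in> V. reach E' V r v}"
  define V2 where "V2 = V - V1"
  define E1 where "E1 = {e \<in> E'. e \<subseteq> V1}"
  define E2 where "E2 = {e \<in> E'. e \<subseteq> V2}"
  have r1: "r \<in> V1" using rx by (simp add: V1_def)
  have x2: "x \<in> V2" using rx bridge[of r x] e by (auto simp: V2_def V1_def E'_def E_def)
  have noc: "v \<in> V1 \<longleftrightarrow> u \<in> V1" if "{u, v} \<in> E'" for u v
    using that edge[of u v] reach_step[of E' V r u v] reach_step[of E' V r v u]
    by (auto simp: V1_def E'_def insert_commute)
  have crossE: "u = r \<and> v = x" if "{u, v} \<in> E" "u \<in> V1" "v \<in> V2" for u v
  proof -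
    have "{u, v} = {r, x}" using that noc[of u v] by (auto simp: E'_def V2_def)
    then show ?thesis using that r1 x2 by (auto simp: doubleton_eq_iff V2_def)
  qed
  have same: "{u, v} \<in> E1" if "{u, v} \<in> E" "u \<in> V1" "v \<in> V1" for u v
    using that x2 by (auto simp: E1_def E'_def V2_def doubleton_eq_iff)
  have same2: "{u, v} \<in> E2" if "{u, v} \<in> E" "u \<in> V2" "v \<in> V2" for u v
    using that r1 by (auto simp: E2_def E'_def V2_def doubleton_eq_iff)
  have key: "connected_in E1 (S \<inter> V1) \<and> connected_in E2 (S \<inter> V2) \<and>
       (S \<inter> V1 \<noteq> {} \<longrightarrow> S \<inter> V2 \<noteq> {} \<longrightarrow> r \<in> S \<and> x \<in> S)"
    if S: "connected_in E S" "S \<subseteq> V" for S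
  proof -
    have rxS: "r \<in> S \<and> x \<in> S" if "S \<inter> V1 \<noteq> {}" "S \<inter> V2 \<noteq> {}"
    proof -
      obtain a b where "a \<in> S" "a \<in> V1" "b \<in> S" "b \<notin> V1" using \<open>S \<inter> V1 \<noteq> {}\<close> \<open>S \<inter> V2 \<noteq> {}\<close> by (auto simp: V2_def)
      then obtain u v where "u \<in> V1" "u \<in> S" "v \<in> S" "v \<notin> V1" "{u, v} \<in> E"
        using connected_in_cut[OF S(1)] by metis
      moreover have "v \<in> V2" using \<open>v \<notin> V1\<close> \<open>v \<in> S\<close> S(2) by (auto simp: V2_def)
      ultimately show ?thesis using crossE[of u v] by blast
    qed
    have c1: "connected_in E1 (S \<inter> V1)"
      by (rule connected_in_bridge_side[OF S(1), where Vb = V2 and a = r]) (use S(2) crossE same in \<open>auto simp: V2_def\<close>)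
    have c2: "connected_in E2 (S \<inter> V2)"
    proof (rule connected_in_bridge_side[OF S(1), where Vb = V1 and a = x])
      show "u = x" if "{u, v} \<in> E" "u \<in> V2" "v \<in> V1" for u v
        using crossE[of v u] that by (simp add: insert_commute)
    qed (use S(2) same2 in \<open>auto simp: V2_def\<close>)
    show ?thesis using c1 c2 rxS by blast
  qed
  have "connected_in E V" "finite V" using T by (auto simp: is_tree_def V_def E_def graph_def)
  have tree: "is_tree (Vi, Ei)"
    if "Vi \<subseteq> V" "Ei = {e \<in> E'. e \<subseteq> Vi}" "connected_in Ei Vi" "Vi \<noteq> {}" for Vi Ei
  proof -
    have "graph (Vi, Ei)"
      unfolding graph_def fst_conv snd_conv
    proof (intro conjI ballI)
      show "finite Vi" using that(1) \<open>finite V\<close> finite_subset by blast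
      fix e assume e: "e \<in> Ei"
      then have "e \<in> snd T" using that(2) by (simp add: E'_def E_def)
      then obtain u v where "e = {u, v}" "u \<noteq> v"
        using T unfolding is_tree_def graph_def by metis
      then show "\<exists>u v. e = {u, v} \<and> u \<noteq> v \<and> u \<in> Vi \<and> v \<in> Vi" using e that(2) by auto
    qed
    moreover have "\<not> reach (Ei - {{u, v}}) Vi u v" if "{u, v} \<in> Ei" for u v
    proof
      assume "reach (Ei - {{u, v}}) Vi u v"
      then have "reach (E - {{u, v}}) V u v"
        by (rule reach_mono) (use \<open>Vi \<subseteq> V\<close> \<open>Ei = _\<close> in \<open>auto simp: E'_def\<close>)
      then show False using bridge[of u v] that \<open>Ei = _\<close> by (auto simp: E'_def)
    qed
    ultimately show ?thesis using that unfolding is_tree_def by auto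
  qed
  have V12: "V \<inter> V1 = V1" "V \<inter> V2 = V2" by (auto simp: V1_def V2_def)
  have "is_tree (V1, E1)" "is_tree (V2, E2)"
    using tree[of V1 E1] tree[of V2 E2] key[OF \<open>connected_in E V\<close>] r1 x2 V12
    by (auto simp: E1_def E2_def)
  moreover have "V1 \<union> V2 = V" "V1 \<inter> V2 = {}" by (auto simp: V1_def V2_def)
  moreover have "E1 \<subseteq> E" "E2 \<subseteq> E" by (auto simp: E1_def E2_def E'_def)
  ultimately show ?thesis
    using that[of "(V1, E1)" "(V2, E2)"] key r1 x2 unfolding V_def E_def by simp
qed

text \<open>The induction is on the number of nodes and splits the tree at an edge from the root
  \<open>r\<close> to a node \<open>x\<close>. The half at \<open>x\<close> acquires the root bag
  \<open>B r\<close> by forgetting \<open>B x - B r\<close> and then enlarging the bag with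
  \<open>shrink\<close>; \<open>union\<close> merges it with the half at \<open>r\<close>.\<close>

lemma rd_if_tree:
  assumes "is_tree T" "r \<in> fst T"
    and "\<And>i. i \<in> fst T \<Longrightarrow> finite (B i) \<and> card (B i) \<le> Suc k"
    and "\<And>v. connected_in (snd T) {i \<in> fst T. v \<in> B i}"
    and "U = (\<Union>i\<in>fst T. B i)"
    and "\<And>u v. u \<in> U \<Longrightarrow> v \<in> U \<Longrightarrow> {u, v} \<in> E \<Longrightarrow> \<exists>i\<in>fst T. u \<in> B i \<and> v \<in> B i"
  shows "rd k E (B r) (U - B r)"
  using assms
proof (induction "card (fst T)" arbitrary: T r U rule: less_induct)
  case less
  have fin: "finite (fst T)" using less.prems(1) by (simp add: is_tree_def graph_def)
  show ?case
  proof (cases "fst T = {r}")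
    case True
    then show ?thesis using less.prems(2,3,5) by (auto intro: rd.nil)
  next
    case False
    then obtain y where "y \<in> fst T" "y \<notin> {r}" using less.prems(2) by blast
    moreover have "connected_in (snd T) (fst T)" using less.prems(1) by (simp add: is_tree_def)
    ultimately obtain r' x where "r' \<in> {r}" "{r', x} \<in> snd T"
      using connected_in_cut[of "snd T" "fst T" r "{r}" y] less.prems(2) by (metis singletonI)
    then have "{r, x} \<in> snd T" by simp
    then obtain T1 T2 where T12: "is_tree T1" "is_tree T2" "fst T1 \<union> fst T2 = fst T"
      "fst T1 \<inter> fst T2 = {}" "r \<in> fst T1" "x \<in> fst T2"
      and cS: "\<And>S. connected_in (snd T) S \<Longrightarrow> S \<subseteq> fst T \<Longrightarrow> connected_in (snd T1) (S \<inter> fst T1) \<and>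
       connected_in (snd T2) (S \<inter> fst T2) \<and>
       (S \<inter> fst T1 \<noteq> {} \<longrightarrow> S \<inter> fst T2 \<noteq> {} \<longrightarrow> r \<in> S \<and> x \<in> S)"
      by (rule tree_split[OF less.prems(1)]) blast
    have sub: "{i \<in> fst T. v \<in> B i} \<inter> fst Ti = {i \<in> fst Ti. v \<in> B i}" if "Ti = T1 \<or> Ti = T2" for v Ti
      using that T12(3) by auto
    have con: "connected_in (snd T1) {i \<in> fst T1. v \<in> B i}" "connected_in (snd T2) {i \<in> fst T2. v \<in> B i}"
      and both: "{i \<in> fst T1. v \<in> B i} \<noteq> {} \<longrightarrow> {i \<in> fst T2. v \<in> B i} \<noteq> {} \<longrightarrow> v \<in> B r \<and> v \<in> B x" for v
      using cS[OF less.prems(4)[of v]] sub[of T1 v] sub[of T2 v] by auto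
    define U1 where "U1 = (\<Union>i\<in>fst T1. B i)"
    define U2 where "U2 = (\<Union>i\<in>fst T2. B i)"
    have U: "U = U1 \<union> U2" using less.prems(5) T12(3) by (auto simp: U1_def U2_def)
    have U12: "U1 \<inter> U2 \<subseteq> B r \<inter> B x" using both by (auto simp: U1_def U2_def)
    have edge: "(\<exists>i\<in>fst T1. u \<in> B i \<and> v \<in> B i) \<or> (\<exists>i\<in>fst T2. u \<in> B i \<and> v \<in> B i)"
      if "u \<in> U" "v \<in> U" "{u, v} \<in> E" for u v
      using less.prems(6)[OF that] T12(3) by blast
    have Br: "B r \<subseteq> U1" "B x \<subseteq> U2" using T12 by (auto simp: U1_def U2_def)
    have lt: "card (fst T1) < card (fst T)" "card (fst T2) < card (fst T)"
      using T12 fin by (auto intro!: psubset_card_mono)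
    have edge1: "\<exists>i\<in>fst T1. u \<in> B i \<and> v \<in> B i" if "u \<in> U1" "v \<in> U1" "{u, v} \<in> E" for u v
    proof -
      have "u \<in> U" "v \<in> U" using that U by auto
      from edge[OF this that(3)] show ?thesis
      proof
        assume "\<exists>i\<in>fst T2. u \<in> B i \<and> v \<in> B i"
        then have "u \<in> B r" "v \<in> B r" using that U12 by (auto simp: U2_def)
        then show ?thesis using T12 by blast
      qed
    qed
    have edge2: "\<exists>i\<in>fst T2. u \<in> B i \<and> v \<in> B i" if "u \<in> U2" "v \<in> U2" "{u, v} \<in> E" for u v
    proof -
      have "u \<in> U" "v \<in> U" using that U by auto
      from edge[OF this that(3)] show ?thesis
      proof
        assume "\<exists>i\<in>fst T1. u \<in> B i \<and> v \<in> B i"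
        then have "u \<in> B x" "v \<in> B x" using that U12 by (auto simp: U1_def)
        then show ?thesis using T12 by blast
      qed
    qed
    have rd1: "rd k E (B r) (U1 - B r)"
      by (rule less.hyps[OF lt(1) T12(1,5) _ con(1) U1_def edge1]) (use less.prems(3) T12(3) in auto)
    have "rd k E (B x) (U2 - B x)"
      by (rule less.hyps[OF lt(2) T12(2,6) _ con(2) U2_def edge2]) (use less.prems(3) T12(3) in auto)
    from rd_intro_set[OF this, of "B x - B r"]
    have "rd k E (B x \<inter> B r) (U2 - B r)"
    proof -
      have "B x - (B x - B r) = B x \<inter> B r" "(B x - B r) \<union> (U2 - B x) = U2 - B r"
        using Br U12 by auto
      then show ?thesis using \<open>B x - B r \<subseteq> B x \<Longrightarrow> _\<close> by auto
    qed
    then have rd2: "rd k E (B r) (U2 - B r)"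
    proof (rule rd.shrink)
      show "{u, v} \<notin> E" if uv: "u \<in> U2 - B r" "v \<in> B r - B x \<inter> B r" for u v
      proof
        assume "{u, v} \<in> E"
        then consider i where "i \<in> fst T1" "u \<in> B i" | i where "i \<in> fst T2" "v \<in> B i"
          using edge[of u v] uv U Br by blast
        then show False
        proof cases
          case 1
          then show ?thesis using uv U12 by (auto simp: U1_def)
        next
          case 2
          then show ?thesis using uv U12 Br by (auto simp: U2_def)
        qed
      qed
    qed (use less.prems(2,3) in auto)
    have "rd k E (B r) ((U1 - B r) \<union> (U2 - B r))"
    proof (rule rd.union[OF rd1 rd2])
      show "(U1 - B r) \<inter> (U2 - B r) = {}" using U12 by blast
      show "{u, v} \<notin> E" if uv: "u \<in> U1 - B r" "v \<in> U2 - B r" for u v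
      proof
        assume "{u, v} \<in> E"
        then consider "v \<in> U1" | "u \<in> U2"
          using edge[of u v] uv U unfolding U1_def U2_def by blast
        then show False using uv U12 by cases auto
      qed
    qed
    then show ?thesis using U by (simp add: Un_Diff)
  qed
qed

text \<open>The decomposition with a single bag shows that the minimum defining \<open>tw\<close> is
  attained.\<close>

lemma rd_tw:
  assumes "graph G"
  shows "rd (tw G) (snd G) {} (fst G)"
proof -
  have "connected_in {} {0::nat}"
    by (simp add: connected_in_def)
  then have "tree_decomposition G ({0}, {}) (\<lambda>_. fst G) \<and> (\<forall>i\<in>fst ({0}, {}). card (fst G) \<le> card (fst G) + 1)"
    using graph_edgeD[OF assms] by (auto simp: tree_decomposition_def is_tree_singleton)
  then have "\<exists>k T B. tree_decomposition G T B \<and> (\<forall>i\<in>fst T. card (B i) \<le> k + 1)" by blast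
  then have "\<exists>T B. tree_decomposition G T B \<and> (\<forall>i\<in>fst T. card (B i) \<le> tw G + 1)"
    unfolding tw_def by (rule LeastI_ex)
  then obtain T B where D: "tree_decomposition G T B" "\<forall>i\<in>fst T. card (B i) \<le> tw G + 1" by blast
  then obtain r where r: "r \<in> fst T" by (auto simp: tree_decomposition_def is_tree_def)
  have sub: "\<forall>i\<in>fst T. B i \<subseteq> fst G" and T: "is_tree T"
    using D by (auto simp: tree_decomposition_def)
  have fin: "finite (fst G)" using assms by (simp add: graph_def)
  have "rd (tw G) (snd G) (B r) (fst G - B r)"
  proof (rule rd_if_tree[OF T r])
    show "finite (B i) \<and> card (B i) \<le> Suc (tw G)" if "i \<in> fst T" for i
      using that D(2) sub fin finite_subset by fastforce
    show "connected_in (snd T) {i \<in> fst T. v \<in> B i}" for v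
    proof (cases "v \<in> fst G")
      case False
      then have "{i \<in> fst T. v \<in> B i} = {}" using sub by blast
      then show ?thesis by (simp only:) (simp add: connected_in_def)
    qed (use D(1) in \<open>simp add: tree_decomposition_def\<close>)
    show "fst G = (\<Union>i\<in>fst T. B i)" using D(1) by (auto simp: tree_decomposition_def)
    show "\<exists>i\<in>fst T. u \<in> B i \<and> v \<in> B i" if "{u, v} \<in> snd G" for u v
      using that D(1) by (simp add: tree_decomposition_def)
  qed
  from rd_intro_set[OF this, of "B r"] show ?thesis using sub r by (simp add: Un_absorb1)
qed

lemma tw_le_iff_rd: "graph G \<Longrightarrow> tw G \<le> k \<longleftrightarrow> rd k (snd G) {} (fst G)"
  using tw_le_if_rd rd_tw rd_mono by blast

section \<open>Partitions built part by part\<close>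

definition quotient_edges :: "'a set set \<Rightarrow> 'a set set set" where
  "quotient_edges E = {{P, Q} | P Q. P \<noteq> Q \<and> (\<exists>u\<in>P. \<exists>v\<in>Q. {u, v} \<in> E)}"

definition attached :: "'a set set \<Rightarrow> 'a set set \<Rightarrow> 'a set \<Rightarrow> 'a set set" where
  "attached E \<R> Z = {R \<in> \<R>. \<exists>r\<in>R. \<exists>z\<in>Z. {r, z} \<in> E}"

lemma quotient_edgesD: "{P, Q} \<in> quotient_edges E \<Longrightarrow> P \<noteq> Q \<and> (\<exists>u\<in>P. \<exists>v\<in>Q. {u, v} \<in> E)"
proof -
  assume "{P, Q} \<in> quotient_edges E"
  then obtain P' Q' where *: "{P, Q} = {P', Q'} \<and> P' \<noteq> Q' \<and> (\<exists>u\<in>P'. \<exists>v\<in>Q'. {u, v} \<in> E)"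
    unfolding quotient_edges_def mem_Collect_eq by (elim exE) rule
  then obtain u v where uv: "u \<in> P'" "v \<in> Q'" "{u, v} \<in> E" by (elim conjE bexE)
  have PQ: "P \<noteq> Q" "P = P' \<and> Q = Q' \<or> P = Q' \<and> Q = P'" using * by (auto simp: doubleton_eq_iff)
  have "{v, u} \<in> E" using uv(3) by (simp add: insert_commute)
  then show ?thesis using PQ uv by blast
qed

text \<open>The existing parts \<open>\<R>\<close> form the root bag of the quotient decomposition,
  so that the partitions of different components can be glued together there.\<close>

definition bounded_parts :: "'a set set \<Rightarrow> nat \<Rightarrow> nat \<Rightarrow> 'a set set \<Rightarrow> 'a set \<Rightarrow> 'a set set \<Rightarrow> bool" where
  "bounded_parts E c w \<R> C \<P> \<longleftrightarrow> \<Union>\<P> = C \<and> pairwise disjnt \<P> \<and> (\<forall>Q\<in>\<P>. Q \<noteq> {} \<and> card Q \<le> w) \<and>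
     rd c (quotient_edges E) \<R> \<P>"

lemma bounded_parts_comps:
  assumes fin: "finite S" "finite \<R>" "card \<R> \<le> Suc c"
    and ex: "\<And>Z. Z \<in> comps E S \<Longrightarrow> \<exists>\<P>. bounded_parts E c w \<R> Z \<P>"
  shows "\<exists>\<P>. bounded_parts E c w \<R> S \<P>"
proof -
  obtain p where p: "\<And>Z. Z \<in> comps E S \<Longrightarrow> bounded_parts E c w \<R> Z (p Z)" using ex by metis
  have pZ: "\<Union>(p Z) = Z" "pairwise disjnt (p Z)" "\<And>A. A \<in> p Z \<Longrightarrow> A \<noteq> {} \<and> card A \<le> w"
    "rd c (quotient_edges E) \<R> (p Z)" if "Z \<in> comps E S" for Z
    using p[OF that] unfolding bounded_parts_def by auto
  have pC: "A \<subseteq> Z" if "Z \<in> comps E S" "A \<in> p Z" for A Z using pZ(1)[OF that(1)] that(2) by blast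
  have "rd c (quotient_edges E) \<R> (\<Union>Z\<in>comps E S. p Z)"
  proof (rule rd_UNION)
    fix Z Z' assume ZZ: "Z \<in> comps E S" "Z' \<in> comps E S" "Z \<noteq> Z'"
    note disj = comps_disjoint[OF ZZ]
    show "p Z \<inter> p Z' = {}"
      using pC[OF ZZ(1)] pC[OF ZZ(2)] pZ(3)[OF ZZ(1)] disj by blast
    show "{A, B} \<notin> quotient_edges E" if AB: "A \<in> p Z" "B \<in> p Z'" for A B
    proof
      assume "{A, B} \<in> quotient_edges E"
      then obtain u v where "u \<in> A" "v \<in> B" "{u, v} \<in> E" using quotient_edgesD by blast
      then show False
        using comps_closed[OF ZZ(1), of u v] disj comps_subset[OF ZZ(2)] pC[OF ZZ(1) AB(1)] pC[OF ZZ(2) AB(2)]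
        by blast
    qed
  qed (use fin pZ(4) finite_comps in auto)
  moreover have "\<Union>(\<Union>Z\<in>comps E S. p Z) = S"
  proof -
    have "\<Union>(\<Union>Z\<in>comps E S. p Z) = (\<Union>Z\<in>comps E S. \<Union>(p Z))" by blast
    also have "\<dots> = \<Union>(comps E S)" using pZ(1) by simp
    finally show ?thesis by simp
  qed
  moreover have "pairwise disjnt (\<Union>Z\<in>comps E S. p Z)"
    unfolding pairwise_def
  proof (intro ballI impI)
    fix A B assume AB: "A \<in> (\<Union>Z\<in>comps E S. p Z)" "B \<in> (\<Union>Z\<in>comps E S. p Z)" "A \<noteq> B"
    then obtain Z Z' where ZZ: "Z \<in> comps E S" "Z' \<in> comps E S" "A \<in> p Z" "B \<in> p Z'" by blast
    show "disjnt A B"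
    proof (cases "Z = Z'")
      case True
      then show ?thesis using pairwiseD[OF pZ(2)[OF ZZ(1)] ZZ(3) _ AB(3)] ZZ(4) by blast
    next
      case False
      then show ?thesis using comps_disjoint[OF ZZ(1,2)] pC[OF ZZ(1,3)] pC[OF ZZ(2,4)]
        unfolding disjnt_def by blast
    qed
  qed
  ultimately show ?thesis using pZ(3) unfolding bounded_parts_def by (intro exI[of _ "\<Union>Z\<in>comps E S. p Z"]) blast
qed

text \<open>\<open>P\<close> is an arbitrary invariant of a component and the parts it sees. At most
  \<open>c\<close> old parts and the new part \<open>Q\<close> form a bag of at most
  \<open>Suc c\<close> elements, that is, width \<open>c\<close>. Parts that \<open>Z\<close> does
  not see are dropped by \<open>shrink\<close>, which brings the count back to \<open>c\<close>
  before the recursion continues in \<open>Z\<close>.\<close>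

lemma build_partition:
  assumes step: "\<And>C \<R>. P C \<R> \<Longrightarrow> conn E C \<Longrightarrow> C \<subseteq> V \<Longrightarrow> finite \<R> \<Longrightarrow> card \<R> \<le> c \<Longrightarrow>
      \<forall>R\<in>\<R>. R \<inter> C = {} \<Longrightarrow>
      \<exists>Q\<subseteq>C. Q \<noteq> {} \<and> card Q \<le> w \<and> (\<forall>Z\<in>comps E (C - Q).
        card (attached E (insert Q \<R>) Z) \<le> c \<and> P Z (attached E (insert Q \<R>) Z))"
    and "finite V" "conn E C" "C \<subseteq> V" "P C \<R>" "finite \<R>" "card \<R> \<le> c" "\<forall>R\<in>\<R>. R \<inter> C = {}"
  shows "\<exists>\<P>. bounded_parts E c w \<R> C \<P>"
  using assms(3-8)
proof (induction "card C" arbitrary: C \<R> rule: less_induct)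
  case less
  obtain Q where Q: "Q \<subseteq> C" "Q \<noteq> {}" "card Q \<le> w"
    and Z: "\<And>Z. Z \<in> comps E (C - Q) \<Longrightarrow> card (attached E (insert Q \<R>) Z) \<le> c \<and> P Z (attached E (insert Q \<R>) Z)"
    using step[OF less.prems(3,1,2,4-6)] by blast
  have fC: "finite C" using less.prems(2) assms(2) finite_subset by blast
  have QR: "Q \<notin> \<R>" using less.prems(6) Q by blast
  have R: "finite (insert Q \<R>)" "card (insert Q \<R>) \<le> Suc c" using less.prems(4,5) QR by auto
  have "\<exists>\<P>. bounded_parts E c w (insert Q \<R>) Z \<P>" if ZI: "Z \<in> comps E (C - Q)" for Z
  proof -
    have ZC: "Z \<subseteq> C - Q" using comps_subset[OF ZI] .
    have "\<exists>\<P>. bounded_parts E c w (attached E (insert Q \<R>) Z) Z \<P>"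
    proof (rule less.hyps)
      have "Z \<subset> C" "\<forall>R\<in>insert Q \<R>. R \<inter> Z = {}" "Z \<subseteq> C" using ZC Q less.prems(6) by blast+
      then show "card Z < card C" "Z \<subseteq> V" "\<forall>R\<in>attached E (insert Q \<R>) Z. R \<inter> Z = {}"
        using less.prems(2) psubset_card_mono[OF fC] by (auto simp: attached_def)
      show "conn E Z" using conn_comps[OF ZI] .
      show "P Z (attached E (insert Q \<R>) Z)" "card (attached E (insert Q \<R>) Z) \<le> c" using Z[OF ZI] by auto
      show "finite (attached E (insert Q \<R>) Z)" using less.prems(4) by (simp add: attached_def)
    qed
    then obtain \<P> where \<P>: "\<Union>\<P> = Z" "pairwise disjnt \<P>" "\<forall>Q\<in>\<P>. Q \<noteq> {} \<and> card Q \<le> w"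
      "rd c (quotient_edges E) (attached E (insert Q \<R>) Z) \<P>"
      unfolding bounded_parts_def by blast
    have "rd c (quotient_edges E) (insert Q \<R>) \<P>"
    proof (rule rd.shrink[OF \<P>(4) _ R])
      show "attached E (insert Q \<R>) Z \<subseteq> insert Q \<R>" by (auto simp: attached_def)
      show "insert Q \<R> \<inter> \<P> = {}"
      proof (rule equals0I)
        fix A assume A: "A \<in> insert Q \<R> \<inter> \<P>"
        have "A \<subseteq> Z" using A \<P>(1) by blast
        then have "A \<subseteq> C - Q" using ZC by simp
        moreover have "A \<noteq> {}" using A \<P>(3) by simp
        ultimately show False using A less.prems(6) by auto
      qed
      show "{A, R} \<notin> quotient_edges E" if AR: "A \<in> \<P>" "R \<in> insert Q \<R> - attached E (insert Q \<R>) Z" for A R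
      proof
        assume "{A, R} \<in> quotient_edges E"
        then obtain u v where uv: "u \<in> A" "v \<in> R" "{u, v} \<in> E"
          using quotient_edgesD by blast
        have "{v, u} \<in> E" using uv(3) by (simp add: insert_commute)
        then show False using AR \<P>(1) uv(1,2) unfolding attached_def by blast
      qed
    qed
    then show ?thesis using \<P> unfolding bounded_parts_def by blast
  qed
  then obtain \<P> where \<P>: "\<Union>\<P> = C - Q" "pairwise disjnt \<P>" "\<forall>Q\<in>\<P>. Q \<noteq> {} \<and> card Q \<le> w"
      "rd c (quotient_edges E) (insert Q \<R>) \<P>"
    using bounded_parts_comps[OF _ R, of "C - Q" E w] fC unfolding bounded_parts_def by auto
  have "rd c (quotient_edges E) \<R> (insert Q \<P>)" using rd.intro[OF \<P>(4) QR] .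
  moreover have "\<Union>(insert Q \<P>) = C" using Q(1) \<P>(1) by blast
  moreover have "pairwise disjnt (insert Q \<P>)"
    unfolding pairwise_insert disjnt_def using \<P>(1,2)[unfolded disjnt_def] by blast
  ultimately show ?case using Q(2,3) \<P>(3) unfolding bounded_parts_def by (intro exI[of _ "insert Q \<P>"]) blast
qed

lemma tpw_leI:
  fixes G :: "nat graph" and H :: "nat graph"
  assumes "graph H" "tw H \<le> c" "H_partition G H \<phi>" "finite (fst G)"
    and "\<And>x. x \<in> fst H \<Longrightarrow> card {v \<in> fst G. \<phi> v = x} \<le> w"
  shows "tpw c G \<le> w"
proof -
  have "finite (fst H)" using assms(1) by (simp add: graph_def)
  then have "partition_width G H \<phi> \<le> w"
    unfolding partition_width_def using assms(5) by (subst Max_le_iff) auto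
  then show ?thesis unfolding tpw_def using assms by (intro Least_le) blast
qed

text \<open>The host graphs in \<open>tpw\<close> live on natural numbers, so each part is
  represented by its minimum; this is injective because the parts are nonempty and disjoint.\<close>

lemma tpw_le_if_partition:
  fixes G :: "nat graph"
  assumes G: "graph G" and U: "\<Union>\<P> = fst G" and disj: "pairwise disjnt \<P>"
    and ne: "\<And>Q. Q \<in> \<P> \<Longrightarrow> Q \<noteq> {} \<and> card Q \<le> w"
    and rd: "rd c (quotient_edges (snd G)) {} \<P>"
  shows "tpw c G \<le> w"
proof -
  have fin: "finite (fst G)" using G by (simp add: graph_def)
  have finQ: "finite Q" if "Q \<in> \<P>" for Q
  proof (rule finite_subset[OF _ fin])
    show "Q \<subseteq> fst G" using that U by blast
  qed
  have mem: "Min Q \<in> Q" if "Q \<in> \<P>" for Q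
    by (rule Min_in[OF finQ[OF that]]) (use ne[OF that] in simp)
  have eq: "A = B" if "A \<in> \<P>" "B \<in> \<P>" "v \<in> A" "v \<in> B" for A B v
  proof (rule ccontr)
    assume "A \<noteq> B"
    then have "disjnt A B" using pairwiseD[OF disj that(1,2)] by blast
    then show False using that(3,4) unfolding disjnt_def by blast
  qed
  have inj: "inj_on Min \<P>"
  proof (rule inj_onI)
    fix A B assume AB: "A \<in> \<P>" "B \<in> \<P>" "Min A = Min B"
    have "Min A \<in> A" using mem[OF AB(1)] .
    moreover have "Min A \<in> B" unfolding AB(3) using mem[OF AB(2)] .
    ultimately show "A = B" using eq[OF AB(1,2)] by blast
  qed
  define H where "H = (Min ` \<P>, {{Min A, Min B} | A B. A \<in> \<P> \<and> B \<in> \<P> \<and> {A, B} \<in> quotient_edges (snd G)})"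
  define part where "part = (\<lambda>v. THE A. A \<in> \<P> \<and> v \<in> A)"
  have part: "part v = A" if "A \<in> \<P>" "v \<in> A" for v A
    unfolding part_def
  proof (rule the_equality)
    fix B assume "B \<in> \<P> \<and> v \<in> B"
    then show "B = A" using that eq by blast
  qed (use that in simp)
  have partin: "part v \<in> \<P>" "v \<in> part v" if "v \<in> fst G" for v
    using that U part by blast+
  have finP: "finite \<P>" using U fin by (metis finite_UnionD)
  have gH: "graph H"
    unfolding graph_def H_def fst_conv snd_conv
  proof (intro conjI ballI)
    show "finite (Min ` \<P>)" using finP by simp
    fix e assume "e \<in> {{Min A, Min B} | A B. A \<in> \<P> \<and> B \<in> \<P> \<and> {A, B} \<in> quotient_edges (snd G)}"
    then obtain A B where AB: "e = {Min A, Min B}" "A \<in> \<P>" "B \<in> \<P>" "{A, B} \<in> quotient_edges (snd G)" by blast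
    then have "Min A \<noteq> Min B" using quotient_edgesD[OF AB(4)] inj by (auto simp: inj_on_def)
    then show "\<exists>u v. e = {u, v} \<and> u \<noteq> v \<and> u \<in> Min ` \<P> \<and> v \<in> Min ` \<P>" using AB by blast
  qed
  have "rd c (snd H) (Min ` {}) (Min ` \<P>)"
  proof (rule rd_image[OF rd])
    show "inj_on Min ({} \<union> \<P>)" using inj by simp
    fix A B assume AB: "A \<in> {} \<union> \<P>" "B \<in> {} \<union> \<P>" "{Min A, Min B} \<in> snd H"
    then obtain A' B' where "{Min A, Min B} = {Min A', Min B'}" "A' \<in> \<P>" "B' \<in> \<P>" "{A', B'} \<in> quotient_edges (snd G)"
      by (auto simp: H_def)
    moreover from this(1) have "Min A = Min A' \<and> Min B = Min B' \<or> Min A = Min B' \<and> Min B = Min A'"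
      by (simp add: doubleton_eq_iff)
    then have "A = A' \<and> B = B' \<or> A = B' \<and> B = A'"
      using inj_onD[OF inj] AB(1,2) calculation(2,3) by blast
    then have "{A, B} = {A', B'}" by auto
    ultimately show "{A, B} \<in> quotient_edges (snd G)" by simp
  qed
  then have twH: "tw H \<le> c" using tw_le_if_rd[OF gH] by (simp add: H_def)
  have hp: "H_partition G H (\<lambda>v. Min (part v))"
    unfolding H_partition_def
  proof (intro conjI ballI allI impI)
    show "Min (part v) \<in> fst H" if "v \<in> fst G" for v using partin[OF that] by (simp add: H_def)
    fix v w assume e: "{v, w} \<in> snd G"
    then have "v \<in> fst G" "w \<in> fst G" using graph_edgeD[OF G] by blast+
    note vw = partin[OF this(1)] partin[OF this(2)]
    show "Min (part v) = Min (part w) \<or> {Min (part v), Min (part w)} \<in> snd H"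
    proof (cases "part v = part w")
      case False
      then have "{part v, part w} \<in> quotient_edges (snd G)"
        using vw e unfolding quotient_edges_def by blast
      then show ?thesis using vw unfolding H_def by auto
    qed simp
  qed
  show ?thesis
  proof (rule tpw_leI[OF gH twH hp fin])
    fix x assume "x \<in> fst H"
    then obtain A where A: "A \<in> \<P>" "x = Min A" by (auto simp: H_def)
    have "{v \<in> fst G. Min (part v) = x} \<subseteq> A"
      using A inj partin by (auto simp: inj_on_def)
    then have "card {v \<in> fst G. Min (part v) = x} \<le> card A" using finQ[OF A(1)] card_mono by blast
    then show "card {v \<in> fst G. Min (part v) = x} \<le> w" using ne[OF A(1)] by simp
  qed
qed

lemma tpw_le_if_step:
  fixes G :: "nat graph"
  assumes G: "graph G"
    and step: "\<And>C \<R>. P C \<R> \<Longrightarrow> conn (snd G) C \<Longrightarrow> C \<subseteq> fst G \<Longrightarrow> finite \<R> \<Longrightarrow> card \<R> \<le> c \<Longrightarrow>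
      \<forall>R\<in>\<R>. R \<inter> C = {} \<Longrightarrow>
      \<exists>Q\<subseteq>C. Q \<noteq> {} \<and> card Q \<le> w \<and> (\<forall>Z\<in>comps (snd G) (C - Q).
        card (attached (snd G) (insert Q \<R>) Z) \<le> c \<and> P Z (attached (snd G) (insert Q \<R>) Z))"
    and init: "\<And>C. C \<in> comps (snd G) (fst G) \<Longrightarrow> P C {}"
  shows "tpw c G \<le> w"
proof -
  have fin: "finite (fst G)" using G by (simp add: graph_def)
  have "\<exists>\<P>. bounded_parts (snd G) c w {} C \<P>" if C: "C \<in> comps (snd G) (fst G)" for C
    by (rule build_partition[where P = P and V = "fst G", OF step fin])
      (use conn_comps[OF C] comps_subset[OF C] init[OF C] in simp_all)
  then obtain \<P> where "bounded_parts (snd G) c w {} (fst G) \<P>"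
    using bounded_parts_comps[OF fin, of "{}" c "snd G" w] by auto
  then have \<P>: "\<Union>\<P> = fst G" "pairwise disjnt \<P>" "\<forall>Q\<in>\<P>. Q \<noteq> {} \<and> card Q \<le> w"
      "rd c (quotient_edges (snd G)) {} \<P>"
    unfolding bounded_parts_def by simp_all
  show ?thesis by (rule tpw_le_if_partition[OF G \<P>(1,2) bspec[OF \<P>(3)] \<P>(4)])
qed

section \<open>Paths\<close>

definition pth :: "'a set set \<Rightarrow> 'a list \<Rightarrow> bool" where
  "pth E xs \<longleftrightarrow> distinct xs \<and> successively (\<lambda>u v. {u, v} \<in> E) xs"

lemma pth_append:
  "pth E (xs @ ys) \<longleftrightarrow> pth E xs \<and> pth E ys \<and> set xs \<inter> set ys = {} \<and>
     (xs \<noteq> [] \<longrightarrow> ys \<noteq> [] \<longrightarrow> {last xs, hd ys} \<in> E)"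
  by (auto simp: pth_def successively_append_iff)

lemma pth_Cons: "pth E (x # ys) \<longleftrightarrow> x \<notin> set ys \<and> pth E ys \<and> (ys \<noteq> [] \<longrightarrow> {x, hd ys} \<in> E)"
  by (cases ys) (auto simp: pth_def)

lemma pth_Nil [simp]: "pth E []"
  by (simp add: pth_def)

lemma pth_singleton [simp]: "pth E [x]"
  by (simp add: pth_def)

lemma pth_rev: "pth E xs \<Longrightarrow> pth E (rev xs)"
  by (simp add: pth_def insert_commute)

lemma conn_path:
  assumes "conn E Y" "a \<in> Y" "b \<in> Y"
  shows "\<exists>xs. pth E xs \<and> xs \<noteq> [] \<and> set xs \<subseteq> Y \<and> hd xs = a \<and> last xs = b"
proof -
  have "reach E Y a b" using assms by (auto simp: conn_def connected_in_def)
  then show ?thesis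
  proof (induction rule: reach_induct)
    case base
    then show ?case using assms(2) by (intro exI[of _ "[a]"]) auto
  next
    case (step y z)
    then obtain xs where xs: "pth E xs" "xs \<noteq> []" "set xs \<subseteq> Y" "hd xs = a" "last xs = y" by blast
    show ?case
    proof (cases "z \<in> set xs")
      \<comment> \<open>A vertex visited before closes a loop, and the path is cut off at its
        earlier visit.\<close>
      case True
      then obtain ys zs where "xs = ys @ z # zs" by (meson split_list)
      then have "xs = (ys @ [z]) @ zs" by simp
      then have "pth E (ys @ [z])" "set (ys @ [z]) \<subseteq> Y" "hd (ys @ [z]) = a"
        using xs pth_append[of E "ys @ [z]" zs] by (auto simp: hd_append)
      then show ?thesis by (intro exI[of _ "ys @ [z]"]) auto
    next
      case False
      then have "pth E (xs @ [z])" using xs step.hyps by (simp add: pth_append)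
      then show ?thesis using xs step.hyps by (intro exI[of _ "xs @ [z]"]) auto
    qed
  qed
qed

lemma pth_conn: "pth E xs \<Longrightarrow> xs \<noteq> [] \<Longrightarrow> conn E (set xs)"
proof (induction xs)
  case (Cons x xs)
  show ?case
  proof (cases "xs = []")
    case False
    then have "conn E (set xs)" "{hd xs, x} \<in> E"
      using Cons by (auto simp: pth_Cons insert_commute)
    then show ?thesis using conn_insert[of E "set xs" "hd xs" x] False by simp
  qed simp
qed simp

section \<open>Nested attachments\<close>

fun att :: "'a set set \<Rightarrow> nat \<Rightarrow> 'a set \<Rightarrow> 'a set \<Rightarrow> bool" where
  "att E 0 S Y \<longleftrightarrow> (\<forall>s\<in>S. \<exists>y\<in>Y. {s, y} \<in> E)"
| "att E (Suc i) S Y \<longleftrightarrow> (\<exists>v\<in>Y. \<exists>Z1 Z2. conn E Z1 \<and> conn E Z2 \<and> Z1 \<subseteq> Y - {v} \<and> Z2 \<subseteq> Y - {v} \<and>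
     Z1 \<inter> Z2 = {} \<and> att E i (insert v S) Z1 \<and> att E i (insert v S) Z2)"

lemma att_mono: "att E i S Y \<Longrightarrow> Y \<subseteq> Y' \<Longrightarrow> att E i S Y'"
proof (cases i)
  case 0
  then show "att E i S Y \<Longrightarrow> Y \<subseteq> Y' \<Longrightarrow> att E i S Y'" by auto
next
  case (Suc j)
  assume "att E i S Y" "Y \<subseteq> Y'"
  then obtain v Z1 Z2 where "v \<in> Y'" "conn E Z1 \<and> conn E Z2 \<and> Z1 \<subseteq> Y' - {v} \<and> Z2 \<subseteq> Y' - {v} \<and>
     Z1 \<inter> Z2 = {} \<and> att E j (insert v S) Z1 \<and> att E j (insert v S) Z2"
    unfolding Suc att.simps by blast
  then show ?thesis unfolding Suc att.simps by blast
qed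

lemma att_adj: "att E i S Y \<Longrightarrow> s \<in> S \<Longrightarrow> \<exists>y\<in>Y. {s, y} \<in> E"
proof (induction i arbitrary: S Y)
  case (Suc i)
  then obtain v Z where "Z \<subseteq> Y - {v}" "att E i (insert v S) Z" unfolding att.simps by blast
  then show ?case using Suc.IH[of "insert v S" Z] Suc.prems(2) by blast
qed simp

text \<open>One path leads from \<open>s\<close> through \<open>Z1\<close> to \<open>v\<close> and
  another from \<open>v\<close> through \<open>Z2\<close> to \<open>s'\<close>, so each level
  doubles the length. Only neighbours of \<open>s\<close> and \<open>s'\<close> are visited, which
  is why \<open>s\<close> and \<open>s'\<close> may coincide.\<close>

lemma att_path:
  assumes "att E i S Y" "conn E Y" "s \<in> S" "s' \<in> S"
  shows "\<exists>xs. pth E xs \<and> xs \<noteq> [] \<and> set xs \<subseteq> Y \<and> {s, hd xs} \<in> E \<and> {last xs, s'} \<in> E \<and>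
    2 ^ Suc i \<le> Suc (length xs)"
  using assms
proof (induction i arbitrary: S Y s s')
  case 0
  obtain a where a: "a \<in> Y" "{s, a} \<in> E" using 0 by auto
  obtain b where b: "b \<in> Y" "{s', b} \<in> E" using 0 by auto
  note ab = a b
  obtain xs where "pth E xs" "xs \<noteq> []" "set xs \<subseteq> Y" "hd xs = a" "last xs = b"
    using conn_path[OF 0(2) ab(1,3)] by blast
  moreover have "2 ^ Suc 0 \<le> Suc (length xs)" using \<open>xs \<noteq> []\<close> by (cases xs) auto
  moreover have "{b, s'} \<in> E" using b(2) by (simp add: insert_commute)
  ultimately show ?case using ab by blast
next
  case (Suc i)
  then obtain v Z1 Z2 where v: "v \<in> Y" and Z: "conn E Z1" "conn E Z2" "Z1 \<subseteq> Y - {v}" "Z2 \<subseteq> Y - {v}"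
    "Z1 \<inter> Z2 = {}" and a: "att E i (insert v S) Z1" "att E i (insert v S) Z2"
    unfolding att.simps by blast
  obtain xs where xs: "pth E xs" "xs \<noteq> []" "set xs \<subseteq> Z1" "{s, hd xs} \<in> E" "{last xs, v} \<in> E"
    "2 ^ Suc i \<le> Suc (length xs)"
    using Suc.IH[OF a(1) Z(1), of s v] Suc.prems(3) by blast
  obtain ys where ys: "pth E ys" "ys \<noteq> []" "set ys \<subseteq> Z2" "{v, hd ys} \<in> E" "{last ys, s'} \<in> E"
    "2 ^ Suc i \<le> Suc (length ys)"
    using Suc.IH[OF a(2) Z(2), of v s'] Suc.prems(4) by blast
  have "pth E (xs @ v # ys)"
    using xs ys Z unfolding pth_append pth_Cons by auto
  moreover have "set (xs @ v # ys) \<subseteq> Y" using xs(3) ys(3) Z v by auto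
  moreover have "2 ^ Suc (Suc i) \<le> Suc (length (xs @ v # ys))" using xs(6) ys(6) by simp
  ultimately show ?case
    using xs(2,4) ys(2,5) by (intro exI[of _ "xs @ v # ys"]) simp
qed

text \<open>\<open>S\<close> may be empty here, so the path has no prescribed ends; in each half the
  vertex \<open>v\<close> plays the role of both ends.\<close>

lemma att_Suc_path:
  assumes "att E (Suc i) S Y"
  shows "\<exists>xs. pth E xs \<and> set xs \<subseteq> Y \<and> 2 ^ Suc (Suc i) \<le> Suc (length xs)"
proof -
  obtain v Z1 Z2 where v: "v \<in> Y" and Z: "conn E Z1" "conn E Z2" "Z1 \<subseteq> Y - {v}" "Z2 \<subseteq> Y - {v}"
    "Z1 \<inter> Z2 = {}" and a: "att E i (insert v S) Z1" "att E i (insert v S) Z2"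
    using assms unfolding att.simps by blast
  obtain xs where xs: "pth E xs" "xs \<noteq> []" "set xs \<subseteq> Z1" "{last xs, v} \<in> E" "2 ^ Suc i \<le> Suc (length xs)"
    using att_path[OF a(1) Z(1), of v v] by blast
  obtain ys where ys: "pth E ys" "ys \<noteq> []" "set ys \<subseteq> Z2" "{v, hd ys} \<in> E" "2 ^ Suc i \<le> Suc (length ys)"
    using att_path[OF a(2) Z(2), of v v] by blast
  have "pth E (xs @ v # ys)"
    using xs ys Z unfolding pth_append pth_Cons by auto
  moreover have "set (xs @ v # ys) \<subseteq> Y" using xs(3) ys(3) Z v by auto
  moreover have "2 ^ Suc (Suc i) \<le> Suc (length (xs @ v # ys))" using xs(5) ys(5) by simp
  ultimately show ?thesis by blast
qed

section \<open>Bounded treedepth\<close>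

text \<open>This says that the treedepth is at most \<open>d\<close>. Quantifying over all connected
  subsets rather than over components makes the property inherited by subsets at once.\<close>

fun tdl :: "'a set set \<Rightarrow> nat \<Rightarrow> 'a set \<Rightarrow> bool" where
  "tdl E 0 X \<longleftrightarrow> X = {}"
| "tdl E (Suc d) X \<longleftrightarrow> (\<forall>Y\<subseteq>X. conn E Y \<longrightarrow> (\<exists>v\<in>Y. tdl E d (Y - {v})))"

lemma tdl_mono: "tdl E d X \<Longrightarrow> Y \<subseteq> X \<Longrightarrow> tdl E d Y"
  by (cases d) auto

lemma tdl_if_conn:
  assumes "\<And>Y. Y \<subseteq> X \<Longrightarrow> conn E Y \<Longrightarrow> tdl E d Y"
  shows "tdl E d X"
proof (cases d)
  case 0
  have "X = {}"
  proof (rule ccontr)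
    assume "X \<noteq> {}"
    then obtain x where "x \<in> X" by blast
    then show False using assms[of "{x}"] 0 by simp
  qed
  then show ?thesis using 0 by simp
next
  case (Suc d')
  show ?thesis unfolding Suc tdl.simps
  proof (intro allI impI)
    fix Y assume "Y \<subseteq> X" "conn E Y"
    then have "tdl E (Suc d') Y" using assms Suc by blast
    then show "\<exists>v\<in>Y. tdl E d' (Y - {v})" unfolding tdl.simps using \<open>conn E Y\<close> by blast
  qed
qed

text \<open>This is the depth-first search argument: after \<open>v\<close> is deleted, each
  component contains a neighbour of \<open>v\<close>, and a path starting there extends backwards by
  \<open>v\<close>.\<close>

lemma tdl_if_no_path:
  assumes "conn E Y" "v \<in> Y"
    and "\<And>xs. pth E xs \<Longrightarrow> xs \<noteq> [] \<Longrightarrow> hd xs = v \<Longrightarrow> set xs \<subseteq> Y \<Longrightarrow> length xs \<le> d"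
  shows "tdl E d Y"
  using assms
proof (induction d arbitrary: Y v)
  case 0
  then show ?case using 0(3)[of "[v]"] by simp
next
  case (Suc d)
  have *: "tdl E d (Y - {v})"
  proof (rule tdl_if_conn)
    fix Z assume Z: "Z \<subseteq> Y - {v}" "conn E Z"
    obtain C where C: "C \<in> comps E (Y - {v})" "Z \<subseteq> C" using conn_in_comp[OF Z(2,1)] .
    obtain q z where qz: "q \<in> {v}" "z \<in> C" "{q, z} \<in> E"
      using comps_attached[OF Suc.prems(1) C(1)] Suc.prems(2) by blast
    have CY: "C \<subseteq> Y - {v}" using comps_subset[OF C(1)] .
    have "tdl E d C"
    proof (rule Suc.IH[OF conn_comps[OF C(1)] qz(2)])
      fix xs assume xs: "pth E xs" "xs \<noteq> []" "hd xs = z" "set xs \<subseteq> C"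
      then have "pth E (v # xs)" using qz CY by (auto simp: pth_Cons)
      then show "length xs \<le> d" using Suc.prems(3)[of "v # xs"] Suc.prems(2) xs(4) CY by auto
    qed
    then show "tdl E d Z" using tdl_mono C(2) by blast
  qed
  show ?case unfolding tdl.simps
  proof (intro allI impI)
    fix Z assume Z: "Z \<subseteq> Y" "conn E Z"
    show "\<exists>u\<in>Z. tdl E d (Z - {u})"
    proof (cases "v \<in> Z")
      case True
      then show ?thesis using tdl_mono[OF *, of "Z - {v}"] Z(1) by blast
    next
      case False
      obtain u where "u \<in> Z" using conn_ne[OF Z(2)] by blast
      then show ?thesis using tdl_mono[OF *, of "Z - {u}"] Z(1) False by blast
    qed
  qed
qed

text \<open>The size of the set constructed in \<open>td_closure\<close>: one deleted vertex, and a
  recursively constructed set in each of at most \<open>r * Suc a\<close> bad components. Here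
  \<open>r\<close> bounds the number of pairs to be treated and \<open>a\<close> the number of
  vertices deleted on the way down.\<close>

fun closure_bound :: "nat \<Rightarrow> nat \<Rightarrow> nat \<Rightarrow> nat" where
  "closure_bound r 0 a = 0"
| "closure_bound r (Suc d) a = Suc (r * Suc a * closure_bound r d (Suc a))"

lemma closure_bound_mono: "d \<le> d' \<Longrightarrow> closure_bound r d a \<le> closure_bound r d' a"
proof (induction d' arbitrary: d a)
  case (Suc d')
  then show ?case by (cases d) (auto intro!: mult_le_mono)
qed simp

text \<open>Two components of \<open>X - {v}\<close> in which \<open>\<tau>\<close> extended by the same \<open>u\<close> is \<open>i\<close>-attached would
  make \<open>\<tau>\<close> itself \<open>(i + 1)\<close>-attached, so only boundedly many components need further treatment.\<close>

lemma td_closure: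
  assumes base: "\<And>\<tau> i. (\<tau>, i) \<in> \<T> \<Longrightarrow> \<not> att E (Suc i) \<tau> X0"
    and \<T>: "finite \<T>" "card \<T> \<le> r" and finX0: "finite X0"
  shows "tdl E d X \<Longrightarrow> conn E X \<Longrightarrow> X \<subseteq> X0 \<Longrightarrow> U \<subseteq> X0 - X \<Longrightarrow> card U \<le> a \<Longrightarrow>
    \<exists>Q\<subseteq>X. Q \<noteq> {} \<and> card Q \<le> closure_bound r d a \<and>
      (\<forall>Z. conn E Z \<longrightarrow> Z \<subseteq> X - Q \<longrightarrow> tdl E (d - 1) Z \<and>
        (\<forall>(\<tau>, i)\<in>\<T>. \<forall>u\<in>U \<union> Q. \<not> att E i (insert u \<tau>) Z))"
proof (induction d arbitrary: X U a)
  case 0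
  then show ?case using conn_ne by auto
next
  case (Suc d)
  obtain v where v: "v \<in> X" "tdl E d (X - {v})" using Suc.prems(1,2) by auto
  have finU: "finite U" "finite X" using Suc.prems(3,4) finX0 finite_subset by blast+
  \<comment> \<open>These are the components that violate the conclusion with one of the vertices
    deleted so far; only they are refined further.\<close>
  define bad where "bad = {C \<in> comps E (X - {v}). \<exists>p\<in>\<T> \<times> insert v U. att E (snd (fst p)) (insert (snd p) (fst (fst p))) C}"
  have "\<forall>C\<in>bad. \<exists>p. p \<in> \<T> \<times> insert v U \<and> att E (snd (fst p)) (insert (snd p) (fst (fst p))) C"
    unfolding bad_def by blast
  then have "\<exists>h. \<forall>C\<in>bad. h C \<in> \<T> \<times> insert v U \<and> att E (snd (fst (h C))) (insert (snd (h C)) (fst (fst (h C)))) C"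
    by (rule bchoice)
  then obtain h where h: "\<And>C. C \<in> bad \<Longrightarrow> h C \<in> \<T> \<times> insert v U"
    "\<And>C. C \<in> bad \<Longrightarrow> att E (snd (fst (h C))) (insert (snd (h C)) (fst (fst (h C)))) C" by blast
  have badC: "C \<in> comps E (X - {v})" if "C \<in> bad" for C using that by (simp add: bad_def)
  have Csub: "C \<subseteq> X - {v}" if "C \<in> comps E (X - {v})" for C using comps_subset[OF that] .
  have "inj_on h bad"
  proof (rule inj_onI, rule ccontr)
    fix C C' assume C: "C \<in> bad" "C' \<in> bad" "h C = h C'" "C \<noteq> C'"
    obtain \<tau> i u where p: "h C = ((\<tau>, i), u)" by (metis prod.collapse)
    have t: "(\<tau>, i) \<in> \<T>" "u \<in> insert v U" using h(1)[OF C(1)] p by auto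
    have a: "att E i (insert u \<tau>) C" "att E i (insert u \<tau>) C'" using h(2)[OF C(1)] h(2)[OF C(2)] p C(3) by auto
    have "u \<in> X0" "C \<subseteq> X0 - {u}" "C' \<subseteq> X0 - {u}"
      using t(2) Csub[OF badC[OF C(1)]] Csub[OF badC[OF C(2)]] Suc.prems(3,4) v(1) by auto
    moreover have "C \<inter> C' = {}" using comps_disjoint badC C by blast
    ultimately have "att E (Suc i) \<tau> X0"
      unfolding att.simps using a conn_comps[OF badC[OF C(1)]] conn_comps[OF badC[OF C(2)]] by blast
    then show False using base[OF t(1)] by blast
  qed
  then have "card bad \<le> card (\<T> \<times> insert v U)"
    using card_inj_on_le[of h bad "\<T> \<times> insert v U"] h(1) \<T>(1) finU by blast
  also have "\<dots> \<le> r * Suc a"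
    unfolding card_cartesian_product using \<T>(2) Suc.prems(5) finU card_insert_le_m1[of "Suc a" U v]
    by (intro mult_le_mono) (auto simp: card_insert_if)
  finally have card_bad: "card bad \<le> r * Suc a" .
  define ok where "ok = (\<lambda>C Q. Q \<subseteq> C \<and> Q \<noteq> {} \<and> card Q \<le> closure_bound r d (Suc a) \<and>
      (\<forall>Z. conn E Z \<longrightarrow> Z \<subseteq> C - Q \<longrightarrow> tdl E (d - 1) Z \<and>
        (\<forall>(\<tau>, i)\<in>\<T>. \<forall>u\<in>insert v U \<union> Q. \<not> att E i (insert u \<tau>) Z)))"
  have "\<exists>Q. ok C Q" if "C \<in> bad" for C
  proof -
    have C: "C \<subseteq> X - {v}" "conn E C" using Csub conn_comps badC that by blast+
    have "tdl E d C" using tdl_mono[OF v(2) C(1)] .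
    moreover have "C \<subseteq> X0" "insert v U \<subseteq> X0 - C" using C(1) Suc.prems(3,4) v(1) by auto
    moreover have "card (insert v U) \<le> Suc a" using Suc.prems(5) finU by (simp add: card_insert_if)
    ultimately show ?thesis unfolding ok_def using Suc.IH[of C "insert v U" "Suc a"] C(2) by simp
  qed
  then obtain q where q: "\<And>C. C \<in> bad \<Longrightarrow> ok C (q C)" by metis
  define Q where "Q = insert v (\<Union>C\<in>bad. q C)"
  have finbad: "finite bad" using finite_comps[of "X - {v}" E] finU by (simp add: bad_def)
  have qC: "q C \<subseteq> C" if "C \<in> bad" for C using q[OF that] by (simp add: ok_def)
  have "card Q \<le> Suc (card (\<Union>C\<in>bad. q C))" unfolding Q_def by (rule card_insert_le_m1) simp_all
  also have "card (\<Union>C\<in>bad. q C) \<le> (\<Sum>C\<in>bad. card (q C))" by (rule card_UN_le[OF finbad])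
  also have "\<dots> \<le> (\<Sum>C\<in>bad. closure_bound r d (Suc a))"
    by (rule sum_mono) (use q in \<open>auto simp: ok_def\<close>)
  also have "\<dots> \<le> r * Suc a * closure_bound r d (Suc a)" using card_bad by simp
  finally have cardQ: "card Q \<le> closure_bound r (Suc d) a" by simp
  have QX: "Q \<subseteq> X" using v(1) qC Csub badC unfolding Q_def by blast
  have main: "\<not> att E i (insert u \<tau>) Z"
    if Z: "conn E Z" "Z \<subseteq> X - Q" and t: "(\<tau>, i) \<in> \<T>" and u: "u \<in> U \<union> Q" for Z \<tau> i u
  proof
    assume a: "att E i (insert u \<tau>) Z"
    have "Z \<subseteq> X - {v}" using Z(2) by (auto simp: Q_def)
    then obtain C where C: "C \<in> comps E (X - {v})" "Z \<subseteq> C" using conn_in_comp Z(1) by metis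
    obtain z where z: "z \<in> Z" "{u, z} \<in> E" using att_adj[OF a] by blast
    \<comment> \<open>An attached set contains a neighbour of \<open>u\<close>, so \<open>u\<close>
      was deleted above or lies in the same component as \<open>Z\<close>.\<close>
    have uC: "u \<in> insert v U \<or> u \<in> C"
    proof (rule ccontr)
      assume "\<not> ?thesis"
      then have "u \<in> X - {v}" "u \<notin> C" using u QX by auto
      then show False using comps_closed[OF C(1), of z u] z C(2) by (auto simp: insert_commute)
    qed
    show False
    proof (cases "C \<in> bad")
      case False
      \<comment> \<open>\<open>Q\<close> takes no vertex from a component that is not bad.\<close>
      have "u \<notin> C"
      proof
        assume "u \<in> C"
        then have "u \<notin> insert v U" using Csub[OF C(1)] Suc.prems(4) by blast
        then obtain C' where "C' \<in> bad" "u \<in> C'" using u qC unfolding Q_def by blast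
        then show False using comps_disjoint[OF C(1) badC[of C']] False \<open>u \<in> C\<close> by blast
      qed
      then have "((\<tau>, i), u) \<in> \<T> \<times> insert v U" using uC t by blast
      moreover have "att E (snd (fst ((\<tau>, i), u))) (insert (snd ((\<tau>, i), u)) (fst (fst ((\<tau>, i), u)))) C"
        using att_mono[OF a C(2)] by simp
      ultimately have "C \<in> bad" using C(1) unfolding bad_def by blast
      then show False using False by simp
    next
      case True
      have "u \<in> insert v U \<union> q C"
      proof (cases "u \<in> insert v U")
        case False
        then obtain C' where C': "C' \<in> bad" "u \<in> q C'" using u unfolding Q_def by blast
        then have "C' = C" using comps_disjoint[OF C(1) badC[of C']] qC[of C'] uC False by blast
        then show ?thesis using C' by blast
      qed blast
      moreover have "Z \<subseteq> C - q C" using Z(2) C(2) True unfolding Q_def by blast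
      ultimately show False using q[OF True] Z(1) t a unfolding ok_def by blast
    qed
  qed
  have "tdl E (Suc d - 1) Z" if "Z \<subseteq> X - Q" for Z
    using tdl_mono[OF v(2), of Z] that by (auto simp: Q_def)
  then have "\<forall>Z. conn E Z \<longrightarrow> Z \<subseteq> X - Q \<longrightarrow> tdl E (Suc d - 1) Z \<and>
        (\<forall>(\<tau>, i)\<in>\<T>. \<forall>u\<in>U \<union> Q. \<not> att E i (insert u \<tau>) Z)"
    using main by blast
  moreover have "Q \<noteq> {}" by (simp add: Q_def)
  ultimately show ?case using QX cardQ by blast
qed

text \<open>\<open>j\<close> counts the steps taken and \<open>w\<close> bounds the parts present at
  the start. The first argument of \<open>closure_bound\<close> counts the pairs of a subset of at
  most \<open>c\<close> parts and a level at most \<open>c\<close>. Sizes grow with every step, but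
  there are at most \<open>D\<close> steps because each lowers the treedepth bound.\<close>

fun short_width :: "nat \<Rightarrow> nat \<Rightarrow> nat \<Rightarrow> nat \<Rightarrow> nat" where
  "short_width c D w 0 = w"
| "short_width c D w (Suc j) = short_width c D w j +
     closure_bound (2 ^ (c * short_width c D w j) * Suc c) D 0"

lemma short_width_mono: "i \<le> j \<Longrightarrow> short_width c D w i \<le> short_width c D w j"
  by (induction rule: dec_induct) auto

text \<open>The number of chosen representatives and the forbidden level always add up to
  \<open>Suc c\<close>. Thus representatives of \<open>c\<close> old parts and a vertex of the new
  one, all with neighbours in one component, would be a forbidden attachment of level 0. The
  difference \<open>D - d\<close> is the number of steps taken.\<close>

definition short_state :: "'a set set \<Rightarrow> nat \<Rightarrow> nat \<Rightarrow> nat \<Rightarrow> 'a set \<Rightarrow> 'a set set \<Rightarrow> bool" where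
  "short_state E c D w C \<R> \<longleftrightarrow> (\<exists>d\<le>D. tdl E d C \<and>
     (\<forall>R\<in>\<R>. finite R \<and> card R \<le> short_width c D w (D - d)) \<and>
     (\<forall>\<R>'\<subseteq>\<R>. \<forall>f. (\<forall>R\<in>\<R>'. f R \<in> R) \<longrightarrow> \<not> att E (Suc c - card \<R>') (f ` \<R>') C))"

lemma card_Union_le_mult:
  assumes "finite \<R>" "\<And>R. R \<in> \<R> \<Longrightarrow> card R \<le> w"
  shows "card (\<Union>\<R>) \<le> card \<R> * w"
proof -
  have "card (\<Union>\<R>) \<le> (\<Sum>R\<in>\<R>. card R)" using card_UN_le[OF assms(1), of id] by simp
  also have "\<dots> \<le> (\<Sum>R\<in>\<R>. w)" by (rule sum_mono) (rule assms(2))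
  finally show ?thesis by simp
qed

lemma short_state_step:
  assumes st: "short_state E c D w C \<R>" and C: "conn E C" "finite C"
    and R: "finite \<R>" "card \<R> \<le> c" "\<forall>R\<in>\<R>. R \<inter> C = {}"
  shows "\<exists>Q\<subseteq>C. Q \<noteq> {} \<and> card Q \<le> short_width c D w D \<and> (\<forall>Z\<in>comps E (C - Q).
    card (attached E (insert Q \<R>) Z) \<le> c \<and> short_state E c D w Z (attached E (insert Q \<R>) Z))"
proof -
  obtain d where d: "d \<le> D" "tdl E d C" "\<And>R. R \<in> \<R> \<Longrightarrow> finite R \<and> card R \<le> short_width c D w (D - d)"
    and inv: "\<And>\<R>' f. \<R>' \<subseteq> \<R> \<Longrightarrow> (\<And>R. R \<in> \<R>' \<Longrightarrow> f R \<in> R) \<Longrightarrow> \<not> att E (Suc c - card \<R>') (f ` \<R>') C"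
    using st unfolding short_state_def by (elim exE conjE) auto
  have d0: "d \<noteq> 0" using d(2) conn_ne[OF C(1)] by (cases d) auto
  define wj where "wj = short_width c D w (D - d)"
  \<comment> \<open>These pairs fail to be attached at the next higher level. Removing the set from
    \<open>td_closure\<close> makes them fail one level lower even after a vertex of that set is
    added, and so trades one level for one more part.\<close>
  define \<T> where "\<T> = {(\<tau>, i). \<tau> \<subseteq> \<Union>\<R> \<and> i \<le> c \<and> \<not> att E (Suc i) \<tau> C}"
  define r where "r = 2 ^ (c * wj) * Suc c"
  have finU: "finite (\<Union>\<R>)" using R(1) d(3) by blast
  have sub: "\<T> \<subseteq> Pow (\<Union>\<R>) \<times> {..c}" by (auto simp: \<T>_def)
  have finT: "finite \<T>" using finite_subset[OF sub] finU by simp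
  have "card (\<Union>\<R>) \<le> card \<R> * wj" by (rule card_Union_le_mult[OF R(1)]) (use d(3) wj_def in auto)
  also have "\<dots> \<le> c * wj" using R(2) by simp
  finally have "card (\<Union>\<R>) \<le> c * wj" .
  then have "card (Pow (\<Union>\<R>) \<times> {..c}) \<le> r"
    using finU unfolding r_def card_cartesian_product card_Pow[OF finU] by (intro mult_le_mono) auto
  then have cT: "card \<T> \<le> r"
    using card_mono[OF _ sub] finU by (meson finite_Pow_iff finite_SigmaI finite_atMost le_trans)
  have base: "\<not> att E (Suc i) \<tau> C" if "(\<tau>, i) \<in> \<T>" for \<tau> i using that by (simp add: \<T>_def)
  obtain Q where Q: "Q \<subseteq> C" "Q \<noteq> {}" "card Q \<le> closure_bound r d 0"
    and QZ: "\<And>Z. conn E Z \<Longrightarrow> Z \<subseteq> C - Q \<Longrightarrow> tdl E (d - 1) Z \<and>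
        (\<forall>(\<tau>, i)\<in>\<T>. \<forall>u\<in>{} \<union> Q. \<not> att E i (insert u \<tau>) Z)"
    using td_closure[OF base finT cT C(2) d(2) C(1), of "{}" 0] by auto
  have "closure_bound r d 0 \<le> closure_bound r D 0" by (rule closure_bound_mono[OF d(1)])
  also have "\<dots> \<le> short_width c D w (Suc (D - d))" by (simp add: r_def wj_def)
  finally have cQ: "card Q \<le> short_width c D w (Suc (D - d))" using Q(3) by simp
  have QR: "Q \<notin> \<R>" using Q R(3) by blast
  have "card (attached E (insert Q \<R>) Z) \<le> c \<and> short_state E c D w Z (attached E (insert Q \<R>) Z)"
    if Z: "Z \<in> comps E (C - Q)" for Z
  proof
    have Zc: "conn E Z" "Z \<subseteq> C - Q" using conn_comps[OF Z] comps_subset[OF Z] .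
    have tr: "(f ` \<R>', c - card \<R>') \<in> \<T>" if "\<R>' \<subseteq> \<R>" "\<And>R. R \<in> \<R>' \<Longrightarrow> f R \<in> R" for \<R>' f
    proof -
      have "card \<R>' \<le> c" using card_mono[OF R(1) that(1)] R(2) by simp
      then have "Suc (c - card \<R>') = Suc c - card \<R>'" by simp
      then have "\<not> att E (Suc (c - card \<R>')) (f ` \<R>') C" using inv[OF that] by simp
      moreover have "f ` \<R>' \<subseteq> \<Union>\<R>" using that by blast
      ultimately show ?thesis unfolding \<T>_def by simp
    qed
    have no: "\<not> att E i (insert u \<tau>) Z" if "(\<tau>, i) \<in> \<T>" "u \<in> Q" for \<tau> i u
      using QZ[OF Zc] that by blast
    show "card (attached E (insert Q \<R>) Z) \<le> c"
    proof (cases "card \<R> < c")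
      case True
      have "card (attached E (insert Q \<R>) Z) \<le> card (insert Q \<R>)"
        using R(1) by (intro card_mono) (auto simp: attached_def)
      then show ?thesis using True R(1) QR by simp
    next
      case False
      \<comment> \<open>If all \<open>c\<close> old parts were seen, their vertices adjacent to
        \<open>Z\<close> and a vertex of \<open>Q\<close> adjacent to \<open>Z\<close> would form a
        0-attached set.\<close>
      have "\<exists>R\<in>\<R>. \<forall>r\<in>R. \<forall>z\<in>Z. {r, z} \<notin> E"
      proof (rule ccontr)
        assume "\<not> ?thesis"
        then have "\<forall>R\<in>\<R>. \<exists>r. r \<in> R \<and> (\<exists>z\<in>Z. {r, z} \<in> E)" by blast
        then obtain f where f: "\<And>R. R \<in> \<R> \<Longrightarrow> f R \<in> R \<and> (\<exists>z\<in>Z. {f R, z} \<in> E)" by metis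
        obtain q z where q: "q \<in> Q" "z \<in> Z" "{q, z} \<in> E"
          using comps_attached[OF C(1) Z] Q by blast
        have "(f ` \<R>, c - card \<R>) \<in> \<T>" using tr[of \<R> f] f by blast
        then have "\<not> att E (c - card \<R>) (insert q (f ` \<R>)) Z" using no q(1) by blast
        then show False using f q False R(2) by auto
      qed
      then obtain R where "R \<in> \<R>" "attached E (insert Q \<R>) Z \<subseteq> insert Q (\<R> - {R})"
        using Q R(3) QR unfolding attached_def by blast
      then have "card (attached E (insert Q \<R>) Z) \<le> card (insert Q (\<R> - {R}))"
        using R(1) by (intro card_mono) auto
      also have "\<dots> = card \<R>" using \<open>R \<in> \<R>\<close> R(1) QR card_Suc_Diff1[of \<R> R] by simp
      finally show ?thesis using R(2) by simp
    qed
    have eqD: "D - (d - 1) = Suc (D - d)" using d0 d(1) by simp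
    show "short_state E c D w Z (attached E (insert Q \<R>) Z)"
      unfolding short_state_def
    proof (intro exI[of _ "d - 1"] conjI ballI allI impI)
      show "d - 1 \<le> D" using d(1) by simp
      show "tdl E (d - 1) Z" using QZ[OF Zc] by blast
      fix R assume RR: "R \<in> attached E (insert Q \<R>) Z"
      then consider "R = Q" | "R \<in> \<R>" by (auto simp: attached_def)
      then show "finite R" "card R \<le> short_width c D w (D - (d - 1))"
        unfolding eqD using cQ Q(1) C(2) finite_subset d(3)[of R] by (cases; force)+
    next
      fix \<R>' f assume a: "\<R>' \<subseteq> attached E (insert Q \<R>) Z" "\<forall>R\<in>\<R>'. f R \<in> R"
      show "\<not> att E (Suc c - card \<R>') (f ` \<R>') Z"
      proof (cases "Q \<in> \<R>'")
        case False
        then have "\<not> att E (Suc c - card \<R>') (f ` \<R>') C" using a by (intro inv) (auto simp: attached_def)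
        then show ?thesis using att_mono Zc(2) by blast
      next
        case True
        \<comment> \<open>The representative in \<open>Q\<close> is split off; the others are
          covered by the old invariant one level higher.\<close>
        define \<R>0 where "\<R>0 = \<R>' - {Q}"
        have R0: "\<R>0 \<subseteq> \<R>" "\<R>' = insert Q \<R>0" "Q \<notin> \<R>0" "finite \<R>0"
          using a True R(1) finite_subset[of \<R>0 \<R>] unfolding \<R>0_def attached_def by auto
        have "f R \<in> R" if "R \<in> \<R>0" for R using a(2) R0(2) that by simp
        then have "(f ` \<R>0, c - card \<R>0) \<in> \<T>" by (rule tr[OF R0(1)])
        moreover have "f Q \<in> Q" using a True by blast
        ultimately have "\<not> att E (c - card \<R>0) (insert (f Q) (f ` \<R>0)) Z" using no by blast
        then show ?thesis using R0 by simp
      qed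
    qed
  qed
  moreover have "card Q \<le> short_width c D w D"
    by (rule le_trans[OF cQ short_width_mono]) (use d0 d(1) in linarith)
  ultimately show ?thesis using Q by blast
qed

section \<open>Hitting sets in rooted decompositions\<close>

definition nbs :: "'a set set \<Rightarrow> 'a set \<Rightarrow> 'a set" where
  "nbs E Y = {q. \<exists>y\<in>Y. {q, y} \<in> E}"

text \<open>The component of \<open>Y \<inter> (W \<union> X)\<close> around \<open>y\<close> can be
  left only through \<open>W\<close>, and it must be left because \<open>Y\<close> is not contained
  in \<open>X\<close>. This transfers statements about connected sets meeting \<open>W\<close> to
  larger sets.\<close>

lemma conn_piece:
  assumes Y: "conn E Y" "y \<in> Y" "y \<in> W \<union> X" "\<not> Y \<subseteq> X"
    and cl: "\<And>u v. u \<in> X \<Longrightarrow> v \<in> Y \<Longrightarrow> {u, v} \<in> E \<Longrightarrow> v \<in> W \<union> X"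
  obtains Y' where "conn E Y'" "y \<in> Y'" "Y' \<subseteq> Y \<inter> (W \<union> X)" "Y' \<inter> W \<noteq> {}"
proof -
  have "y \<in> Y \<inter> (W \<union> X)" using Y by blast
  then obtain Y' where Y': "Y' \<in> comps E (Y \<inter> (W \<union> X))" "{y} \<subseteq> Y'"
    using conn_in_comp[OF conn_singleton, of y "Y \<inter> (W \<union> X)" E] by blast
  have sub: "Y' \<subseteq> Y \<inter> (W \<union> X)" using comps_subset[OF Y'(1)] .
  have "Y' \<inter> W \<noteq> {}"
  proof
    assume no: "Y' \<inter> W = {}"
    then have "Y' \<subseteq> X" using sub by blast
    then obtain b where "b \<in> Y" "b \<notin> Y'" using Y(4) by blast
    then obtain u v where uv: "u \<in> Y'" "v \<in> Y" "v \<notin> Y'" "{u, v} \<in> E"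
      using conn_cut[OF Y(1,2)] Y'(2) by (metis insert_subset)
    have "v \<in> W \<union> X" using cl[of u v] uv \<open>Y' \<subseteq> X\<close> by blast
    then have "v \<in> Y'" using comps_closed[OF Y'(1) uv(1)] uv by blast
    then show False using uv(3) by simp
  qed
  then show ?thesis using that[of Y'] conn_comps[OF Y'(1)] Y'(2) sub by blast
qed

text \<open>The set \<open>D\<close> is the bag marked last below the root bag \<open>W\<close>: every connected set meeting \<open>W\<close>
  sees \<open>Q\<close> only inside \<open>D\<close>. A bag is marked when it completes a bad set or joins two marked
  subtrees, so there are fewer than twice as many marked bags as disjoint bad sets.\<close>

definition hitting :: "nat \<Rightarrow> 'a set set \<Rightarrow> ('a set \<Rightarrow> bool) \<Rightarrow> 'a set \<Rightarrow> 'a set \<Rightarrow> 'a set \<Rightarrow> 'a set \<Rightarrow> 'a set set \<Rightarrow> nat \<Rightarrow> bool" where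
  "hitting k E bad W X Q D F m \<longleftrightarrow> Q \<subseteq> W \<union> X \<and> D \<subseteq> Q \<and> card D \<le> Suc k \<and> W \<inter> Q \<subseteq> D \<and>
     finite F \<and> pairwise disjnt F \<and> (\<forall>A\<in>F. conn E A \<and> bad A \<and> A \<subseteq> X) \<and>
     card Q \<le> Suc k * m \<and> m + (if Q = {} then 0 else 1) \<le> 2 * card F \<and>
     (\<forall>Y. conn E Y \<longrightarrow> Y \<subseteq> W \<union> X - Q \<longrightarrow> Y \<inter> W \<noteq> {} \<longrightarrow> nbs E Y \<inter> Q \<subseteq> D \<and> (\<forall>A\<in>F. A \<inter> Y = {})) \<and>
     (\<forall>Y. conn E Y \<longrightarrow> Y \<subseteq> X - Q \<longrightarrow> \<not> bad Y \<and> card (nbs E Y \<inter> Q) \<le> 2 * Suc k)"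

lemma hitting_basic:
  assumes "hitting k E bad W X Q D F m"
  shows "Q \<subseteq> W \<union> X" "D \<subseteq> Q" "card D \<le> Suc k" "W \<inter> Q \<subseteq> D"
    "finite F" "pairwise disjnt F" "\<forall>A\<in>F. conn E A \<and> bad A \<and> A \<subseteq> X"
    "card Q \<le> Suc k * m" "m + (if Q = {} then 0 else 1) \<le> 2 * card F"
  by (insert assms, unfold hitting_def, (elim conjE, assumption)+)

lemma hitting_meeting:
  assumes "hitting k E bad W X Q D F m" "conn E Y" "Y \<subseteq> W \<union> X - Q" "Y \<inter> W \<noteq> {}"
  shows "nbs E Y \<inter> Q \<subseteq> D \<and> (\<forall>A\<in>F. A \<inter> Y = {})"
proof -
  have "\<forall>Y. conn E Y \<longrightarrow> Y \<subseteq> W \<union> X - Q \<longrightarrow> Y \<inter> W \<noteq> {} \<longrightarrow> nbs E Y \<inter> Q \<subseteq> D \<and> (\<forall>A\<in>F. A \<inter> Y = {})"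
    using assms(1) unfolding hitting_def by (elim conjE)
  then show ?thesis using assms(2-) by simp
qed

lemma hitting_below:
  assumes "hitting k E bad W X Q D F m" "conn E Y" "Y \<subseteq> X - Q"
  shows "\<not> bad Y \<and> card (nbs E Y \<inter> Q) \<le> 2 * Suc k"
proof -
  have "\<forall>Y. conn E Y \<longrightarrow> Y \<subseteq> X - Q \<longrightarrow> \<not> bad Y \<and> card (nbs E Y \<inter> Q) \<le> 2 * Suc k"
    using assms(1) unfolding hitting_def by (elim conjE)
  then show ?thesis using assms(2-) by simp
qed

text \<open>This shows why marking \<open>W\<close> keeps the number of neighbours bounded. If
  \<open>Y\<close> has a neighbour in \<open>W - Q\<close>, adding it gives a connected set meeting
  the root bag, which sees \<open>Q\<close> only inside \<open>D\<close>; then \<open>Y\<close> sees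
  only \<open>D\<close> and \<open>W\<close>, two bags. Otherwise the marking adds no neighbour of
  \<open>Y\<close>.\<close>

lemma hitting_mark:
  assumes H: "hitting k E bad W X Q D F m" and fin: "finite W" "finite X" "card W \<le> Suc k" "W \<inter> X = {}"
    and Y: "conn E Y" "Y \<subseteq> X - Q"
    and cl: "\<And>w. w \<in> nbs E Y \<Longrightarrow> w \<in> Q' \<Longrightarrow> w \<in> Q \<union> W" and QQ: "Q \<subseteq> Q'"
  shows "\<not> bad Y \<and> card (nbs E Y \<inter> Q') \<le> 2 * Suc k"
proof
  show "\<not> bad Y" using hitting_below[OF H Y] by blast
  have D: "finite D" "card D \<le> Suc k"
    using hitting_basic[OF H] fin finite_subset[of D "W \<union> X"] by auto
  have sub: "nbs E Y \<inter> Q' \<subseteq> (nbs E Y \<inter> Q) \<union> W" using cl by blast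
  show "card (nbs E Y \<inter> Q') \<le> 2 * Suc k"
  proof (cases "\<exists>w\<in>W - Q. w \<in> nbs E Y")
    case True
    then obtain w y where w: "w \<in> W - Q" "y \<in> Y" "{w, y} \<in> E" unfolding nbs_def by blast
    then have "{y, w} \<in> E" by (simp add: insert_commute)
    then have "conn E (insert w Y)" using conn_insert[OF Y(1) w(2)] by blast
    moreover have "insert w Y \<subseteq> W \<union> X - Q" "insert w Y \<inter> W \<noteq> {}" using w Y(2) by auto
    ultimately have "nbs E (insert w Y) \<inter> Q \<subseteq> D" using hitting_meeting[OF H] by blast
    then have "nbs E Y \<inter> Q \<subseteq> D" unfolding nbs_def by blast
    then have "nbs E Y \<inter> Q' \<subseteq> D \<union> W" using sub by blast
    then have "card (nbs E Y \<inter> Q') \<le> card (D \<union> W)" using D fin by (intro card_mono) auto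
    also have "\<dots> \<le> card D + card W" by (rule card_Un_le)
    finally show ?thesis using D fin by simp
  next
    case False
    then have "nbs E Y \<inter> Q' = nbs E Y \<inter> Q" using cl QQ by blast
    then show ?thesis using hitting_below[OF H Y] by simp
  qed
qed

lemma ex_hitting:
  assumes "rd k E W X"
  shows "\<exists>Q D F m. hitting k E bad W X Q D F m"
  using assms
proof (induction rule: rd.induct)
  case (nil W)
  have "hitting k E bad W {} {} {} {} 0"
    unfolding hitting_def using conn_ne by auto
  then show ?case by blast
next
  case (shrink W' X W)
  obtain Q D F m where H: "hitting k E bad W' X Q D F m" using shrink.IH by blast
  have I1: "\<And>Y. conn E Y \<Longrightarrow> Y \<subseteq> W' \<union> X - Q \<Longrightarrow> Y \<inter> W' \<noteq> {} \<Longrightarrow> nbs E Y \<inter> Q \<subseteq> D \<and> (\<forall>A\<in>F. A \<inter> Y = {})"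
    using hitting_meeting[OF H] by blast
  have "hitting k E bad W X Q D F m"
    unfolding hitting_def
  proof (intro conjI allI impI)
    show "Q \<subseteq> W \<union> X" "D \<subseteq> Q" "card D \<le> Suc k" "finite F" "pairwise disjnt F"
      "card Q \<le> Suc k * m" "m + (if Q = {} then 0 else 1) \<le> 2 * card F" "\<forall>A\<in>F. conn E A \<and> bad A \<and> A \<subseteq> X"
      using hitting_basic[OF H] shrink.hyps(2) by blast+
    have QD: "W' \<inter> Q \<subseteq> D" "Q \<subseteq> W' \<union> X" using hitting_basic[OF H] by auto
    then show "W \<inter> Q \<subseteq> D" using shrink.hyps(5) by blast
    show "\<not> bad Y" "card (nbs E Y \<inter> Q) \<le> 2 * Suc k" if "conn E Y" "Y \<subseteq> X - Q" for Y
      using hitting_below[OF H that] by auto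
    fix Y assume Y: "conn E Y" "Y \<subseteq> W \<union> X - Q" "Y \<inter> W \<noteq> {}"
    have nX: "\<not> Y \<subseteq> X" using Y(3) shrink.hyps(5) by blast
    have cl: "v \<in> W' \<union> X" if "u \<in> X" "v \<in> Y" "{u, v} \<in> E" for u v
      using that shrink.hyps(6)[of u v] Y(2) by blast
    have piece: "nbs E Y' \<inter> Q \<subseteq> D \<and> (\<forall>A\<in>F. A \<inter> Y' = {})"
      if "conn E Y'" "Y' \<subseteq> Y \<inter> (W' \<union> X)" "Y' \<inter> W' \<noteq> {}" for Y'
      using I1[of Y'] that Y(2) by blast
    show "nbs E Y \<inter> Q \<subseteq> D"
    proof
      fix q assume q: "q \<in> nbs E Y \<inter> Q"
      then obtain y where y: "y \<in> Y" "{q, y} \<in> E" by (auto simp: nbs_def)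
      show "q \<in> D"
      proof (cases "q \<in> W'")
        case False
        then have "q \<in> X" using q QD by blast
        then have yy: "y \<in> W' \<union> X" using cl y by blast
        obtain Y' where "conn E Y'" "y \<in> Y'" "Y' \<subseteq> Y \<inter> (W' \<union> X)" "Y' \<inter> W' \<noteq> {}"
          by (rule conn_piece[OF Y(1) y(1) yy nX cl])
        then show ?thesis using piece[of Y'] y q unfolding nbs_def by blast
      qed (use q QD in blast)
    qed
    show "\<forall>A\<in>F. A \<inter> Y = {}"
    proof (intro ballI, rule ccontr)
      fix A assume A: "A \<in> F" "A \<inter> Y \<noteq> {}"
      then obtain y where y: "y \<in> A" "y \<in> Y" by blast
      have "A \<subseteq> X" using hitting_basic[OF H] A(1) by blast
      then have yy: "y \<in> W' \<union> X" using y by blast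
      obtain Y' where "conn E Y'" "y \<in> Y'" "Y' \<subseteq> Y \<inter> (W' \<union> X)" "Y' \<inter> W' \<noteq> {}"
        by (rule conn_piece[OF Y(1) y(2) yy nX cl])
      then show False using piece[of Y'] y A(1) by blast
    qed
  qed
  then show ?case by blast
next
  case (intro v W X)
  obtain Q D F m where H: "hitting k E bad (insert v W) X Q D F m" using intro.IH by blast
  have fin: "finite (insert v W)" "finite X" "card (insert v W) \<le> Suc k" "insert v W \<inter> X = {}"
    using rd_finite[OF intro.hyps(1)] by auto
  note h = hitting_basic[OF H]
  note I1 = hitting_meeting[OF H]
  note I2 = hitting_below[OF H]
  have finD: "finite D" using h(1,2) fin finite_subset[of D "insert v W \<union> X"] by auto
  show ?case
  proof (cases "\<exists>A. conn E A \<and> A \<subseteq> insert v X - Q \<and> bad A")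
    case True
    then obtain A where A: "conn E A" "A \<subseteq> insert v X - Q" "bad A" by blast
    \<comment> \<open>A bad set without \<open>v\<close> would lie in \<open>X - Q\<close>, where
      none is left.\<close>
    have vA: "v \<in> A" using I2[of A] A by blast
    \<comment> \<open>Containing \<open>v\<close>, the set \<open>A\<close> meets the old root bag,
      and such sets avoid the whole family \<open>F\<close>.\<close>
    have disjA: "B \<inter> A = {}" if "B \<in> F" for B using I1[of A] A vA that by blast
    have AF: "A \<notin> F" using disjA[of A] vA by blast
    let ?Q = "Q \<union> insert v W"
    have "hitting k E bad W (insert v X) ?Q (insert v W) (insert A F) (Suc m)"
      unfolding hitting_def
    proof (intro conjI allI impI)
      show "?Q \<subseteq> W \<union> insert v X" using h(1) by blast
      have "card ?Q \<le> card Q + card (insert v W)" by (rule card_Un_le)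
      then show "card ?Q \<le> Suc k * Suc m" using h(8) fin(3) by simp
      show "Suc m + (if ?Q = {} then 0 else 1) \<le> 2 * card (insert A F)" using h(5,9) AF by simp
      show "pairwise disjnt (insert A F)"
        using h(6) disjA unfolding pairwise_insert disjnt_def by blast
      show "\<forall>B\<in>insert A F. conn E B \<and> bad B \<and> B \<subseteq> insert v X" using h(7) A by blast
      fix Y assume Y: "conn E Y" "Y \<subseteq> insert v X - ?Q"
      have "\<not> bad Y \<and> card (nbs E Y \<inter> ?Q) \<le> 2 * Suc k"
        by (rule hitting_mark[OF H fin Y(1)]) (use Y(2) in blast)+
      then show "\<not> bad Y" "card (nbs E Y \<inter> ?Q) \<le> 2 * Suc k" by auto
    qed (use h(5) fin in auto)
    then show ?thesis by blast
  next
    case False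
    have "hitting k E bad W (insert v X) Q D F m"
      unfolding hitting_def
    proof (intro conjI allI impI)
      show "\<forall>A\<in>F. conn E A \<and> bad A \<and> A \<subseteq> insert v X" using h(7) by blast
      show "Q \<subseteq> W \<union> insert v X" "W \<inter> Q \<subseteq> D" using h(1,4) by auto
      fix Y assume Y: "conn E Y"
      show "nbs E Y \<inter> Q \<subseteq> D" "\<forall>A\<in>F. A \<inter> Y = {}" if "Y \<subseteq> W \<union> insert v X - Q" "Y \<inter> W \<noteq> {}"
        using I1[OF Y] that by blast+
      assume Y2: "Y \<subseteq> insert v X - Q"
      then show "\<not> bad Y" using False Y by blast
      show "card (nbs E Y \<inter> Q) \<le> 2 * Suc k"
      proof (cases "v \<in> Y")
        case True
        then have "nbs E Y \<inter> Q \<subseteq> D" using I1[OF Y] Y2 by blast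
        then have "card (nbs E Y \<inter> Q) \<le> card D" using finD card_mono by blast
        then show ?thesis using h(3) by simp
      next
        case False
        then show ?thesis using I2[OF Y] Y2 by blast
      qed
    qed (use h in \<open>simp_all\<close>)
    then show ?thesis by blast
  qed
next
  case (union W X1 X2)
  \<comment> \<open>If one branch has no marked bag, the marked set of the other branch is kept and
    \<open>W\<close> stays unmarked.\<close>
  have key: "\<exists>Q D F m. hitting k E bad W (X \<union> X') Q D F m"
    if H: "hitting k E bad W X Q D F m" and H': "hitting k E bad W X' {} D' F' m'"
      and fin: "finite W" "finite X" "finite X'" "W \<inter> X = {}" "W \<inter> X' = {}" "X \<inter> X' = {}"
      and no: "\<And>x y. x \<in> X \<Longrightarrow> y \<in> X' \<Longrightarrow> {x, y} \<notin> E"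
    for X X' Q D F m D' F' m'
  proof -
    note h = hitting_basic[OF H]
    note I1 = hitting_meeting[OF H]
    note I2 = hitting_below[OF H]
    have I2': "\<not> bad Y" if "conn E Y" "Y \<subseteq> X'" for Y using hitting_below[OF H'] that by blast
    have finD: "finite D" using h(1,2) fin finite_subset[of D "W \<union> X"] by auto
    have no': "{y, x} \<notin> E" if "x \<in> X" "y \<in> X'" for x y using no[OF that] by (simp add: insert_commute)
    have "hitting k E bad W (X \<union> X') Q D F m"
      unfolding hitting_def
    proof (intro conjI allI impI)
      show "Q \<subseteq> W \<union> (X \<union> X')" "\<forall>A\<in>F. conn E A \<and> bad A \<and> A \<subseteq> X \<union> X'" using h(1,7) by auto
      fix Y assume Y: "conn E Y"
      {
        assume Y2: "Y \<subseteq> W \<union> (X \<union> X') - Q" "Y \<inter> W \<noteq> {}"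
        have nX: "\<not> Y \<subseteq> X" using Y2(2) fin(4) by blast
        have cl: "v \<in> W \<union> X" if "u \<in> X" "v \<in> Y" "{u, v} \<in> E" for u v
          using that no[of u v] Y2(1) by blast
        have piece: "nbs E Y' \<inter> Q \<subseteq> D \<and> (\<forall>A\<in>F. A \<inter> Y' = {})"
          if "conn E Y'" "Y' \<subseteq> Y \<inter> (W \<union> X)" "Y' \<inter> W \<noteq> {}" for Y'
          using I1[of Y'] that Y2(1) by blast
        show "nbs E Y \<inter> Q \<subseteq> D"
        proof
          fix q assume q: "q \<in> nbs E Y \<inter> Q"
          then obtain y where y: "y \<in> Y" "{q, y} \<in> E" by (auto simp: nbs_def)
          show "q \<in> D"
          proof (cases "q \<in> W")
            case False
            then have "q \<in> X" using q h(1) by blast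
            then have yy: "y \<in> W \<union> X" using cl y by blast
            obtain Y' where "conn E Y'" "y \<in> Y'" "Y' \<subseteq> Y \<inter> (W \<union> X)" "Y' \<inter> W \<noteq> {}"
              by (rule conn_piece[OF Y y(1) yy nX cl])
            then show ?thesis using piece[of Y'] y q unfolding nbs_def by blast
          qed (use q h(4) in blast)
        qed
        show "\<forall>A\<in>F. A \<inter> Y = {}"
        proof (intro ballI, rule ccontr)
          fix A assume A: "A \<in> F" "A \<inter> Y \<noteq> {}"
          then obtain y where y: "y \<in> A" "y \<in> Y" by blast
          then have yy: "y \<in> W \<union> X" using h(7) A(1) by blast
          obtain Y' where "conn E Y'" "y \<in> Y'" "Y' \<subseteq> Y \<inter> (W \<union> X)" "Y' \<inter> W \<noteq> {}"
            by (rule conn_piece[OF Y y(2) yy nX cl])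
          then show False using piece[of Y'] y A(1) by blast
        qed
      }
      assume Y2: "Y \<subseteq> X \<union> X' - Q"
      have one: "Y \<subseteq> X \<or> Y \<subseteq> X'"
      proof (rule ccontr)
        assume "\<not> ?thesis"
        then obtain a b where "a \<in> Y" "a \<in> X" "b \<in> Y" "b \<notin> X" using Y2 by blast
        then obtain u v where "u \<in> X" "v \<in> Y" "v \<notin> X" "{u, v} \<in> E"
          using conn_cut[OF Y] by metis
        then show False using no[of u v] Y2 by blast
      qed
      then show "\<not> bad Y" using I2[OF Y] I2'[OF Y] Y2 by blast
      show "card (nbs E Y \<inter> Q) \<le> 2 * Suc k"
        using one
      proof
        assume "Y \<subseteq> X"
        then show ?thesis using I2[OF Y] Y2 by blast
      next
        assume "Y \<subseteq> X'"
        then have "nbs E Y \<inter> Q \<subseteq> D" using no h(1,4) unfolding nbs_def by blast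
        then have "card (nbs E Y \<inter> Q) \<le> card D" using finD card_mono by blast
        then show ?thesis using h(3) by simp
      qed
    qed (use h in \<open>simp_all\<close>)
    then show ?thesis by blast
  qed
  obtain Q1 D1 F1 m1 where H1: "hitting k E bad W X1 Q1 D1 F1 m1" using union.IH(1) by blast
  obtain Q2 D2 F2 m2 where H2: "hitting k E bad W X2 Q2 D2 F2 m2" using union.IH(2) by blast
  have f1: "finite W" "finite X1" "card W \<le> Suc k" "W \<inter> X1 = {}" using rd_finite[OF union.hyps(1)] by auto
  have f2: "finite W" "finite X2" "card W \<le> Suc k" "W \<inter> X2 = {}" using rd_finite[OF union.hyps(2)] by auto
  have no': "{y, x} \<notin> E" if "x \<in> X1" "y \<in> X2" for x y using union.hyps(4)[OF that] by (simp add: insert_commute)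
  consider "Q2 = {}" | "Q1 = {}" | "Q1 \<noteq> {}" "Q2 \<noteq> {}" by blast
  then show ?case
  proof cases
    case 1
    then show ?thesis using key[OF H1 _ f1(1,2) f2(2) f1(4) f2(4) union.hyps(3,4)] H2 by blast
  next
    case 2
    have "X2 \<inter> X1 = {}" using union.hyps(3) by blast
    then show ?thesis using key[OF H2 _ f1(1) f2(2) f1(2) f2(4) f1(4) _ no'] H1 2 by (metis Un_commute)
  next
    case 3
    let ?Q = "Q1 \<union> Q2 \<union> W"
    note h1 = hitting_basic[OF H1]
    \<comment> \<open>The extra unit recorded for a nonempty marked set is spent here: of the two
      units from the branches, one pays for marking \<open>W\<close> and one remains.\<close>
    have m1: "m1 + 1 \<le> 2 * card F1" using h1(9) 3 by simp
    note h2 = hitting_basic[OF H2]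
    have m2: "m2 + 1 \<le> 2 * card F2" using h2(9) 3 by simp
    have disjF: "A \<inter> B = {}" if "A \<in> F1" "B \<in> F2" for A B using h1(7) h2(7) that union.hyps(3) by blast
    have "F1 \<inter> F2 = {}"
    proof (rule equals0I)
      fix A assume A: "A \<in> F1 \<inter> F2"
      then have "A = {}" using disjF[of A A] by simp
      moreover have "conn E A" using h1(7) A by blast
      ultimately show False using conn_ne[of E A] by simp
    qed
    then have cF: "card (F1 \<union> F2) = card F1 + card F2" using h1(5) h2(5) by (simp add: card_Un_disjoint)
    have "hitting k E bad W (X1 \<union> X2) ?Q W (F1 \<union> F2) (m1 + m2 + 1)"
      unfolding hitting_def
    proof (intro conjI allI impI)
      show "?Q \<subseteq> W \<union> (X1 \<union> X2)" using h1(1) h2(1) by blast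
      show "pairwise disjnt (F1 \<union> F2)"
        unfolding pairwise_def
      proof (intro ballI impI)
        fix A B assume AB: "A \<in> F1 \<union> F2" "B \<in> F1 \<union> F2" "A \<noteq> B"
        then consider "A \<in> F1" "B \<in> F1" | "A \<in> F2" "B \<in> F2" | "A \<in> F1" "B \<in> F2" | "A \<in> F2" "B \<in> F1" by blast
        then show "disjnt A B"
        proof cases
          case 1
          show ?thesis by (rule pairwiseD[OF h1(6) 1 AB(3)])
        next
          case 2
          show ?thesis by (rule pairwiseD[OF h2(6) 2 AB(3)])
        next
          case 3
          then show ?thesis using disjF unfolding disjnt_def by blast
        next
          case 4
          then show ?thesis using disjF unfolding disjnt_def by blast
        qed
      qed
      show "\<forall>A\<in>F1 \<union> F2. conn E A \<and> bad A \<and> A \<subseteq> X1 \<union> X2" using h1(7) h2(7) by blast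
      have "card ?Q \<le> card Q1 + card Q2 + card W"
        using card_Un_le[of "Q1 \<union> Q2" W] card_Un_le[of Q1 Q2] by linarith
      also have "\<dots> \<le> Suc k * m1 + Suc k * m2 + Suc k" using h1(8) h2(8) f1(3) by linarith
      finally show "card ?Q \<le> Suc k * (m1 + m2 + 1)" by (simp add: algebra_simps)
      show "m1 + m2 + 1 + (if ?Q = {} then 0 else 1) \<le> 2 * card (F1 \<union> F2)"
        unfolding cF using m1 m2 by auto
      fix Y assume Y: "conn E Y" "Y \<subseteq> X1 \<union> X2 - ?Q"
      have "Y \<subseteq> X1 \<or> Y \<subseteq> X2"
      proof (rule ccontr)
        assume "\<not> ?thesis"
        then obtain a b where "a \<in> Y" "a \<in> X1" "b \<in> Y" "b \<notin> X1" using Y by blast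
        then obtain u v where "u \<in> X1" "v \<in> Y" "v \<notin> X1" "{u, v} \<in> E"
          using conn_cut[OF Y(1)] by metis
        then show False using union.hyps(4)[of u v] Y by blast
      qed
      then have "\<not> bad Y \<and> card (nbs E Y \<inter> ?Q) \<le> 2 * Suc k"
      proof
        assume Y1: "Y \<subseteq> X1"
        have "w \<in> Q1 \<union> W" if "w \<in> nbs E Y" "w \<in> ?Q" for w
          using that no' Y1 h2(1) unfolding nbs_def by blast
        then show ?thesis using hitting_mark[OF H1 f1 Y(1)] Y(2) Y1 by blast
      next
        assume Y1: "Y \<subseteq> X2"
        have "w \<in> Q2 \<union> W" if "w \<in> nbs E Y" "w \<in> ?Q" for w
          using that union.hyps(4) Y1 h1(1) unfolding nbs_def by blast
        then show ?thesis using hitting_mark[OF H2 f2 Y(1)] Y(2) Y1 by blast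
      qed
      then show "\<not> bad Y" "card (nbs E Y \<inter> ?Q) \<le> 2 * Suc k" by auto
    qed (use h1(5) h2(5) f1 in auto)
    then show ?thesis by blast
  qed
qed

text \<open>This is an Erdos-Posa bound with the additional feature that each remaining connected
  set has few neighbours in the hitting set. The count of marked bags is at most twice the size of a
  disjoint family of bad sets, hence at most \<open>2 * \<nu>\<close>.\<close>

lemma ex_hitting_set:
  assumes "rd k E {} X"
    and "\<And>F. finite F \<Longrightarrow> pairwise disjnt F \<Longrightarrow> \<forall>A\<in>F. conn E A \<and> bad A \<and> A \<subseteq> X \<Longrightarrow> card F \<le> \<nu>"
  obtains Q where "Q \<subseteq> X" "card Q \<le> 2 * Suc k * \<nu>"
    "\<And>Y. conn E Y \<Longrightarrow> Y \<subseteq> X - Q \<Longrightarrow> \<not> bad Y \<and> card (nbs E Y \<inter> Q) \<le> 2 * Suc k"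
proof -
  obtain Q D F m where H: "hitting k E bad {} X Q D F m" using ex_hitting[OF assms(1)] by blast
  have F: "finite F" "pairwise disjnt F" "\<forall>A\<in>F. conn E A \<and> bad A \<and> A \<subseteq> X"
    and m: "card Q \<le> Suc k * m" "m + (if Q = {} then 0 else 1) \<le> 2 * card F" and Q: "Q \<subseteq> X"
    and I: "\<And>Y. conn E Y \<Longrightarrow> Y \<subseteq> X - Q \<Longrightarrow> \<not> bad Y \<and> card (nbs E Y \<inter> Q) \<le> 2 * Suc k"
    using hitting_basic[OF H] hitting_below[OF H] by auto
  have "m \<le> 2 * \<nu>" using assms(2)[OF F] m(2) by linarith
  then have "Suc k * m \<le> Suc k * (2 * \<nu>)" by (rule mult_le_mono2)
  also have "\<dots> = 2 * Suc k * \<nu>" by simp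
  finally show ?thesis using that[OF Q _ I] m(1) by linarith
qed

section \<open>Upper bounds\<close>

lemma contains_path_iff:
  "contains_subgraph G (path_graph n) \<longleftrightarrow> (\<exists>xs. pth (snd G) xs \<and> set xs \<subseteq> fst G \<and> length xs = n)"
proof
  assume "contains_subgraph G (path_graph n)"
  then obtain f where f: "inj_on f {0..<n}" "f ` {0..<n} \<subseteq> fst G"
    "\<And>u v. {u, v} \<in> snd (path_graph n) \<Longrightarrow> {f u, f v} \<in> snd G"
    unfolding contains_subgraph_def path_graph_def by auto
  have "{f i, f (Suc i)} \<in> snd G" if "Suc i < n" for i
    using f(3)[of i "Suc i"] that by (auto simp: path_graph_def)
  then have "pth (snd G) (map f [0..<n])"
    using f(1) by (auto simp: pth_def successively_conv_nth distinct_map)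
  then show "\<exists>xs. pth (snd G) xs \<and> set xs \<subseteq> fst G \<and> length xs = n"
    using f(2) by (intro exI[of _ "map f [0..<n]"]) auto
next
  assume "\<exists>xs. pth (snd G) xs \<and> set xs \<subseteq> fst G \<and> length xs = n"
  then obtain xs where xs: "pth (snd G) xs" "set xs \<subseteq> fst G" "length xs = n" by blast
  show "contains_subgraph G (path_graph n)"
    unfolding contains_subgraph_def
  proof (intro exI[of _ "\<lambda>i. xs ! i"] conjI allI impI)
    show "inj_on ((!) xs) (fst (path_graph n))"
      using xs by (auto simp: path_graph_def pth_def inj_on_def nth_eq_iff_index_eq)
    show "(!) xs ` fst (path_graph n) \<subseteq> fst G"
      using xs by (auto simp: path_graph_def)
    fix u v assume "{u, v} \<in> snd (path_graph n)"
    then obtain i where i: "{u, v} = {i, Suc i}" "Suc i < n" by (auto simp: path_graph_def)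
    then have "{xs ! i, xs ! Suc i} \<in> snd G" using xs by (auto simp: pth_def successively_conv_nth)
    then show "{xs ! u, xs ! v} \<in> snd G" using i(1) by (auto simp: doubleton_eq_iff insert_commute)
  qed
qed

lemma pth_take: "pth E xs \<Longrightarrow> pth E (take m xs)"
  by (metis append_take_drop_id pth_append)

lemma contains_path_if_long:
  assumes "pth (snd G) xs" "set xs \<subseteq> fst G" "n \<le> length xs"
  shows "contains_subgraph G (path_graph n)"
  unfolding contains_path_iff
  using assms set_take_subset[of n xs] by (intro exI[of _ "take n xs"]) (auto simp: pth_take)

text \<open>Excluding a path bounds the treedepth by \<open>n\<close>, so the bound on the part size
  is constant. At the start, an attachment of the empty set of level \<open>Suc c\<close> would give
  a path on at least \<open>2 ^ Suc (Suc c) - 1\<close> vertices, which is at least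
  \<open>n\<close>.\<close>

lemma utw_path_upper:
  assumes "n < 2 ^ Suc (Suc c)"
  shows "utw_bounded_by (excl (path_graph n)) c"
  unfolding utw_bounded_by_def
proof (intro exI[of _ "\<lambda>_. short_width c n 0 n"] ballI)
  fix G assume "G \<in> excl (path_graph n)"
  then have G: "graph G" "\<not> contains_subgraph G (path_graph n)" by (auto simp: excl_def)
  have fin: "finite (fst G)" using G(1) by (simp add: graph_def)
  have short: "length xs < n" if "pth (snd G) xs" "set xs \<subseteq> fst G" for xs
    using contains_path_if_long[OF that] G(2) by (meson not_le)
  show "tpw c G \<le> short_width c n 0 n"
  proof (rule tpw_le_if_step[OF G(1), where P = "short_state (snd G) c n 0"])
    fix C \<R>
    assume st: "short_state (snd G) c n 0 C \<R>" "conn (snd G) C" and CV: "C \<subseteq> fst G"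
      and R: "finite \<R>" "card \<R> \<le> c" "\<forall>R\<in>\<R>. R \<inter> C = {}"
    show "\<exists>Q\<subseteq>C. Q \<noteq> {} \<and> card Q \<le> short_width c n 0 n \<and> (\<forall>Z\<in>comps (snd G) (C - Q).
        card (attached (snd G) (insert Q \<R>) Z) \<le> c \<and> short_state (snd G) c n 0 Z (attached (snd G) (insert Q \<R>) Z))"
      by (rule short_state_step[OF st finite_subset[OF CV fin] R])
  next
    fix C assume C: "C \<in> comps (snd G) (fst G)"
    have CV: "C \<subseteq> fst G" "conn (snd G) C" using comps_subset[OF C] conn_comps[OF C] .
    obtain v where "v \<in> C" using conn_ne[OF CV(2)] by blast
    then have "tdl (snd G) n C"
      by (rule tdl_if_no_path[OF CV(2)]) (use short CV(1) in \<open>meson less_imp_le_nat subset_trans\<close>)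
    moreover have "\<not> att (snd G) (Suc c) {} C"
    proof
      assume "att (snd G) (Suc c) {} C"
      then obtain xs where "pth (snd G) xs" "set xs \<subseteq> C" "2 ^ Suc (Suc c) \<le> Suc (length xs)"
        using att_Suc_path by blast
      then show False using short[of xs] CV(1) assms by auto
    qed
    moreover have "\<R>' = {}" if "\<R>' \<subseteq> {}" for \<R>' :: "nat set set" using that by blast
    ultimately show "short_state (snd G) c n 0 C {}"
      unfolding short_state_def by (metis all_not_in_conv card.empty diff_zero image_empty order_refl)
  qed
qed

section \<open>Graphs without a given spider\<close>

definition long_leg :: "'a set set \<Rightarrow> nat \<Rightarrow> 'a \<Rightarrow> 'a set \<Rightarrow> bool" where
  "long_leg E t r Y \<longleftrightarrow> (\<exists>xs. pth E xs \<and> set xs \<subseteq> Y \<and> length xs = t \<and> {r, hd xs} \<in> E)"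

lemma spider_simps:
  "fst (spider s t) = insert (0, 0, 0) {(0, j, i) | j i. 1 \<le> j \<and> j \<le> s \<and> 1 \<le> i \<and> i \<le> t}"
  "1 \<le> t \<Longrightarrow> snd (spider s t) = {{(0, 0, 0), (0, j, 1)} | j. 1 \<le> j \<and> j \<le> s} \<union>
     {{(0, j, i), (0, j, Suc i)} | j i. 1 \<le> j \<and> j \<le> s \<and> 1 \<le> i \<and> Suc i \<le> t}"
proof -
  have V: "c < length [replicate s t] \<and> 1 \<le> j \<and> j \<le> length ([replicate s t] ! c) \<and>
      1 \<le> i \<and> i \<le> [replicate s t] ! c ! (j - 1) \<longleftrightarrow> c = 0 \<and> 1 \<le> j \<and> j \<le> s \<and> 1 \<le> i \<and> i \<le> t" for c j i
    by (cases c) auto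
  show "fst (spider s t) = insert (0, 0, 0) {(0, j, i) | j i. 1 \<le> j \<and> j \<le> s \<and> 1 \<le> i \<and> i \<le> t}"
    unfolding spider_def spider_forest_graph_def fst_conv V by auto
  assume t: "1 \<le> t"
  have E1: "c < length [replicate s t] \<and> 1 \<le> j \<and> j \<le> length ([replicate s t] ! c) \<and>
      1 \<le> [replicate s t] ! c ! (j - 1) \<longleftrightarrow> c = 0 \<and> 1 \<le> j \<and> j \<le> s" for c j
    using t by (cases c) auto
  have E2: "c < length [replicate s t] \<and> 1 \<le> j \<and> j \<le> length ([replicate s t] ! c) \<and>
      1 \<le> i \<and> Suc i \<le> [replicate s t] ! c ! (j - 1) \<longleftrightarrow> c = 0 \<and> 1 \<le> j \<and> j \<le> s \<and> 1 \<le> i \<and> Suc i \<le> t" for c j i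
    by (cases c) auto
  show "snd (spider s t) = {{(0, 0, 0), (0, j, 1)} | j. 1 \<le> j \<and> j \<le> s} \<union>
     {{(0, j, i), (0, j, Suc i)} | j i. 1 \<le> j \<and> j \<le> s \<and> 1 \<le> i \<and> Suc i \<le> t}"
    unfolding spider_def spider_forest_graph_def snd_conv E1 E2 by simp
qed

lemma contains_spider_iff:
  assumes t: "1 \<le> t"
  shows "contains_subgraph G (spider s t) \<longleftrightarrow> (\<exists>r p. r \<in> fst G \<and>
    (\<forall>j\<in>{1..s}. pth (snd G) (p j) \<and> set (p j) \<subseteq> fst G - {r} \<and> length (p j) = t \<and> {r, hd (p j)} \<in> snd G) \<and>
    (\<forall>i\<in>{1..s}. \<forall>j\<in>{1..s}. i \<noteq> j \<longrightarrow> set (p i) \<inter> set (p j) = {}))" (is "?L = ?R")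
proof
  assume ?L
  then obtain f where f: "inj_on f (fst (spider s t))" "f ` fst (spider s t) \<subseteq> fst G"
    "\<And>u v. {u, v} \<in> snd (spider s t) \<Longrightarrow> {f u, f v} \<in> snd G"
    unfolding contains_subgraph_def by blast
  define r where "r = f (0, 0, 0)"
  define p where "p j = map (\<lambda>i. f (0, j, Suc i)) [0..<t]" for j
  have v: "(0, 0, 0) \<in> fst (spider s t)" "(0, j, Suc i) \<in> fst (spider s t)" if "1 \<le> j" "j \<le> s" "i < t" for i j
    using that by (auto simp: spider_simps)
  have v0: "(0, 0, 0) \<in> fst (spider s t)" by (simp add: spider_simps)
  have e1: "{(0, 0, 0), (0, j, 1)} \<in> snd (spider s t)" if "1 \<le> j" "j \<le> s" for j
    using that t by (auto simp: spider_simps)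
  have e2: "{(0, j, Suc i), (0, j, Suc (Suc i))} \<in> snd (spider s t)" if "1 \<le> j" "j \<le> s" "Suc i < t" for i j
  proof -
    have "\<exists>j' i'. {(0, j, Suc i), (0, j, Suc (Suc i))} = {(0::nat, j', i'), (0, j', Suc i')} \<and> 1 \<le> j' \<and> j' \<le> s \<and> 1 \<le> i' \<and> Suc i' \<le> t"
      using that by (intro exI[of _ j] exI[of _ "Suc i"]) auto
    then show ?thesis unfolding spider_simps(2)[OF t] by blast
  qed
  have "pth (snd G) (p j) \<and> set (p j) \<subseteq> fst G - {r} \<and> length (p j) = t \<and> {r, hd (p j)} \<in> snd G"
    if j: "1 \<le> j" "j \<le> s" for j
  proof (intro conjI)
    have "inj_on (\<lambda>i. f (0, j, Suc i)) {0..<t}"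
    proof (rule inj_onI)
      fix a b assume "a \<in> {0..<t}" "b \<in> {0..<t}" "f (0, j, Suc a) = f (0, j, Suc b)"
      then show "a = b" using inj_onD[OF f(1) _ v(2)[OF j, of a] v(2)[OF j, of b]] by simp
    qed
    then show "pth (snd G) (p j)"
      using f(3)[OF e2[OF j]] unfolding pth_def p_def
      by (simp add: distinct_map successively_conv_nth)
    show "set (p j) \<subseteq> fst G - {r}"
    proof
      fix x assume "x \<in> set (p j)"
      then obtain i where i: "i < t" "x = f (0, j, Suc i)" by (auto simp: p_def)
      have "x \<noteq> r" using inj_onD[OF f(1) _ v0 v(2)[OF j i(1)]] i(2) unfolding r_def by auto
      then show "x \<in> fst G - {r}" using f(2) v(2)[OF j i(1)] i(2) by blast
    qed
    show "length (p j) = t" by (simp add: p_def)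
    have "hd (p j) = f (0, j, 1)" using t by (simp add: p_def hd_map)
    then show "{r, hd (p j)} \<in> snd G" using f(3)[OF e1[OF j]] by (simp add: r_def)
  qed
  moreover have "set (p i) \<inter> set (p j) = {}" if ij: "1 \<le> i" "i \<le> s" "1 \<le> j" "j \<le> s" "i \<noteq> j" for i j
  proof (rule equals0I)
    fix x assume "x \<in> set (p i) \<inter> set (p j)"
    then obtain a b where ab: "a < t" "b < t" "f (0, i, Suc a) = f (0, j, Suc b)" by (auto simp: p_def)
    then show False using inj_onD[OF f(1) ab(3) v(2)[OF ij(1,2) ab(1)] v(2)[OF ij(3,4) ab(2)]] ij(5) by simp
  qed
  moreover have "r \<in> fst G" using f(2) v0 unfolding r_def by blast
  ultimately show ?R by (intro exI[of _ r] exI[of _ p]) auto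
next
  assume ?R
  then obtain r p where r: "r \<in> fst G" and
    p': "\<forall>j\<in>{1..s}. pth (snd G) (p j) \<and> set (p j) \<subseteq> fst G - {r} \<and> length (p j) = t \<and> {r, hd (p j)} \<in> snd G" and
    disj': "\<forall>i\<in>{1..s}. \<forall>j\<in>{1..s}. i \<noteq> j \<longrightarrow> set (p i) \<inter> set (p j) = {}" by blast
  have p: "pth (snd G) (p j) \<and> set (p j) \<subseteq> fst G - {r} \<and> length (p j) = t \<and> {r, hd (p j)} \<in> snd G" if "1 \<le> j" "j \<le> s" for j
    using p' that by simp
  have disj: "\<And>i j. 1 \<le> i \<Longrightarrow> i \<le> s \<Longrightarrow> 1 \<le> j \<Longrightarrow> j \<le> s \<Longrightarrow> i \<noteq> j \<Longrightarrow> set (p i) \<inter> set (p j) = {}"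
    using disj' by simp
  define f where "f = (\<lambda>(c::nat, j::nat, i::nat). if i = 0 then r else p j ! (i - 1))"
  have f0: "f (0, 0, 0) = r" by (simp add: f_def)
  have fj: "f (0, j, Suc i) = p j ! i" for i j by (simp add: f_def)
  have pin: "p j ! i \<in> set (p j)" if "1 \<le> j" "j \<le> s" "i < t" for i j using p[OF that(1,2)] that(3) by simp
  have vx: "x = (0, 0, 0) \<or> (\<exists>j i. x = (0, j, Suc i) \<and> 1 \<le> j \<and> j \<le> s \<and> i < t)" if "x \<in> fst (spider s t)" for x
  proof (rule disjCI)
    assume "\<not> (\<exists>j i. x = (0, j, Suc i) \<and> 1 \<le> j \<and> j \<le> s \<and> i < t)"
    moreover have "x = (0, j, Suc (i - 1)) \<and> 1 \<le> j \<and> j \<le> s \<and> i - 1 < t"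
      if "x = (0, j, i)" "1 \<le> j" "j \<le> s" "1 \<le> i" "i \<le> t" for j i
      using that by simp
    ultimately show "x = (0, 0, 0)" using that unfolding spider_simps by blast
  qed
  show ?L
    unfolding contains_subgraph_def
  proof (intro exI[of _ f] conjI allI impI)
    show "inj_on f (fst (spider s t))"
    proof (rule inj_onI)
      fix x y assume xy: "x \<in> fst (spider s t)" "y \<in> fst (spider s t)" "f x = f y"
      have ne: "f (0, j, Suc i) \<noteq> r" if "1 \<le> j" "j \<le> s" "i < t" for i j
        using pin[OF that] p[OF that(1,2)] unfolding fj by auto
      consider "x = (0,0,0)" "y = (0,0,0)"
        | j i where "1 \<le> j" "j \<le> s" "i < t" "x = (0, j, Suc i)" "y = (0,0,0)"
        | j i where "1 \<le> j" "j \<le> s" "i < t" "y = (0, j, Suc i)" "x = (0,0,0)"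
        | j i j' i' where "1 \<le> j" "j \<le> s" "i < t" "x = (0, j, Suc i)" "1 \<le> j'" "j' \<le> s" "i' < t" "y = (0, j', Suc i')"
        using vx[OF xy(1)] vx[OF xy(2)] by blast
      then show "x = y"
      proof cases
        case 2
        then show ?thesis using ne[OF 2(1-3)] xy(3) f0 by simp
      next
        case 3
        then show ?thesis using ne[OF 3(1-3)] xy(3) f0 by simp
      next
        case 4
        then have eq: "p j ! i = p j' ! i'" using xy(3) fj by simp
        then have "j = j'" using disj[OF 4(1,2,5,6)] pin[OF 4(1-3)] pin[OF 4(5-7)] by auto
        then show ?thesis using eq p[OF 4(1,2)] 4 by (auto simp: pth_def nth_eq_iff_index_eq)
      qed simp
    qed
    show "f ` fst (spider s t) \<subseteq> fst G"
    proof
      fix y assume "y \<in> f ` fst (spider s t)"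
      then obtain x where x: "x \<in> fst (spider s t)" "y = f x" by blast
      have "p j ! i \<in> fst G" if "1 \<le> j" "j \<le> s" "i < t" for i j
        using pin[OF that] p[OF that(1,2)] by blast
      then show "y \<in> fst G" using vx[OF x(1)] x(2) f0 fj r by metis
    qed
    fix u v assume "{u, v} \<in> snd (spider s t)"
    then consider j where "{u, v} = {(0,0,0), (0, j, 1)}" "1 \<le> j" "j \<le> s"
      | j i where "{u, v} = {(0, j, i), (0, j, Suc i)}" "1 \<le> j" "j \<le> s" "1 \<le> i" "Suc i \<le> t"
      unfolding spider_simps(2)[OF t] by (elim UnE CollectE exE conjE) auto
    then have "\<exists>a b. {u, v} = {a, b} \<and> {f a, f b} \<in> snd G"
    proof cases
      case 1
      have "p j \<noteq> []" using p[OF 1(2,3)] t by auto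
      then have "f (0, j, 1) = hd (p j)" using fj[of j 0] by (simp add: hd_conv_nth)
      then show ?thesis using 1 p[OF 1(2,3)] f0 by metis
    next
      case 2
      then obtain i' where i': "i = Suc i'" by (cases i) auto
      have "{p j ! i', p j ! Suc i'} \<in> snd G"
        using p[OF 2(2,3)] 2(5) i' by (auto simp: pth_def successively_conv_nth)
      then show ?thesis using 2(1) i' fj by metis
    qed
    then obtain a b where "{u, v} = {a, b}" "{f a, f b} \<in> snd G" by blast
    then show "{f u, f v} \<in> snd G" by (auto simp: doubleton_eq_iff insert_commute)
  qed
qed

lemma contains_spider_if_legs:
  assumes t: "1 \<le> t" and r: "r \<in> fst G" and F: "finite F" "pairwise disjnt F" "s \<le> card F"
    and A: "\<And>A. A \<in> F \<Longrightarrow> A \<subseteq> fst G - {r} \<and> long_leg (snd G) t r A"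
  shows "contains_subgraph G (spider s t)"
proof -
  obtain F' where F': "F' \<subseteq> F" "card F' = s" by (meson F(3) obtain_subset_with_card_n)
  then have "finite F'" using F(1) finite_subset by blast
  then obtain h where h: "bij_betw h {1..s} F'"
    using F'(2) by (metis atLeastAtMost_iff card_atLeastAtMost diff_Suc_1 finite_atLeastAtMost finite_same_card_bij)
  have hF: "h j \<in> F" if "j \<in> {1..s}" for j using h that F'(1) bij_betwE by blast
  have "\<forall>j\<in>{1..s}. \<exists>xs. pth (snd G) xs \<and> set xs \<subseteq> h j \<and> length xs = t \<and> {r, hd xs} \<in> snd G"
    using A hF unfolding long_leg_def by blast
  then obtain p where p: "\<forall>j\<in>{1..s}. pth (snd G) (p j) \<and> set (p j) \<subseteq> h j \<and> length (p j) = t \<and> {r, hd (p j)} \<in> snd G"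
    by metis
  have "set (p i) \<inter> set (p j) = {}" if ij: "i \<in> {1..s}" "j \<in> {1..s}" "i \<noteq> j" for i j
  proof -
    have "h i \<noteq> h j" using h ij unfolding bij_betw_def inj_on_def by blast
    then have "disjnt (h i) (h j)" using pairwiseD[OF F(2) hF[OF ij(1)] hF[OF ij(2)]] by blast
    then show ?thesis using p ij unfolding disjnt_def by blast
  qed
  then show ?thesis
    unfolding contains_spider_iff[OF t] using r p hF A by (intro exI[of _ r] exI[of _ p]) blast
qed

text \<open>A connection from \<open>z\<close> to the long path splits it at the vertex
  \<open>q\<close> where they meet. As the path has at least \<open>2 * t - 1\<close> vertices, one
  of its two parts, counted with \<open>q\<close>, has at least \<open>t\<close> of them.\<close>

lemma long_leg_if_long_path:
  assumes Z: "conn E Z" "z \<in> Z" "{r, z} \<in> E" and xs: "pth E xs" "set xs \<subseteq> Z" "2 * t \<le> Suc (length xs)" and t: "1 \<le> t"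
  shows "long_leg E t r Z"
proof -
  have "xs \<noteq> []" using xs(3) t by auto
  then have "hd xs \<in> Z" using xs(2) by auto
  then obtain zs where zs: "pth E zs" "zs \<noteq> []" "set zs \<subseteq> Z" "hd zs = z" "last zs = hd xs"
    using conn_path[OF Z(1,2)] by blast
  have "\<exists>x\<in>set zs. x \<in> set xs" using zs(2,5) \<open>xs \<noteq> []\<close> by (metis hd_in_set last_in_set)
  \<comment> \<open>Stopping at the first common vertex keeps the connection disjoint from the rest
    of the path.\<close>
  then obtain ys q ws where q: "zs = ys @ q # ws" "q \<in> set xs" "\<forall>y\<in>set ys. y \<notin> set xs"
    by (rule split_list_first_propE)
  obtain as bs where ab: "xs = as @ q # bs" using q(2) by (meson split_list)
  have xs1: "pth E (q # bs)" "set (q # bs) \<subseteq> set xs" using xs(1) ab by (auto simp: pth_append)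
  have "xs = (as @ [q]) @ bs" using ab by simp
  then have "pth E (as @ [q])" using xs(1) pth_append by blast
  then have "pth E (rev (as @ [q]))" by (rule pth_rev)
  then have xs2: "pth E (q # rev as)" "set (q # rev as) \<subseteq> set xs" using ab by auto
  obtain us where us: "pth E (q # us)" "set (q # us) \<subseteq> set xs" "t \<le> length (q # us)"
  proof (cases "t \<le> length (q # bs)")
    case False
    then have "t \<le> length (q # rev as)" using xs(3) ab by simp
    then show ?thesis using that xs2 by blast
  qed (use that xs1 in blast)
  have zq: "zs = (ys @ [q]) @ ws" using q(1) by simp
  have "pth E (ys @ q # us)"
    using zs(1) q(3) us(1,2) unfolding q(1) by (auto simp: pth_append)
  then have "pth E (take t (ys @ q # us))" by (rule pth_take)
  moreover have "set (ys @ q # us) \<subseteq> Z" using us(2) xs(2) zs(3) unfolding q(1) by auto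
  then have "set (take t (ys @ q # us)) \<subseteq> Z" by (rule subset_trans[OF set_take_subset])
  moreover have "length (take t (ys @ q # us)) = t" using us(3) by simp
  moreover have "hd (take t (ys @ q # us)) = z" using zs(4) t unfolding q(1) by (cases ys) (auto simp: hd_append)
  ultimately show ?thesis unfolding long_leg_def using Z(3) by metis
qed

text \<open>As long as long legs may exist, at most one part is seen, and only the at most
  \<open>K\<close> neighbours of \<open>C\<close> in it can be centres of legs into
  \<open>C\<close>. After they have disappeared, the treedepth is at most \<open>2 * t\<close> and
  the argument for short paths takes over.\<close>

definition spider_state :: "'a set set \<Rightarrow> nat \<Rightarrow> nat \<Rightarrow> nat \<Rightarrow> nat \<Rightarrow> 'a set \<Rightarrow> 'a set set \<Rightarrow> bool" where
  "spider_state E c t K w C \<R> \<longleftrightarrow>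
     (\<exists>R. \<R> \<subseteq> {R}) \<and> (\<forall>R\<in>\<R>. finite R \<and> card R \<le> w \<and> card (nbs E C \<inter> R) \<le> K) \<or>
     short_state E c (2 * t) w C \<R>"

text \<open>This is the passage to the second phase, with two parts already present. A path with at
  least \<open>2 * t - 1\<close> vertices would contain a long leg for a vertex of \<open>R\<close>
  adjacent to \<open>Z\<close>, so all paths in \<open>Z\<close> are short, which bounds the
  treedepth.\<close>

lemma short_state_if_no_long_leg:
  assumes Z: "conn E Z" "finite Q" "card Q \<le> w" "finite R" "card R \<le> w"
    and no: "\<And>r. r \<in> R \<Longrightarrow> \<not> long_leg E t r Z" and adj: "r \<in> R" "z \<in> Z" "{r, z} \<in> E"
    and sub: "\<R> \<subseteq> {Q, R}" and t: "1 \<le> t" "t < 2 ^ c"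
  shows "short_state E c (2 * t) w Z \<R>"
  unfolding short_state_def
proof (intro exI[of _ "2 * t"] conjI allI impI ballI)
  have short: "Suc (length xs) < 2 * t" if "pth E xs" "set xs \<subseteq> Z" for xs
    using long_leg_if_long_path[OF Z(1) adj(2,3) that _ t(1)] no[OF adj(1)] by (meson not_le)
  show "tdl E (2 * t) Z"
    by (rule tdl_if_no_path[OF Z(1) adj(2)]) (use short in force)
  show "finite P" "card P \<le> short_width c (2 * t) w (2 * t - 2 * t)" if "P \<in> \<R>" for P
    using that sub Z by auto
  fix \<R>' f assume R': "\<R>' \<subseteq> \<R>" "\<forall>P\<in>\<R>'. f P \<in> P"
  have fin: "finite \<R>'" using R'(1) sub finite_subset[of \<R>' "{Q, R}"] by auto
  show "\<not> att E (Suc c - card \<R>') (f ` \<R>') Z"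
  proof
    assume a: "att E (Suc c - card \<R>') (f ` \<R>') Z"
    show False
    proof (cases "R \<in> \<R>'")
      case True
      \<comment> \<open>At most two representatives leave a level of at least \<open>c - 1\<close>;
        the resulting path has at least \<open>2 ^ c - 1 \<ge> t\<close> vertices and starts next to
        the representative in \<open>R\<close>.\<close>
      have "card \<R>' \<le> card {Q, R}" using R'(1) sub by (intro card_mono) auto
      then have "card \<R>' \<le> 2" using card_insert_le_m1[of 2 "{R}" Q] by simp
      then have "c \<le> Suc (Suc c - card \<R>')" by simp
      then have le: "(2::nat) ^ c \<le> 2 ^ Suc (Suc c - card \<R>')" by (rule power_increasing) simp
      obtain xs where xs: "pth E xs" "set xs \<subseteq> Z" "{f R, hd xs} \<in> E" "2 ^ Suc (Suc c - card \<R>') \<le> Suc (length xs)"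
        using att_path[OF a Z(1), of "f R" "f R"] True by blast
      have "t \<le> length xs" using le xs(4) t(2) by linarith
      then have "long_leg E t (f R) Z"
        unfolding long_leg_def using xs set_take_subset[of t xs] t(1)
        by (intro exI[of _ "take t xs"]) (auto simp: pth_take)
      then show False using no R'(2) True by blast
    next
      case False
      \<comment> \<open>Without a representative in \<open>R\<close> no leg arises, but the level is
        at least \<open>c\<close>, and the path is longer than \<open>short\<close> permits.\<close>
      then have "\<R>' \<subseteq> {Q}" using R'(1) sub by blast
      then have "card \<R>' \<le> 1" using card_mono[of "{Q}" \<R>'] by simp
      then obtain i where i: "Suc c - card \<R>' = Suc i" "c \<le> Suc i"
        using t by (cases c) (auto simp: Suc_diff_le)
      obtain xs where xs: "pth E xs" "set xs \<subseteq> Z" "2 ^ Suc (Suc i) \<le> Suc (length xs)"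
        using att_Suc_path a unfolding i(1) by blast
      have "(2::nat) ^ Suc c \<le> 2 ^ Suc (Suc i)" by (rule power_increasing) (use i(2) in auto)
      then show False using short[OF xs(1,2)] xs(3) t(2) by simp
    qed
  qed
qed simp

text \<open>A set is bad if it contains a long leg for one of the at most \<open>K\<close>
  neighbours of \<open>C\<close> in the old part. Each of these neighbours has legs in at most
  \<open>s\<close> disjoint sets, so at most \<open>K * s\<close> bad sets are disjoint and the
  hitting set has at most \<open>K * (K * s)\<close> vertices. The number \<open>w\<close> depends
  on \<open>k\<close> and \<open>s\<close> alone and hence serves in every step.\<close>

lemma spider_state_step:
  assumes G: "graph G" "\<not> contains_subgraph G (spider s t)" "rd k (snd G) {} (fst G)"
    and t: "1 \<le> t" "t < 2 ^ c" and K: "K = 2 * Suc k" and w: "w = K * (K * s) + 1"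
    and st: "spider_state (snd G) c t K w C \<R>" and C: "conn (snd G) C" "C \<subseteq> fst G"
    and R: "finite \<R>" "card \<R> \<le> c" "\<forall>R\<in>\<R>. R \<inter> C = {}"
  shows "\<exists>Q\<subseteq>C. Q \<noteq> {} \<and> card Q \<le> short_width c (2 * t) w (2 * t) \<and> (\<forall>Z\<in>comps (snd G) (C - Q).
    card (attached (snd G) (insert Q \<R>) Z) \<le> c \<and> spider_state (snd G) c t K w Z (attached (snd G) (insert Q \<R>) Z))"
proof -
  let ?E = "snd G"
  have finC: "finite C" using C(2) G(1) finite_subset by (auto simp: graph_def)
  have c1: "1 \<le> c" using t by (cases c) auto
  consider (short) "short_state ?E c (2 * t) w C \<R>"
    | (long) R0 where "\<R> \<subseteq> {R0}" "\<forall>R\<in>\<R>. finite R \<and> card R \<le> w \<and> card (nbs ?E C \<inter> R) \<le> K"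
    using st unfolding spider_state_def by blast
  then show ?thesis
  proof cases
    case short
    then show ?thesis
      using short_state_step[OF short C(1) finC R] unfolding spider_state_def by blast
  next
    case long
    define N where "N = nbs ?E C \<inter> \<Union>\<R>"
    have N: "finite N" "card N \<le> K" if "\<R> = {R0}" using long(2) that by (auto simp: N_def)
    have N': "finite N \<and> card N \<le> K"
    proof (cases "\<R> = {}")
      case False
      then have "\<R> = {R0}" using long(1) by blast
      then show ?thesis using N by blast
    qed (simp add: N_def)
    define bad where "bad Y \<longleftrightarrow> (\<exists>r\<in>N. long_leg ?E t r Y)" for Y
    have NG: "N \<subseteq> fst G" unfolding N_def nbs_def using graph_edgeD[OF G(1)] by blast
    have NC: "N \<inter> C = {}" using R(3) by (auto simp: N_def)
    have pack: "card F \<le> K * s" if F: "finite F" "pairwise disjnt F" "\<forall>A\<in>F. conn ?E A \<and> bad A \<and> A \<subseteq> C" for F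
    proof -
      have each: "card {A \<in> F. long_leg ?E t r A} \<le> s" if r: "r \<in> N" for r
      proof (rule ccontr)
        assume "\<not> ?thesis"
        then have s: "s \<le> card {A \<in> F. long_leg ?E t r A}" by simp
        have "contains_subgraph G (spider s t)"
        proof (rule contains_spider_if_legs[OF t(1) _ _ _ s])
          show "r \<in> fst G" using r NG by blast
          show "pairwise disjnt {A \<in> F. long_leg ?E t r A}"
            by (rule pairwise_subset[OF F(2)]) blast
          show "A \<subseteq> fst G - {r} \<and> long_leg ?E t r A" if "A \<in> {A \<in> F. long_leg ?E t r A}" for A
            using that F(3) r NC C(2) by blast
        qed (use F(1) in simp)
        then show False using G(2) by simp
      qed
      have "F \<subseteq> (\<Union>r\<in>N. {A \<in> F. long_leg ?E t r A})" using F(3) by (auto simp: bad_def)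
      then have "card F \<le> card (\<Union>r\<in>N. {A \<in> F. long_leg ?E t r A})"
        using N' F(1) by (intro card_mono) auto
      also have "\<dots> \<le> (\<Sum>r\<in>N. card {A \<in> F. long_leg ?E t r A})" by (rule card_UN_le) (use N' in blast)
      also have "\<dots> \<le> (\<Sum>r\<in>N. s)" by (rule sum_mono) (rule each)
      also have "\<dots> \<le> K * s" using N' by simp
      finally show ?thesis .
    qed
    have "rd k ?E ({} \<inter> C) (fst G \<inter> C)" by (rule rd_restrict[OF G(3)])
    then have rdC: "rd k ?E {} C" using C(2) by (simp add: Int_absorb1)
    obtain Q0 where Q0: "Q0 \<subseteq> C" "card Q0 \<le> K * (K * s)"
      "\<And>Y. conn ?E Y \<Longrightarrow> Y \<subseteq> C - Q0 \<Longrightarrow> \<not> bad Y \<and> card (nbs ?E Y \<inter> Q0) \<le> K"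
      using ex_hitting_set[OF rdC pack] unfolding K by blast
    obtain x where x: "x \<in> C" using conn_ne[OF C(1)] by blast
    \<comment> \<open>A part must be nonempty; the summand 1 in \<open>w\<close> covers this
      replacement when nothing has to be hit.\<close>
    define Q where "Q = (if Q0 = {} then {x} else Q0)"
    have Q: "Q \<subseteq> C" "Q \<noteq> {}" "card Q \<le> w" using Q0 x by (auto simp: Q_def w)
    have QY: "\<not> bad Y \<and> card (nbs ?E Y \<inter> Q) \<le> K" if "conn ?E Y" "Y \<subseteq> C - Q" for Y
    proof -
      have "card (nbs ?E Y \<inter> {x}) \<le> card {x}" by (rule card_mono) auto
      then have "card (nbs ?E Y \<inter> {x}) \<le> K" unfolding K by simp
      then show ?thesis using Q0(3)[OF that(1)] that(2) unfolding Q_def by (auto split: if_splits)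
    qed
    have finQ: "finite Q" using Q(1) finC finite_subset by blast
    have "w \<le> short_width c (2 * t) w (2 * t)"
      using short_width_mono[of 0 "2 * t" c "2 * t" w] by simp
    then have cQ: "card Q \<le> short_width c (2 * t) w (2 * t)" using Q(3) by simp
    have "card (attached ?E (insert Q \<R>) Z) \<le> c \<and> spider_state ?E c t K w Z (attached ?E (insert Q \<R>) Z)"
      if "Z \<in> comps ?E (C - Q)" for Z
    proof -
      have Z: "conn ?E Z" "Z \<subseteq> C - Q" using conn_comps[OF that] comps_subset[OF that] .
      show ?thesis
      proof (cases "\<exists>R\<in>\<R>. \<exists>r\<in>R. \<exists>z\<in>Z. {r, z} \<in> ?E")
        case False
        then have sub: "attached ?E (insert Q \<R>) Z \<subseteq> {Q}" unfolding attached_def by blast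
        then have "card (attached ?E (insert Q \<R>) Z) \<le> 1" using card_mono[OF _ sub] by simp
        moreover have "spider_state ?E c t K w Z (attached ?E (insert Q \<R>) Z)"
          unfolding spider_state_def using sub finQ Q(3) QY[OF Z] by blast
        ultimately show ?thesis using c1 by simp
      next
        case True
        then obtain R r z where r: "R \<in> \<R>" "r \<in> R" "z \<in> Z" "{r, z} \<in> ?E" by blast
        have RR: "\<R> = {R}" using long(1) r(1) by blast
        have no: "\<not> long_leg ?E t r' Z" if "r' \<in> R" for r'
        proof
          assume l: "long_leg ?E t r' Z"
          then obtain xs where "pth ?E xs" "set xs \<subseteq> Z" "length xs = t" "{r', hd xs} \<in> ?E"
            unfolding long_leg_def by blast
          then have "hd xs \<in> Z" "{r', hd xs} \<in> ?E" using t(1) by (auto intro!: subsetD[of "set xs" Z] hd_in_set)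
          then have "r' \<in> N" using that Z(2) unfolding N_def nbs_def RR by blast
          then show False using QY[OF Z] l unfolding bad_def by blast
        qed
        have sub: "attached ?E (insert Q \<R>) Z \<subseteq> {Q, R}" unfolding attached_def RR by blast
        \<comment> \<open>Two parts may be seen here. For \<open>c = 1\<close> this cannot happen:
          then \<open>t = 1\<close>, and a single neighbour is already a long leg.\<close>
        have "c \<noteq> 1"
        proof
          assume "c = 1"
          then have "t = 1" using t by simp
          then have "long_leg ?E t r Z" unfolding long_leg_def using r by (intro exI[of _ "[z]"]) simp
          then show False using no r(2) by blast
        qed
        then have "2 \<le> c" using c1 by simp
        moreover have "card (attached ?E (insert Q \<R>) Z) \<le> card {Q, R}" by (rule card_mono[OF _ sub]) simp
        moreover have "card {Q, R} \<le> 2" using card_insert_le_m1[of 2 "{R}" Q] by simp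
        moreover have "short_state ?E c (2 * t) w Z (attached ?E (insert Q \<R>) Z)"
          using short_state_if_no_long_leg[OF Z(1) finQ Q(3) _ _ no r(2-4) sub t] long(2) r(1) by blast
        ultimately show ?thesis unfolding spider_state_def by simp
      qed
    qed
    then show ?thesis using Q cQ by blast
  qed
qed

lemma utw_spider_upper:
  assumes t: "1 \<le> t" "t < 2 ^ c"
  shows "utw_bounded_by (excl (spider s t)) c"
  unfolding utw_bounded_by_def
proof (intro exI[of _ "\<lambda>k. short_width c (2 * t) (2 * Suc k * (2 * Suc k * s) + 1) (2 * t)"] ballI)
  fix G assume "G \<in> excl (spider s t)"
  then have G: "graph G" "\<not> contains_subgraph G (spider s t)" by (auto simp: excl_def)
  define K where "K = 2 * Suc (tw G)"
  define w where "w = K * (K * s) + 1"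
  have "tpw c G \<le> short_width c (2 * t) w (2 * t)"
    by (rule tpw_le_if_step[OF G(1), where P = "spider_state (snd G) c t K w"])
      (use spider_state_step[OF G rd_tw[OF G(1)] t K_def w_def] in \<open>auto simp: spider_state_def\<close>)
  then show "tpw c G \<le> short_width c (2 * t) (2 * Suc (tw G) * (2 * Suc (tw G) * s) + 1) (2 * t)"
    unfolding w_def K_def .
qed

section \<open>Excluding several copies\<close>

text \<open>The partition into one part, with a one-vertex host, shows that the minimum defining
  \<open>tpw\<close> is attained.\<close>

lemma ex_tpw_partition:
  fixes G :: "nat graph"
  assumes "finite (fst G)"
  shows "\<exists>(H :: nat graph) \<phi>. graph H \<and> tw H \<le> c \<and> H_partition G H \<phi> \<and>
    (\<forall>x. card {v \<in> fst G. \<phi> v = x} \<le> tpw c G)"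
proof -
  define H0 :: "nat graph" where "H0 = ({0}, {})"
  have H0: "graph H0" by (simp add: H0_def graph_def)
  have "rd c (snd H0) {} (fst H0)" unfolding H0_def by (rule rd_small) auto
  then have "tw H0 \<le> c" by (rule tw_le_if_rd[OF H0])
  moreover have "H_partition G H0 (\<lambda>_. 0)" by (simp add: H_partition_def H0_def)
  ultimately have "\<exists>k (H :: nat graph) \<phi>. graph H \<and> tw H \<le> c \<and> H_partition G H \<phi> \<and> partition_width G H \<phi> \<le> k"
    using H0 by blast
  then have "\<exists>(H :: nat graph) \<phi>. graph H \<and> tw H \<le> c \<and> H_partition G H \<phi> \<and> partition_width G H \<phi> \<le> tpw c G"
    unfolding tpw_def by (rule LeastI_ex)
  then obtain H :: "nat graph" and \<phi> where H: "graph H" "tw H \<le> c" "H_partition G H \<phi>" "partition_width G H \<phi> \<le> tpw c G"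
    by blast
  have "card {v \<in> fst G. \<phi> v = x} \<le> tpw c G" for x
  proof (cases "x \<in> fst H")
    case True
    have "finite (fst H)" using H(1) by (simp add: graph_def)
    then have "card {v \<in> fst G. \<phi> v = x} \<le> partition_width G H \<phi>"
      unfolding partition_width_def using True by (intro Max_ge) auto
    then show ?thesis using H(4) by simp
  next
    case False
    then have "{v \<in> fst G. \<phi> v = x} = {}" using H(3) by (auto simp: H_partition_def)
    then show ?thesis by (metis card.empty le0)
  qed
  then show ?thesis using H by blast
qed

definition del_vertices :: "'a graph \<Rightarrow> 'a set \<Rightarrow> 'a graph" where
  "del_vertices G Z = (fst G - Z, {e \<in> snd G. e \<inter> Z = {}})"

lemma graph_del_vertices:
  assumes "graph G"
  shows "graph (del_vertices G Z)"
  unfolding graph_def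
proof (intro conjI ballI)
  show "finite (fst (del_vertices G Z))" using assms by (simp add: graph_def del_vertices_def)
  fix e assume e: "e \<in> snd (del_vertices G Z)"
  then obtain u v where "e = {u, v}" "u \<noteq> v" "u \<in> fst G" "v \<in> fst G"
    using assms unfolding graph_def del_vertices_def by auto
  then show "\<exists>u v. e = {u, v} \<and> u \<noteq> v \<and> u \<in> fst (del_vertices G Z) \<and> v \<in> fst (del_vertices G Z)"
    using e by (intro exI[of _ u] exI[of _ v]) (auto simp: del_vertices_def)
qed

lemma tw_del_vertices:
  assumes "graph G"
  shows "tw (del_vertices G Z) \<le> tw G"
proof (rule tw_le_if_rd[OF graph_del_vertices[OF assms]])
  have "rd (tw G) (snd G) ({} \<inter> (- Z)) (fst G \<inter> (- Z))" by (rule rd_restrict[OF rd_tw[OF assms]])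
  then have "rd (tw G) (snd G) {} (fst (del_vertices G Z))"
    by (simp add: del_vertices_def Diff_eq)
  then show "rd (tw G) (snd (del_vertices G Z)) {} (fst (del_vertices G Z))"
    by (rule rd_mono_edges) (auto simp: del_vertices_def)
qed

text \<open>One copy is deleted at a time: a copy of \<open>X\<close> together with \<open>l\<close>
  disjoint copies found after its deletion would be \<open>Suc l\<close> copies in
  \<open>G\<close>.\<close>

lemma ex_hitting_copies:
  assumes "\<not> contains_subgraph G (copies l X)" "finite (fst X)"
  shows "\<exists>Z\<subseteq>fst G. finite Z \<and> card Z \<le> l * card (fst X) \<and> \<not> contains_subgraph (del_vertices G Z) X"
  using assms(1)
proof (induction l arbitrary: G)
  case 0
  have "contains_subgraph G (copies 0 X)" by (simp add: contains_subgraph_def copies_def)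
  then show ?case using 0 by simp
next
  case (Suc l)
  show ?case
  proof (cases "contains_subgraph G X")
    case False
    moreover have "del_vertices G {} = G" by (simp add: del_vertices_def)
    ultimately show ?thesis by (intro exI[of _ "{}"]) simp
  next
    case True
    then obtain f where f: "inj_on f (fst X)" "f ` fst X \<subseteq> fst G" "\<And>u v. {u, v} \<in> snd X \<Longrightarrow> {f u, f v} \<in> snd G"
      unfolding contains_subgraph_def by blast
    define Z1 where "Z1 = f ` fst X"
    have Z1: "finite Z1" "card Z1 \<le> card (fst X)" "Z1 \<subseteq> fst G"
      using assms(2) f(2) by (auto simp: Z1_def card_image_le)
    have "\<not> contains_subgraph (del_vertices G Z1) (copies l X)"
    proof
      assume "contains_subgraph (del_vertices G Z1) (copies l X)"
      then obtain g where g: "inj_on g (fst (copies l X))" "g ` fst (copies l X) \<subseteq> fst G - Z1"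
        "\<And>u v. {u, v} \<in> snd (copies l X) \<Longrightarrow> {g u, g v} \<in> snd G"
        unfolding contains_subgraph_def del_vertices_def by auto
      define h where "h = (\<lambda>(i, v). if i = l then f v else g (i, v))"
      have hl: "h (l, v) = f v" for v by (simp add: h_def)
      have hg: "h x = g x" if "x \<in> fst (copies l X)" for x using that by (auto simp: h_def copies_def)
      have split: "x \<in> fst (copies (Suc l) X) \<longleftrightarrow> (\<exists>v\<in>fst X. x = (l, v)) \<or> x \<in> fst (copies l X)" for x
        by (cases x) (auto simp: copies_def less_Suc_eq)
      have "contains_subgraph G (copies (Suc l) X)"
        unfolding contains_subgraph_def
      proof (intro exI[of _ h] conjI allI impI)
        show "inj_on h (fst (copies (Suc l) X))"
        proof (rule inj_onI)
          fix x y assume xy: "x \<in> fst (copies (Suc l) X)" "y \<in> fst (copies (Suc l) X)" "h x = h y"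
          have ne: "h (l, v) \<noteq> h z" if "v \<in> fst X" "z \<in> fst (copies l X)" for v z
            using that g(2) hl[of v] hg[of z] unfolding Z1_def by auto
          consider v w where "v \<in> fst X" "w \<in> fst X" "x = (l, v)" "y = (l, w)"
            | v where "v \<in> fst X" "x = (l, v)" "y \<in> fst (copies l X)"
            | v where "v \<in> fst X" "y = (l, v)" "x \<in> fst (copies l X)"
            | "x \<in> fst (copies l X)" "y \<in> fst (copies l X)"
            using xy(1,2) unfolding split by blast
          then show "x = y"
          proof cases
            case 1
            then show ?thesis using xy(3) hl f(1) by (auto dest: inj_onD)
          next
            case 2
            then show ?thesis using xy(3) ne by blast
          next
            case 3
            then show ?thesis using xy(3) ne by metis
          next
            case 4
            then show ?thesis using xy(3) hg g(1) by (auto dest: inj_onD)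
          qed
        qed
        show "h ` fst (copies (Suc l) X) \<subseteq> fst G"
        proof (rule image_subsetI)
          fix x assume "x \<in> fst (copies (Suc l) X)"
          then consider v where "v \<in> fst X" "x = (l, v)" | "x \<in> fst (copies l X)" unfolding split by blast
          then show "h x \<in> fst G"
          proof cases
            case 1
            then show ?thesis using f(2) hl by auto
          next
            case 2
            then show ?thesis using g(2) hg[OF 2] by auto
          qed
        qed
        fix u v assume "{u, v} \<in> snd (copies (Suc l) X)"
        then obtain i e where ie: "{u, v} = (\<lambda>v. (i, v)) ` e" "i < Suc l" "e \<in> snd X" by (auto simp: copies_def)
        then obtain a b where ab: "u = (i, a)" "v = (i, b)" by blast
        then have e: "e = {a, b}"
          using ie(1) by auto
        show "{h u, h v} \<in> snd G"
        proof (cases "i = l")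
          case True
          then show ?thesis using f(3)[of a b] ie(3) e ab hl by simp
        next
          case False
          then have "i < l" using ie(2) by simp
          then have "{u, v} \<in> snd (copies l X)" unfolding ie(1) copies_def snd_conv using ie(3) by blast
          then show ?thesis using g(3)[of u v] False ab by (simp add: h_def)
        qed
      qed
      then show False using Suc.prems by simp
    qed
    then obtain Z2 where Z2: "Z2 \<subseteq> fst (del_vertices G Z1)" "finite Z2" "card Z2 \<le> l * card (fst X)"
      "\<not> contains_subgraph (del_vertices (del_vertices G Z1) Z2) X"
      using Suc.IH by blast
    have "del_vertices (del_vertices G Z1) Z2 = del_vertices G (Z1 \<union> Z2)"
      by (auto simp: del_vertices_def)
    moreover have "card (Z1 \<union> Z2) \<le> Suc l * card (fst X)"
      using card_Un_le[of Z1 Z2] Z1(2) Z2(3) by simp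
    moreover have "Z1 \<union> Z2 \<subseteq> fst G" using Z1(3) Z2(1) by (auto simp: del_vertices_def)
    ultimately show ?thesis using Z1(1) Z2(2,4) by (intro exI[of _ "Z1 \<union> Z2"]) simp
  qed
qed

lemma tpw_Suc_le:
  fixes G :: "nat graph"
  assumes G: "graph G" and Z: "finite Z" "card Z \<le> w" and w: "tpw c (del_vertices G Z) \<le> w"
  shows "tpw (Suc c) G \<le> w"
proof -
  let ?G = "del_vertices G Z"
  have finG: "finite (fst G)" using G by (simp add: graph_def)
  then have "finite (fst ?G)" by (simp add: del_vertices_def)
  from ex_tpw_partition[OF this, of c] obtain H :: "nat graph" and \<phi> where H: "graph H" "tw H \<le> c" "H_partition ?G H \<phi>"
    "\<forall>x. card {v \<in> fst ?G. \<phi> v = x} \<le> tpw c ?G"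
    by blast
  have finH: "finite (fst H)" using H(1) by (simp add: graph_def)
  then obtain a where a: "a \<notin> fst H" using ex_new_if_finite by blast
  define H' where "H' = (insert a (fst H), snd H \<union> {{a, x} | x. x \<in> fst H})"
  have eH: "{u, v} \<in> snd H" if "u \<in> fst H" "v \<in> fst H" "{u, v} \<in> snd H'" for u v
    using that a by (auto simp: H'_def doubleton_eq_iff)
  have gH': "graph H'"
    unfolding graph_def
  proof (intro conjI ballI)
    show "finite (fst H')" using finH by (simp add: H'_def)
    fix e assume "e \<in> snd H'"
    then consider "e \<in> snd H" | x where "e = {a, x}" "x \<in> fst H" by (auto simp: H'_def)
    then show "\<exists>u v. e = {u, v} \<and> u \<noteq> v \<and> u \<in> fst H' \<and> v \<in> fst H'"
    proof cases
      case 1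
      then obtain u v where "e = {u, v}" "u \<noteq> v" "u \<in> fst H" "v \<in> fst H" using H(1) unfolding graph_def by metis
      then show ?thesis by (auto simp: H'_def)
    next
      case 2
      then show ?thesis using a by (intro exI[of _ a] exI[of _ x]) (auto simp: H'_def)
    qed
  qed
  have "rd c (snd H) {} (fst H)" using tw_le_iff_rd[OF H(1)] H(2) by blast
  then have "rd (Suc c) (snd H') {a} (fst H)"
    by (rule rd_insert_apex) (use a eH in auto)
  then have "rd (Suc c) (snd H') {} (fst H')" unfolding H'_def fst_conv by (rule rd.intro) simp
  then have tw: "tw H' \<le> Suc c" by (rule tw_le_if_rd[OF gH'])
  define \<psi> where "\<psi> v = (if v \<in> Z then a else \<phi> v)" for v
  have hp: "\<phi> v \<in> fst H" if "v \<in> fst G" "v \<notin> Z" for v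
    using H(3) that by (simp add: H_partition_def del_vertices_def)
  have "H_partition G H' \<psi>"
    unfolding H_partition_def
  proof (intro conjI ballI allI impI)
    show "\<psi> v \<in> fst H'" if "v \<in> fst G" for v using hp that by (simp add: \<psi>_def H'_def)
    fix u v assume uv: "{u, v} \<in> snd G"
    then have V: "u \<in> fst G" "v \<in> fst G" using graph_edgeD[OF G] by blast+
    show "\<psi> u = \<psi> v \<or> {\<psi> u, \<psi> v} \<in> snd H'"
    proof (cases "u \<in> Z \<or> v \<in> Z")
      case True
      then show ?thesis using hp V by (auto simp: \<psi>_def H'_def insert_commute)
    next
      case False
      then have "{u, v} \<in> snd ?G" using uv by (simp add: del_vertices_def)
      then have "\<phi> u = \<phi> v \<or> {\<phi> u, \<phi> v} \<in> snd H" using H(3) unfolding H_partition_def by blast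
      then show ?thesis using False by (auto simp: \<psi>_def H'_def)
    qed
  qed
  then show ?thesis
  proof (rule tpw_leI[OF gH' tw _ finG])
    fix x assume "x \<in> fst H'"
    show "card {v \<in> fst G. \<psi> v = x} \<le> w"
    proof (cases "x = a")
      case True
      then have "{v \<in> fst G. \<psi> v = x} \<subseteq> Z" using hp a by (auto simp: \<psi>_def split: if_splits)
      then show ?thesis using card_mono[OF Z(1)] Z(2) le_trans by blast
    next
      case False
      then have "{v \<in> fst G. \<psi> v = x} \<subseteq> {v \<in> fst ?G. \<phi> v = x}"
        by (auto simp: \<psi>_def del_vertices_def split: if_splits)
      then have "card {v \<in> fst G. \<psi> v = x} \<le> card {v \<in> fst ?G. \<phi> v = x}"
        by (intro card_mono) (simp_all add: del_vertices_def finG)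
      then show ?thesis using H(4) w le_trans by blast
    qed
  qed
qed

lemma utw_copies_upper:
  assumes "utw_bounded_by (excl X) c" "finite (fst X)"
  shows "utw_bounded_by (excl (copies l X)) (Suc c)"
proof -
  obtain f where f: "\<And>G. G \<in> excl X \<Longrightarrow> tpw c G \<le> f (tw G)"
    using assms(1) unfolding utw_bounded_by_def by blast
  show ?thesis
    unfolding utw_bounded_by_def
  \<comment> \<open>The deletion may lower the treewidth while \<open>f\<close> need not be
    monotone, so the values of \<open>f\<close> at all smaller arguments are summed.\<close>
  proof (intro exI[of _ "\<lambda>k. (\<Sum>j\<le>k. f j) + l * card (fst X)"] ballI)
    fix G assume "G \<in> excl (copies l X)"
    then have G: "graph G" "\<not> contains_subgraph G (copies l X)" by (auto simp: excl_def)
    obtain Z where Z: "finite Z" "card Z \<le> l * card (fst X)" "\<not> contains_subgraph (del_vertices G Z) X"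
      using ex_hitting_copies[OF G(2) assms(2)] by blast
    have "tpw c (del_vertices G Z) \<le> f (tw (del_vertices G Z))"
      using f Z(3) graph_del_vertices[OF G(1)] by (simp add: excl_def)
    also have "\<dots> \<le> (\<Sum>j\<le>tw G. f j)"
      by (rule member_le_sum) (use tw_del_vertices[OF G(1)] in auto)
    finally show "tpw (Suc c) G \<le> (\<Sum>j\<le>tw G. f j) + l * card (fst X)"
      by (intro tpw_Suc_le[OF G(1) Z(1)]) (use Z(2) in auto)
  qed
qed

section \<open>Lower bounds\<close>

text \<open>On graphs of treewidth at most \<open>T\<close> a bound in terms of the treewidth
  amounts to a constant, namely the sum of its first values.\<close>

lemma not_utw_bounded_byI:
  assumes "\<And>N. \<exists>G\<in>C. tw G \<le> T \<and> N < tpw c G"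
  shows "\<not> utw_bounded_by C c"
proof
  assume "utw_bounded_by C c"
  then obtain f where f: "\<And>G. G \<in> C \<Longrightarrow> tpw c G \<le> f (tw G)" unfolding utw_bounded_by_def by blast
  obtain G where G: "G \<in> C" "tw G \<le> T" "(\<Sum>j\<le>T. f j) < tpw c G" using assms by blast
  have "f (tw G) \<le> (\<Sum>j\<le>T. f j)" by (rule member_le_sum) (use G(2) in auto)
  then show False using f[OF G(1)] G(3) by simp
qed

text \<open>No host graph occurs, only the sizes of the fibres of a labelling. This makes the
  property easy to carry through the constructions that enlarge the clique.\<close>

definition forcing :: "nat \<Rightarrow> nat \<Rightarrow> nat graph \<Rightarrow> bool" where
  "forcing N m G \<longleftrightarrow> (\<forall>\<phi> :: nat \<Rightarrow> nat. (\<forall>x. card {v \<in> fst G. \<phi> v = x} \<le> N) \<longrightarrow>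
     (\<exists>K\<subseteq>fst G. finite K \<and> card K = m \<and> inj_on \<phi> K \<and> (\<forall>u\<in>K. \<forall>v\<in>K. u \<noteq> v \<longrightarrow> {u, v} \<in> snd G)))"

text \<open>The parts of the clique vertices are distinct and pairwise adjacent in the host, so
  nothing separates them and they share a bag.\<close>

lemma tpw_gt_if_forcing:
  assumes G: "graph G" and f: "forcing N m G" and m: "Suc c < m"
  shows "N < tpw c G"
proof (rule ccontr)
  assume "\<not> N < tpw c G"
  then have N: "tpw c G \<le> N" by simp
  have "finite (fst G)" using G by (simp add: graph_def)
  from ex_tpw_partition[OF this, of c] obtain H :: "nat graph" and \<phi> where H: "graph H" "tw H \<le> c" "H_partition G H \<phi>"
    "\<forall>x. card {v \<in> fst G. \<phi> v = x} \<le> tpw c G"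
    by blast
  have "\<forall>x. card {v \<in> fst G. \<phi> v = x} \<le> N" using H(4) N le_trans by blast
  then obtain K where K: "K \<subseteq> fst G" "finite K" "card K = m" "inj_on \<phi> K"
    "\<And>u v. u \<in> K \<Longrightarrow> v \<in> K \<Longrightarrow> u \<noteq> v \<Longrightarrow> {u, v} \<in> snd G"
    using f[unfolded forcing_def, rule_format, of \<phi>] by blast
  have "rd c (snd H) {} (fst H)" using tw_le_iff_rd[OF H(1)] H(2) by blast
  then have "card (\<phi> ` K) \<le> Suc c"
  proof (rule rd_linked_card)
    show "\<phi> ` K \<subseteq> {} \<union> fst H" using H(3) K(1) by (auto simp: H_partition_def)
    show "{} \<union> fst H \<subseteq> fst H" by simp
    show "\<forall>x\<in>fst H. \<forall>y\<in>fst H. {x, y} \<in> snd H \<longrightarrow> y \<in> {} \<union> fst H" by simp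
    fix Z x y assume xy: "x \<in> \<phi> ` K - Z" "y \<in> \<phi> ` K - Z"
    then obtain u v where uv: "u \<in> K" "v \<in> K" "x = \<phi> u" "y = \<phi> v" by blast
    show "reach (snd H) (fst H - Z) x y"
    proof (cases "x = y")
      case False
      then have "{u, v} \<in> snd G" using K(5) uv by blast
      then have "{x, y} \<in> snd H" using H(3) False uv unfolding H_partition_def by blast
      then show ?thesis
        using reach_step[of "snd H" "fst H - Z" x x y] graph_edgeD[OF H(1), of x y] xy by simp
    qed simp
  qed
  then show False using card_image[OF K(4)] K(3) m by simp
qed

lemma not_utw_if_forcing:
  assumes "\<And>N. \<exists>G\<in>C. graph G \<and> rd k (snd G) {} (fst G) \<and> forcing N m G" and "Suc c < m"
  shows "\<not> utw_bounded_by C c"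
proof (rule not_utw_bounded_byI)
  fix N
  obtain G where "G \<in> C" "graph G" "rd k (snd G) {} (fst G)" "forcing N m G" using assms(1) by blast
  then show "\<exists>G\<in>C. tw G \<le> k \<and> N < tpw c G"
    using tpw_gt_if_forcing[OF _ _ assms(2)] tw_le_if_rd by blast
qed

text \<open>Pigeonhole: if \<open>B\<close> met all \<open>Suc M\<close> disjoint sets, it would
  have a different element in each.\<close>

lemma ex_avoiding_index:
  assumes fin: "finite V" and disj: "\<And>i j. i \<le> M \<Longrightarrow> j \<le> M \<Longrightarrow> i \<noteq> j \<Longrightarrow> A i \<inter> A j = {}"
    and B: "finite B" "card B \<le> M"
  shows "\<exists>j\<le>M. A j \<inter> B = {}"
proof (rule ccontr)
  assume "\<not> ?thesis"
  then have "\<forall>j\<in>{..M}. \<exists>b. b \<in> A j \<inter> B" by blast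
  then obtain b where b: "\<And>j. j \<le> M \<Longrightarrow> b j \<in> A j \<inter> B" by (metis atMost_iff)
  have "inj_on b {..M}"
  proof (rule inj_onI, rule ccontr)
    fix i j assume ij: "i \<in> {..M}" "j \<in> {..M}" "b i = b j" "i \<noteq> j"
    then show False using b[of i] b[of j] disj[of i j] by auto
  qed
  then have "card {..M} \<le> card B" by (rule card_inj_on_le) (use b B(1) in auto)
  then show False using B(2) by simp
qed

section \<open>An apex joined to many copies\<close>

definition apex_copy :: "nat \<Rightarrow> nat \<Rightarrow> nat" where
  "apex_copy j v = Suc (prod_encode (j, v))"

lemma apex_copy_eq [simp]: "apex_copy i u = apex_copy j v \<longleftrightarrow> i = j \<and> u = v"
  by (simp add: apex_copy_def)

lemma apex_copy_ne_0 [simp]: "apex_copy i u \<noteq> 0" "0 \<noteq> apex_copy i u"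
  by (simp_all add: apex_copy_def)

definition add_apex :: "nat \<Rightarrow> nat graph \<Rightarrow> nat graph" where
  "add_apex N G = (insert 0 {apex_copy j v | j v. j \<le> N \<and> v \<in> fst G},
     {{0, apex_copy j v} | j v. j \<le> N \<and> v \<in> fst G} \<union>
     {{apex_copy j u, apex_copy j v} | j u v. j \<le> N \<and> {u, v} \<in> snd G})"

lemma add_apex_edge:
  "{apex_copy i u, apex_copy j v} \<in> snd (add_apex N G) \<longleftrightarrow> i = j \<and> j \<le> N \<and> {u, v} \<in> snd G"
  by (auto simp: add_apex_def doubleton_eq_iff insert_commute)

lemma graph_add_apex:
  assumes "graph G"
  shows "graph (add_apex N G)"
  unfolding graph_def
proof (intro conjI ballI)
  have "fst (add_apex N G) = insert 0 ((\<lambda>(j, v). apex_copy j v) ` ({..N} \<times> fst G))"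
    by (auto simp: add_apex_def)
  then show "finite (fst (add_apex N G))" using assms by (simp add: graph_def)
  fix e assume "e \<in> snd (add_apex N G)"
  then consider j v where "e = {0, apex_copy j v}" "j \<le> N" "v \<in> fst G"
    | j u v where "e = {apex_copy j u, apex_copy j v}" "j \<le> N" "{u, v} \<in> snd G"
    by (auto simp: add_apex_def)
  then show "\<exists>u v. e = {u, v} \<and> u \<noteq> v \<and> u \<in> fst (add_apex N G) \<and> v \<in> fst (add_apex N G)"
  proof cases
    case 1
    then show ?thesis by (intro exI[of _ 0] exI[of _ "apex_copy j v"]) (auto simp: add_apex_def)
  next
    case 2
    then show ?thesis using graph_edgeD[OF assms 2(3)]
      by (intro exI[of _ "apex_copy j u"] exI[of _ "apex_copy j v"]) (auto simp: add_apex_def)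
  qed
qed

lemma rd_add_apex:
  assumes "rd k (snd G) {} (fst G)"
  shows "rd (Suc k) (snd (add_apex N G)) {} (fst (add_apex N G))"
proof -
  let ?E = "snd (add_apex N G)"
  have "rd k ?E {} (\<Union>j\<in>{..N}. apex_copy j ` fst G)"
  proof (rule rd_UNION)
    fix j assume j: "j \<in> {..N}"
    have "rd k ?E (apex_copy j ` {}) (apex_copy j ` fst G)"
      by (rule rd_image[OF assms]) (auto simp: inj_on_def add_apex_edge)
    then show "rd k ?E {} (apex_copy j ` fst G)" by simp
  qed (auto simp: add_apex_edge)
  then have "rd (Suc k) ?E {0} (\<Union>j\<in>{..N}. apex_copy j ` fst G)"
    by (rule rd_insert_apex) auto
  then have "rd (Suc k) ?E {} (insert 0 (\<Union>j\<in>{..N}. apex_copy j ` fst G))"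
    by (rule rd.intro) simp
  moreover have "insert 0 (\<Union>j\<in>{..N}. apex_copy j ` fst G) = fst (add_apex N G)"
    by (auto simp: add_apex_def)
  ultimately show ?thesis by simp
qed

text \<open>Restricting a labelling to an embedded copy only shrinks its fibres.\<close>

lemma forcing_copy:
  assumes f: "forcing N m G" and e: "inj_on e (fst G)" and V: "finite V" "e ` fst G \<subseteq> V"
    and E: "\<And>u v. {u, v} \<in> snd G \<Longrightarrow> {e u, e v} \<in> E" and \<phi>: "\<And>x. card {v \<in> V. \<phi> v = x} \<le> N"
  obtains K where "K \<subseteq> e ` fst G" "finite K" "card K = m" "inj_on (\<phi> :: nat \<Rightarrow> nat) K"
    "\<And>u v. u \<in> K \<Longrightarrow> v \<in> K \<Longrightarrow> u \<noteq> v \<Longrightarrow> {u, v} \<in> E"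
proof -
  have "card {v \<in> fst G. \<phi> (e v) = x} \<le> N" for x
  proof -
    have "e ` {v \<in> fst G. \<phi> (e v) = x} \<subseteq> {v \<in> V. \<phi> v = x}" using V(2) by blast
    moreover have "inj_on e {v \<in> fst G. \<phi> (e v) = x}" using e by (rule inj_on_subset) blast
    ultimately have "card {v \<in> fst G. \<phi> (e v) = x} \<le> card {v \<in> V. \<phi> v = x}"
      using V(1) by (intro card_inj_on_le[of e]) auto
    then show ?thesis using \<phi>[of x] by simp
  qed
  then obtain K where K: "K \<subseteq> fst G" "finite K" "card K = m" "inj_on (\<lambda>v. \<phi> (e v)) K"
    "\<forall>u\<in>K. \<forall>v\<in>K. u \<noteq> v \<longrightarrow> {u, v} \<in> snd G"
    using f[unfolded forcing_def, rule_format, of "\<lambda>v. \<phi> (e v)"] by blast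
  have eK: "inj_on e K" using e K(1) by (rule inj_on_subset)
  show ?thesis
  proof (rule that[of "e ` K"])
    show "card (e ` K) = m" using card_image[OF eK] K(3) by simp
    show "inj_on \<phi> (e ` K)" using K(4) by (auto simp: inj_on_def)
    show "{u, v} \<in> E" if uv: "u \<in> e ` K" "v \<in> e ` K" "u \<noteq> v" for u v
    proof -
      obtain a b where "a \<in> K" "b \<in> K" "u = e a" "v = e b" using uv by blast
      moreover from this have "{a, b} \<in> snd G" using K(5) uv(3) by auto
      ultimately show ?thesis using E[of a b] by simp
    qed
  qed (use K in auto)
qed

lemma forcing_insert:
  assumes "finite K" "card K = m" "inj_on \<phi> K" "\<And>u v. u \<in> K \<Longrightarrow> v \<in> K \<Longrightarrow> u \<noteq> v \<Longrightarrow> {u, v} \<in> E"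
    and "\<phi> a \<notin> \<phi> ` K" "\<And>u. u \<in> K \<Longrightarrow> {a, u} \<in> E"
  shows "finite (insert a K)" "card (insert a K) = Suc m" "inj_on \<phi> (insert a K)"
    "\<And>u v. u \<in> insert a K \<Longrightarrow> v \<in> insert a K \<Longrightarrow> u \<noteq> v \<Longrightarrow> {u, v} \<in> E"
proof -
  have "a \<notin> K" using assms(5) by blast
  then show "card (insert a K) = Suc m" using assms(1,2) by simp
  show "inj_on \<phi> (insert a K)" using assms(3,5) \<open>a \<notin> K\<close> by auto
  fix u v assume "u \<in> insert a K" "v \<in> insert a K" "u \<noteq> v"
  then show "{u, v} \<in> E" using assms(4)[of u v] assms(6)[of u] assms(6)[of v] by (auto simp: insert_commute)
qed (use assms(1) in simp)

text \<open>The part of the apex has at most \<open>N\<close> vertices, so one of the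
  \<open>Suc N\<close> copies avoids it, and the clique forced in this copy is extended by the
  apex.\<close>

lemma forcing_add_apex:
  assumes G: "graph G" and f: "forcing N m G"
  shows "forcing N (Suc m) (add_apex N G)"
  unfolding forcing_def
proof (intro allI impI)
  let ?V = "fst (add_apex N G)" and ?E = "snd (add_apex N G)"
  fix \<phi> :: "nat \<Rightarrow> nat" assume \<phi>: "\<forall>x. card {v \<in> ?V. \<phi> v = x} \<le> N"
  have fin: "finite ?V" using graph_add_apex[OF G] by (simp add: graph_def)
  define B where "B = {v \<in> ?V. \<phi> v = \<phi> 0}"
  have "\<exists>j\<le>N. apex_copy j ` fst G \<inter> B = {}"
    by (rule ex_avoiding_index[OF fin]) (use \<phi> fin in \<open>auto simp: B_def\<close>)
  then obtain j where j: "j \<le> N" "apex_copy j ` fst G \<inter> B = {}" by blast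
  have sub: "apex_copy j ` fst G \<subseteq> ?V" using j(1) by (auto simp: add_apex_def)
  obtain K where K: "K \<subseteq> apex_copy j ` fst G" "finite K" "card K = m" "inj_on \<phi> K"
    "\<And>u v. u \<in> K \<Longrightarrow> v \<in> K \<Longrightarrow> u \<noteq> v \<Longrightarrow> {u, v} \<in> ?E"
    by (rule forcing_copy[OF f _ fin sub, where E = ?E and \<phi> = \<phi>]) (use \<phi> j(1) in \<open>auto simp: inj_on_def add_apex_edge\<close>)
  have 0: "\<phi> 0 \<notin> \<phi> ` K" using K(1) j(2) sub unfolding B_def by (auto 4 3)
  have *: "{0, u} \<in> ?E" if u: "u \<in> K" for u
  proof -
    obtain v where "u = apex_copy j v" "v \<in> fst G" using u K(1) by blast
    then show ?thesis using j(1) unfolding add_apex_def snd_conv by blast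
  qed
  note forcing_insert[OF K(2-5) 0 *]
  moreover have "insert 0 K \<subseteq> ?V" using K(1) sub by (auto simp: add_apex_def)
  ultimately show "\<exists>K\<subseteq>?V. finite K \<and> card K = Suc m \<and> inj_on \<phi> K \<and> (\<forall>u\<in>K. \<forall>v\<in>K. u \<noteq> v \<longrightarrow> {u, v} \<in> ?E)"
    by blast
qed

lemma add_apex_conn:
  assumes S: "conn (snd (add_apex N G)) S" "S \<subseteq> fst (add_apex N G) - {0}"
  obtains g where "inj_on g S" "g ` S \<subseteq> fst G"
    "\<And>u v. u \<in> S \<Longrightarrow> v \<in> S \<Longrightarrow> {u, v} \<in> snd (add_apex N G) \<Longrightarrow> {g u, g v} \<in> snd G"
proof -
  have form: "\<exists>j v. x = apex_copy j v \<and> v \<in> fst G" if "x \<in> S" for x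
    using S(2) that by (auto simp: add_apex_def)
  obtain x where x: "x \<in> S" using conn_ne[OF S(1)] by blast
  obtain j v where jv: "x = apex_copy j v" using form[OF x] by blast
  have "S \<subseteq> apex_copy j ` fst G"
  proof (rule ccontr)
    assume no: "\<not> ?thesis"
    have "x \<in> apex_copy j ` fst G" using form[OF x] jv by auto
    then obtain a b where ab: "a \<in> apex_copy j ` fst G" "a \<in> S" "b \<in> S" "b \<notin> apex_copy j ` fst G" "{a, b} \<in> snd (add_apex N G)"
      using conn_cut[OF S(1) x] no by (metis subsetI)
    obtain u where u: "a = apex_copy j u" using ab(1) by blast
    obtain i v where v: "b = apex_copy i v" "v \<in> fst G" using form[OF ab(3)] by blast
    have "j = i" using ab(5) add_apex_edge[of j u i v N G] unfolding u v(1) by blast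
    then show False using ab(4) v by blast
  qed
  then have eq: "apex_copy j (the_inv (apex_copy j) y) = y" "the_inv (apex_copy j) y \<in> fst G" if "y \<in> S" for y
    using that by (auto simp: the_inv_f_f inj_def)
  show ?thesis
  proof (rule that[of "the_inv (apex_copy j)"])
    show "inj_on (the_inv (apex_copy j)) S" using eq(1) by (metis inj_onI)
    show "{the_inv (apex_copy j) u, the_inv (apex_copy j) v} \<in> snd G"
      if "u \<in> S" "v \<in> S" "{u, v} \<in> snd (add_apex N G)" for u v
      using that eq(1) add_apex_edge by metis
  qed (use eq in auto)
qed

text \<open>Of two disjoint copies of \<open>X\<close> at least one misses the apex; being
  connected, it lies inside a single copy of \<open>G\<close>.\<close>

lemma not_contains_copies_add_apex:
  assumes X: "conn (snd X) (fst X)" "graph X" and G: "\<not> contains_subgraph G X" and l: "2 \<le> l"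
  shows "\<not> contains_subgraph (add_apex N G) (copies l X)"
proof
  let ?E = "snd (add_apex N G)"
  assume "contains_subgraph (add_apex N G) (copies l X)"
  then obtain f where f: "inj_on f (fst (copies l X))" "f ` fst (copies l X) \<subseteq> fst (add_apex N G)"
    "\<And>u v. {u, v} \<in> snd (copies l X) \<Longrightarrow> {f u, f v} \<in> ?E"
    unfolding contains_subgraph_def by blast
  have V: "(i, v) \<in> fst (copies l X)" if "i < 2" "v \<in> fst X" for i v using that l by (simp add: copies_def)
  have E: "{(i, u), (i, v)} \<in> snd (copies l X)" if "i < 2" "{u, v} \<in> snd X" for i u v
  proof -
    have "{(i, u), (i, v)} = (\<lambda>v. (i, v)) ` {u, v}" by simp
    then show ?thesis using that l unfolding copies_def snd_conv by (metis (mono_tags, lifting) CollectI less_le_trans)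
  qed
  have "\<exists>i<2. \<forall>v\<in>fst X. f (i, v) \<noteq> 0"
  proof (rule ccontr)
    assume no: "\<not> ?thesis"
    have no': "\<exists>v\<in>fst X. f (i, v) = 0" if "i < 2" for i using no that by auto
    obtain u where u: "u \<in> fst X" "f (0, u) = 0" using no'[of 0] by auto
    obtain v where v: "v \<in> fst X" "f (1, v) = 0" using no'[of 1] by auto
    have "(0 :: nat, u) = (1, v)" by (rule inj_onD[OF f(1)]) (use u v V in auto)
    then show False by simp
  qed
  then obtain i where i: "i < 2" "\<And>v. v \<in> fst X \<Longrightarrow> f (i, v) \<noteq> 0" by blast
  define h where "h v = f (i, v)" for v
  have h: "inj_on h (fst X)" "h ` fst X \<subseteq> fst (add_apex N G) - {0}" "\<And>u v. {u, v} \<in> snd X \<Longrightarrow> {h u, h v} \<in> ?E"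
  proof -
    show "inj_on h (fst X)"
    proof (rule inj_onI)
      fix x y assume "x \<in> fst X" "y \<in> fst X" "h x = h y"
      then have "(i, x) = (i, y)" using inj_onD[OF f(1)] V i(1) unfolding h_def by blast
      then show "x = y" by simp
    qed
    show "h ` fst X \<subseteq> fst (add_apex N G) - {0}"
    proof (rule image_subsetI)
      fix v assume v: "v \<in> fst X"
      then have "f (i, v) \<in> fst (add_apex N G)" using f(2) V[OF i(1)] by blast
      then show "h v \<in> fst (add_apex N G) - {0}" using i(2)[OF v] by (simp add: h_def)
    qed
    show "{h u, h v} \<in> ?E" if "{u, v} \<in> snd X" for u v
      using f(3)[OF E[OF i(1) that]] by (simp add: h_def)
  qed
  have "conn ?E (h ` fst X)" by (rule conn_image[OF X(1)]) (use h(3) in blast)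
  then obtain g where g: "inj_on g (h ` fst X)" "g ` (h ` fst X) \<subseteq> fst G"
    "\<And>u v. u \<in> h ` fst X \<Longrightarrow> v \<in> h ` fst X \<Longrightarrow> {u, v} \<in> ?E \<Longrightarrow> {g u, g v} \<in> snd G"
    using add_apex_conn[OF _ h(2)] by metis
  have "contains_subgraph G X"
    unfolding contains_subgraph_def
  proof (intro exI[of _ "g \<circ> h"] conjI allI impI)
    show "inj_on (g \<circ> h) (fst X)" using h(1) g(1) by (rule comp_inj_on)
    show "(g \<circ> h) ` fst X \<subseteq> fst G" using g(2) by (simp add: image_comp)
    fix u v assume uv: "{u, v} \<in> snd X"
    then have "u \<in> fst X" "v \<in> fst X" using graph_edgeD[OF X(2)] by blast+
    then show "{(g \<circ> h) u, (g \<circ> h) v} \<in> snd G" using g(3)[of "h u" "h v"] h(3)[OF uv] by simp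
  qed
  then show False using G by simp
qed

lemma pth_map:
  assumes "pth E xs" "inj_on g (set xs)" "\<And>u v. u \<in> set xs \<Longrightarrow> v \<in> set xs \<Longrightarrow> {u, v} \<in> E \<Longrightarrow> {g u, g v} \<in> E'"
  shows "pth E' (map g xs)"
  using assms by (auto simp: pth_def distinct_map successively_conv_nth)

lemma ex_forcing_short_paths:
  "\<exists>G. graph G \<and> rd h (snd G) {} (fst G) \<and> forcing N h G \<and>
     (\<forall>xs. pth (snd G) xs \<longrightarrow> set xs \<subseteq> fst G \<longrightarrow> length xs < 2 ^ h)"
proof (induction h)
  case 0
  show ?case
    by (intro exI[of _ "({}, {})"]) (auto simp: graph_def forcing_def intro: rd.nil)
next
  case (Suc h)
  then obtain G where G: "graph G" "rd h (snd G) {} (fst G)" "forcing N h G"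
    "\<And>xs. pth (snd G) xs \<Longrightarrow> set xs \<subseteq> fst G \<Longrightarrow> length xs < 2 ^ h" by blast
  let ?G = "add_apex N G"
  have short: "length xs < 2 ^ h" if xs: "pth (snd ?G) xs" "set xs \<subseteq> fst ?G - {0}" for xs
  proof (cases "xs = []")
    case False
    obtain g where g: "inj_on g (set xs)" "g ` set xs \<subseteq> fst G"
      "\<And>u v. u \<in> set xs \<Longrightarrow> v \<in> set xs \<Longrightarrow> {u, v} \<in> snd ?G \<Longrightarrow> {g u, g v} \<in> snd G"
      using add_apex_conn[OF pth_conn[OF xs(1) False] xs(2)] by metis
    show ?thesis using G(4)[OF pth_map[OF xs(1) g(1,3)]] g(2) by simp
  qed simp
  have "length xs < 2 ^ Suc h" if xs: "pth (snd ?G) xs" "set xs \<subseteq> fst ?G" for xs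
  proof (cases "0 \<in> set xs")
    case True
    then obtain ys zs where yz: "xs = ys @ 0 # zs" by (meson split_list)
    have "pth (snd ?G) ys" "pth (snd ?G) zs" "0 \<notin> set ys" "0 \<notin> set zs"
      using xs(1) unfolding yz pth_append pth_Cons by auto
    then have "length ys < 2 ^ h" "length zs < 2 ^ h" using short xs(2) yz by auto
    then show ?thesis using yz by simp
  next
    case False
    then have "length xs < 2 ^ h" using short xs by blast
    then show ?thesis by simp
  qed
  then show ?case
    using graph_add_apex[OF G(1)] rd_add_apex[OF G(2)] forcing_add_apex[OF G(1,3)] by blast
qed

section \<open>Strips: a path with copies attached to its edges\<close>

definition spine :: "nat \<Rightarrow> nat" where
  "spine i = prod_encode (0, i)"

definition rib :: "nat \<Rightarrow> nat \<Rightarrow> nat \<Rightarrow> nat" where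
  "rib i j v = prod_encode (Suc i, prod_encode (j, v))"

lemma spine_rib_simps [simp]:
  "spine i = spine j \<longleftrightarrow> i = j" "rib i j v = rib i' j' v' \<longleftrightarrow> i = i' \<and> j = j' \<and> v = v'"
  "spine a \<noteq> rib i j v" "rib i j v \<noteq> spine a"
  by (simp_all add: spine_def rib_def)

definition strip :: "nat \<Rightarrow> nat \<Rightarrow> nat graph \<Rightarrow> nat graph" where
  "strip M N G = (spine ` {..M} \<union> {rib i j v | i j v. i < M \<and> j \<le> N \<and> v \<in> fst G},
     {{spine i, spine (Suc i)} | i. i < M} \<union>
     {{spine a, rib i j v} | a i j v. (a = i \<or> a = Suc i) \<and> i < M \<and> j \<le> N \<and> v \<in> fst G} \<union>
     {{rib i j u, rib i j v} | i j u v. i < M \<and> j \<le> N \<and> {u, v} \<in> snd G})"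

lemma strip_vertex:
  "spine i \<in> fst (strip M N G) \<longleftrightarrow> i \<le> M"
  "rib i j v \<in> fst (strip M N G) \<longleftrightarrow> i < M \<and> j \<le> N \<and> v \<in> fst G"
  by (auto simp: strip_def)

lemma strip_vertex_cases:
  assumes "x \<in> fst (strip M N G)"
  obtains i where "i \<le> M" "x = spine i" | i j v where "i < M" "j \<le> N" "v \<in> fst G" "x = rib i j v"
  using assms by (auto simp: strip_def)

lemma strip_edge:
  "{rib i j u, rib i' j' v} \<in> snd (strip M N G) \<longleftrightarrow> i = i' \<and> j = j' \<and> i < M \<and> j \<le> N \<and> {u, v} \<in> snd G"
  "{spine a, rib i j v} \<in> snd (strip M N G) \<longleftrightarrow> (a = i \<or> a = Suc i) \<and> i < M \<and> j \<le> N \<and> v \<in> fst G"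
  "{rib i j v, spine a} \<in> snd (strip M N G) \<longleftrightarrow> (a = i \<or> a = Suc i) \<and> i < M \<and> j \<le> N \<and> v \<in> fst G"
  "{spine a, spine b} \<in> snd (strip M N G) \<longleftrightarrow> a < M \<and> b = Suc a \<or> b < M \<and> a = Suc b"
  by (auto simp: strip_def doubleton_eq_iff insert_commute)

lemma graph_strip:
  assumes "graph G"
  shows "graph (strip M N G)"
  unfolding graph_def
proof (intro conjI ballI)
  have "fst (strip M N G) = spine ` {..M} \<union> (\<Union>i\<in>{..<M}. \<Union>j\<in>{..N}. rib i j ` fst G)"
    unfolding strip_def fst_conv by blast
  then show "finite (fst (strip M N G))" using assms by (simp add: graph_def)
  fix e assume "e \<in> snd (strip M N G)"
  then consider i where "e = {spine i, spine (Suc i)}" "i < M"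
    | a i j v where "e = {spine a, rib i j v}" "a = i \<or> a = Suc i" "i < M" "j \<le> N" "v \<in> fst G"
    | i j u v where "e = {rib i j u, rib i j v}" "i < M" "j \<le> N" "{u, v} \<in> snd G"
    unfolding strip_def snd_conv by (elim UnE CollectE exE conjE) auto
  then show "\<exists>u v. e = {u, v} \<and> u \<noteq> v \<and> u \<in> fst (strip M N G) \<and> v \<in> fst (strip M N G)"
  proof cases
    case 1
    then show ?thesis by (intro exI[of _ "spine i"] exI[of _ "spine (Suc i)"]) (simp add: strip_vertex)
  next
    case 2
    then show ?thesis by (intro exI[of _ "spine a"] exI[of _ "rib i j v"]) (auto simp: strip_vertex)
  next
    case 3
    then show ?thesis using graph_edgeD[OF assms 3(4)]
      by (intro exI[of _ "rib i j u"] exI[of _ "rib i j v"]) (simp add: strip_vertex)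
  qed
qed

text \<open>The bag moves along the spine. While it holds both ends of a spine edge, the copies at
  this edge branch off with the two ends added to their bags; then the earlier end is dropped. The
  induction runs from the last spine vertex back to the first.\<close>

lemma rd_strip:
  assumes "rd k (snd G) {} (fst G)"
  shows "rd (Suc (Suc k)) (snd (strip M N G)) {} (fst (strip M N G))"
proof -
  let ?E = "snd (strip M N G)"
  define X where "X i = (\<Union>j\<in>{..N}. rib i j ` fst G)" for i
  define Y where "Y i = spine ` {i<..M} \<union> (\<Union>i'\<in>{i..<M}. X i')" for i
  have X0: "rd k ?E {} (X i)" for i
    unfolding X_def
  proof (rule rd_UNION)
    fix j
    have "rd k ?E (rib i j ` {}) (rib i j ` fst G)"
      by (rule rd_image[OF assms]) (auto simp: inj_on_def strip_edge)
    then show "rd k ?E {} (rib i j ` fst G)" by simp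
  qed (auto simp: strip_edge)
  have X2: "rd (Suc (Suc k)) ?E {spine i, spine (Suc i)} (X i)" for i
  proof -
    have "rd (Suc k) ?E {spine (Suc i)} (X i)"
      by (rule rd_insert_apex[OF X0]) (auto simp: X_def)
    then show ?thesis by (rule rd_insert_apex) (auto simp: X_def)
  qed
  have "rd (Suc (Suc k)) ?E {spine i} (Y i)" if "i \<le> M" for i
    using that
  proof (induction rule: inc_induct)
    case base
    show ?case by (simp add: Y_def rd.nil)
  next
    case (step i)
    have "rd (Suc (Suc k)) ?E {spine i, spine (Suc i)} (Y (Suc i))"
    proof (rule rd.shrink[OF step.IH])
      show "card {spine i, spine (Suc i)} \<le> Suc (Suc (Suc k))" by (simp add: card_insert_if)
      show "{spine i, spine (Suc i)} \<inter> Y (Suc i) = {}" by (auto simp: Y_def X_def)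
      show "{x, w} \<notin> ?E" if xw: "x \<in> Y (Suc i)" "w \<in> {spine i, spine (Suc i)} - {spine (Suc i)}" for x w
      proof -
        have w: "w = spine i" using xw(2) by auto
        show ?thesis using xw(1) unfolding Y_def X_def w by (auto simp: strip_edge)
      qed
    qed auto
    with X2 have "rd (Suc (Suc k)) ?E {spine i, spine (Suc i)} (X i \<union> Y (Suc i))"
      by (rule rd.union) (auto simp: X_def Y_def strip_edge)
    then have "rd (Suc (Suc k)) ?E {spine i} (insert (spine (Suc i)) (X i \<union> Y (Suc i)))"
      by (intro rd.intro) (simp_all add: insert_commute)
    moreover have "insert (spine (Suc i)) (X i \<union> Y (Suc i)) = Y i"
    proof -
      have "{i<..M} = insert (Suc i) {Suc i<..M}" "{i..<M} = insert i {Suc i..<M}" using step.hyps by auto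
      then show ?thesis by (auto simp: Y_def)
    qed
    ultimately show ?case by simp
  qed
  then have "rd (Suc (Suc k)) ?E {} (insert (spine 0) (Y 0))" by (intro rd.intro) auto
  moreover have "insert (spine 0) (Y 0) = fst (strip M N G)"
  proof -
    have "{..M} = insert 0 {0<..M}" by auto
    then have "spine ` {..M} = insert (spine 0) (spine ` {0<..M})" by simp
    moreover have "{rib i j v | i j v. i < M \<and> j \<le> N \<and> v \<in> fst G} = (\<Union>i'\<in>{0..<M}. X i')"
      unfolding X_def atLeast0LessThan by blast
    ultimately show ?thesis unfolding Y_def strip_def fst_conv by simp
  qed
  ultimately show ?thesis by simp
qed

text \<open>The \<open>N + 1\<close> spine vertices do not fit into one part, so two consecutive
  ones lie in different parts. These two parts have at most \<open>2 * N\<close> vertices, hence one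
  of the \<open>2 * N + 1\<close> copies at this edge avoids both.\<close>

lemma forcing_strip:
  assumes G: "graph G" and f: "forcing N m G"
  shows "forcing N (Suc (Suc m)) (strip N (2 * N) G)"
  unfolding forcing_def
proof (intro allI impI)
  let ?V = "fst (strip N (2 * N) G)" and ?E = "snd (strip N (2 * N) G)"
  fix \<phi> :: "nat \<Rightarrow> nat" assume \<phi>: "\<forall>x. card {v \<in> ?V. \<phi> v = x} \<le> N"
  have fin: "finite ?V" using graph_strip[OF G] by (simp add: graph_def)
  have "\<exists>i<N. \<phi> (spine i) \<noteq> \<phi> (spine (Suc i))"
  proof (rule ccontr)
    assume no: "\<not> ?thesis"
    have eq: "\<phi> (spine i) = \<phi> (spine 0)" if "i \<le> N" for i
      using that no by (induction i) auto
    have "spine ` {..N} \<subseteq> {v \<in> ?V. \<phi> v = \<phi> (spine 0)}"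
    proof (rule image_subsetI)
      fix i assume "i \<in> {..N}"
      then show "spine i \<in> {v \<in> ?V. \<phi> v = \<phi> (spine 0)}" using eq[of i] by (simp add: strip_vertex)
    qed
    then have "card (spine ` {..N}) \<le> card {v \<in> ?V. \<phi> v = \<phi> (spine 0)}" using fin by (intro card_mono) auto
    moreover have "card (spine ` {..N}) = Suc N" by (simp add: card_image inj_on_def)
    ultimately show False using \<phi> by (metis Suc_n_not_le_n le_trans)
  qed
  then obtain i where i: "i < N" "\<phi> (spine i) \<noteq> \<phi> (spine (Suc i))" by blast
  define B where "B = {v \<in> ?V. \<phi> v = \<phi> (spine i)} \<union> {v \<in> ?V. \<phi> v = \<phi> (spine (Suc i))}"
  have "card B \<le> card {v \<in> ?V. \<phi> v = \<phi> (spine i)} + card {v \<in> ?V. \<phi> v = \<phi> (spine (Suc i))}"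
    unfolding B_def by (rule card_Un_le)
  also have "\<dots> \<le> N + N" using \<phi> by (intro add_mono) auto
  finally have B: "card B \<le> 2 * N" "finite B" using fin by (simp_all add: B_def)
  have "\<exists>j\<le>2 * N. rib i j ` fst G \<inter> B = {}"
    by (rule ex_avoiding_index[OF fin _ B(2,1)]) auto
  then obtain j where j: "j \<le> 2 * N" "rib i j ` fst G \<inter> B = {}" by blast
  have sub: "rib i j ` fst G \<subseteq> ?V" using j(1) i(1) by (auto simp: strip_vertex)
  obtain K where K: "K \<subseteq> rib i j ` fst G" "finite K" "card K = m" "inj_on \<phi> K"
    "\<And>u v. u \<in> K \<Longrightarrow> v \<in> K \<Longrightarrow> u \<noteq> v \<Longrightarrow> {u, v} \<in> ?E"
    by (rule forcing_copy[OF f _ fin sub, where E = ?E and \<phi> = \<phi>])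
      (use \<phi> j(1) i(1) in \<open>auto simp: inj_on_def strip_edge\<close>)
  have KB: "K \<subseteq> ?V" "K \<inter> B = {}" using K(1) j(2) sub by auto
  have 1: "\<phi> (spine i) \<notin> \<phi> ` K" using KB unfolding B_def by auto
  have 2: "{spine i, u} \<in> ?E" if u: "u \<in> K" for u
  proof -
    obtain v where "u = rib i j v" "v \<in> fst G" using u K(1) by blast
    then show ?thesis using j(1) i(1) by (simp add: strip_edge)
  qed
  note K1 = forcing_insert[OF K(2-5) 1 2]
  have 3: "\<phi> (spine (Suc i)) \<notin> \<phi> ` insert (spine i) K" using KB i(2) unfolding B_def by auto
  have 4: "{spine (Suc i), u} \<in> ?E" if u: "u \<in> insert (spine i) K" for u
  proof (cases "u = spine i")
    case True
    then show ?thesis using i(1) by (simp add: strip_edge)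
  next
    case False
    then obtain v where "u = rib i j v" "v \<in> fst G" using u K(1) by blast
    then show ?thesis using j(1) i(1) by (simp add: strip_edge)
  qed
  note forcing_insert[OF K1 3 4]
  moreover have "insert (spine (Suc i)) (insert (spine i) K) \<subseteq> ?V"
    using KB(1) i(1) by (simp add: strip_vertex)
  ultimately show "\<exists>K\<subseteq>?V. finite K \<and> card K = Suc (Suc m) \<and> inj_on \<phi> K \<and> (\<forall>u\<in>K. \<forall>v\<in>K. u \<noteq> v \<longrightarrow> {u, v} \<in> ?E)"
    by blast
qed

text \<open>A copy of \<open>G\<close> can be left only through the two ends of its spine edge, and
  the paths inside it are too short.\<close>

lemma strip_leg_leaves_rib:
  assumes xs: "pth (snd (strip M N G)) xs" "set xs \<subseteq> fst (strip M N G)" "t \<le> length xs" "xs \<noteq> []"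
    and h: "hd xs = rib i j v" and av: "spine i \<notin> set xs" "spine (Suc i) \<notin> set xs"
    and short: "\<And>ys. pth (snd G) ys \<Longrightarrow> set ys \<subseteq> fst G \<Longrightarrow> length ys < t"
  shows False
proof -
  have c: "conn (snd (strip M N G)) (set xs)" by (rule pth_conn[OF xs(1,4)])
  have v: "v \<in> fst G" "i < M" "j \<le> N" using xs(2,4) h strip_vertex(2) hd_in_set by (metis subsetD)+
  have sub: "set xs \<subseteq> rib i j ` fst G"
  proof (rule ccontr)
    assume "\<not> ?thesis"
    then obtain b0 where b0: "b0 \<in> set xs" "b0 \<notin> rib i j ` fst G" by blast
    have "hd xs \<in> set xs" using xs(4) by simp
    moreover have "hd xs \<in> rib i j ` fst G" using h v(1) by simp
    ultimately obtain a b where ab: "a \<in> rib i j ` fst G" "b \<in> set xs" "b \<notin> rib i j ` fst G" "{a, b} \<in> snd (strip M N G)"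
      using conn_cut[OF c] b0 by metis
    then obtain u where u: "a = rib i j u" by blast
    have "b \<in> fst (strip M N G)" using ab(2) xs(2) by blast
    then show False
    proof (cases rule: strip_vertex_cases)
      case (1 i')
      then show ?thesis using ab(2,4) av u by (auto simp: strip_edge)
    next
      case (2 i' j' v')
      then show ?thesis using ab(3,4) u by (auto simp: strip_edge)
    qed
  qed
  define g where "g = the_inv (rib i j)"
  have inj: "inj (rib i j)" by (simp add: inj_def)
  have g: "rib i j (g y) = y" "g y \<in> fst G" if "y \<in> set xs" for y
    using sub that by (auto simp: g_def the_inv_f_f[OF inj])
  have "pth (snd G) (map g xs)"
  proof (rule pth_map[OF xs(1)])
    show "inj_on g (set xs)" using g(1) by (metis inj_onI)
    show "{g a, g b} \<in> snd G" if "a \<in> set xs" "b \<in> set xs" "{a, b} \<in> snd (strip M N G)" for a b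
      using that g(1)[OF that(1)] g(1)[OF that(2)] strip_edge(1) by metis
  qed
  moreover have "set (map g xs) \<subseteq> fst G" using g(2) by auto
  ultimately show False using short[of "map g xs"] xs(3) by simp
qed

text \<open>Wherever the centre lies, two spine vertices meet every leg, while three legs are
  disjoint.\<close>

lemma not_contains_spider_strip:
  assumes s: "3 \<le> s" and t: "1 \<le> t"
    and short: "\<And>ys. pth (snd G) ys \<Longrightarrow> set ys \<subseteq> fst G \<Longrightarrow> length ys < t"
  shows "\<not> contains_subgraph (strip M N G) (spider s t)"
proof
  let ?E = "snd (strip M N G)"
  assume "contains_subgraph (strip M N G) (spider s t)"
  then obtain r p where r: "r \<in> fst (strip M N G)"
    and p: "\<forall>j\<in>{1..s}. pth ?E (p j) \<and> set (p j) \<subseteq> fst (strip M N G) - {r} \<and> length (p j) = t \<and> {r, hd (p j)} \<in> ?E"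
    and disj: "\<forall>i\<in>{1..s}. \<forall>j\<in>{1..s}. i \<noteq> j \<longrightarrow> set (p i) \<inter> set (p j) = {}"
    unfolding contains_spider_iff[OF t] by blast
  obtain D where D: "finite D" "card D \<le> 2" "\<And>j. j \<in> {1..s} \<Longrightarrow> set (p j) \<inter> D \<noteq> {}"
    using r
  proof (cases rule: strip_vertex_cases)
    case (1 i)
    \<comment> \<open>For \<open>i = 0\<close> the truncated difference yields the centre itself,
      which no leg contains; the other vertex then meets all legs.\<close>
    have hit: "set (p j) \<inter> {spine (i - 1), spine (Suc i)} \<noteq> {}" if j: "j \<in> {1..s}" for j
    proof
      assume no: "set (p j) \<inter> {spine (i - 1), spine (Suc i)} = {}"
      have pj: "pth ?E (p j)" "set (p j) \<subseteq> fst (strip M N G)" "r \<notin> set (p j)" "t \<le> length (p j)" "p j \<noteq> []" "{r, hd (p j)} \<in> ?E"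
        using p j t by fastforce+
      have hin: "hd (p j) \<in> set (p j)" using pj(5) by simp
      then have "hd (p j) \<in> fst (strip M N G)" using pj(2) by blast
      then show False
      proof (cases rule: strip_vertex_cases)
        case a: (1 a)
        then have "a = Suc i \<or> i = Suc a" using pj(6) 1 by (auto simp: strip_edge)
        then show ?thesis using no hin a by auto
      next
        case b: (2 a b v)
        then have ia: "i = a \<or> i = Suc a" using pj(6) 1 by (auto simp: strip_edge)
        then have "spine a \<notin> set (p j)" "spine (Suc a) \<notin> set (p j)" using no pj(3) 1 by auto
        then show ?thesis using strip_leg_leaves_rib[OF pj(1,2,4,5) b(4) _ _ short] by blast
      qed
    qed
    show ?thesis by (rule that[of "{spine (i - 1), spine (Suc i)}"]) (use hit in \<open>auto simp: card_insert_if\<close>)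
  next
    case (2 i b v)
    have hit: "set (p j) \<inter> {spine i, spine (Suc i)} \<noteq> {}" if j: "j \<in> {1..s}" for j
    proof
      assume no: "set (p j) \<inter> {spine i, spine (Suc i)} = {}"
      have pj: "pth ?E (p j)" "set (p j) \<subseteq> fst (strip M N G)" "r \<notin> set (p j)" "t \<le> length (p j)" "p j \<noteq> []" "{r, hd (p j)} \<in> ?E"
        using p j t by fastforce+
      have hin: "hd (p j) \<in> set (p j)" using pj(5) by simp
      then have "hd (p j) \<in> fst (strip M N G)" using pj(2) by blast
      then show False
      proof (cases rule: strip_vertex_cases)
        case a: (1 a)
        then have "a = Suc i \<or> a = i" using pj(6) 2 by (auto simp: strip_edge)
        then show ?thesis using no hin a by auto
      next
        case c: (2 a b' v')
        then have "a = i" using pj(6) 2 by (auto simp: strip_edge)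
        then show ?thesis using strip_leg_leaves_rib[OF pj(1,2,4,5) c(4) _ _ short] no by blast
      qed
    qed
    show ?thesis by (rule that[of "{spine i, spine (Suc i)}"]) (use hit in \<open>auto simp: card_insert_if\<close>)
  qed
  then have "\<forall>j\<in>{1..s}. \<exists>d. d \<in> set (p j) \<inter> D" by blast
  then obtain d where d: "\<And>j. j \<in> {1..s} \<Longrightarrow> d j \<in> set (p j) \<inter> D" by metis
  have "inj_on d {1..s}"
  proof (rule inj_onI, rule ccontr)
    fix a b assume ab: "a \<in> {1..s}" "b \<in> {1..s}" "d a = d b" "a \<noteq> b"
    then have "set (p a) \<inter> set (p b) = {}" using disj by blast
    then show False using d[OF ab(1)] d[OF ab(2)] ab(3) by auto
  qed
  then have "card {1..s} \<le> card D" by (rule card_inj_on_le) (use d D(1) in auto)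
  then show False using s D(2) by simp
qed

section \<open>The values for paths, spiders and their copies\<close>

lemma conn_path_graph:
  assumes "1 \<le> n"
  shows "conn (snd (path_graph n)) (fst (path_graph n))"
proof -
  have "pth (snd (path_graph n)) [0..<n]"
    by (auto simp: pth_def successively_conv_nth path_graph_def)
  then have "conn (snd (path_graph n)) (set [0..<n])" by (rule pth_conn) (use assms in simp)
  then show ?thesis by (simp add: path_graph_def)
qed

lemma graph_path_graph: "graph (path_graph n)"
  unfolding graph_def
proof (intro conjI ballI)
  fix e assume "e \<in> snd (path_graph n)"
  then obtain i where "e = {i, Suc i}" "Suc i < n" by (auto simp: path_graph_def)
  then show "\<exists>u v. e = {u, v} \<and> u \<noteq> v \<and> u \<in> fst (path_graph n) \<and> v \<in> fst (path_graph n)"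
    by (intro exI[of _ i] exI[of _ "Suc i"]) (simp add: path_graph_def)
qed (simp add: path_graph_def)

lemma conn_spider:
  assumes t: "1 \<le> t"
  shows "conn (snd (spider s t)) (fst (spider s t))"
proof -
  let ?E = "snd (spider s t)" and ?V = "fst (spider s t)"
  have *: "reach ?E ?V (0, 0, 0) (0, j, Suc i)" if j: "1 \<le> j" "j \<le> s" "i < t" for i j
    using j(3)
  proof (induction i)
    case 0
    have "{(0, 0, 0), (0, j, Suc 0)} \<in> ?E" unfolding spider_simps(2)[OF t] using j by auto
    then show ?case using j t by (intro reach_step[OF reach_refl]) (auto simp: spider_simps(1))
  next
    case (Suc i)
    have "\<exists>j' i'. {(0, j, Suc i), (0, j, Suc (Suc i))} = {(0::nat, j', i'), (0, j', Suc i')} \<and> 1 \<le> j' \<and> j' \<le> s \<and> 1 \<le> i' \<and> Suc i' \<le> t"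
      using j Suc.prems by (intro exI[of _ j] exI[of _ "Suc i"]) auto
    then have "{(0, j, Suc i), (0, j, Suc (Suc i))} \<in> ?E" unfolding spider_simps(2)[OF t] by blast
    then show ?case using Suc j by (intro reach_step[OF Suc.IH]) (auto simp: spider_simps(1))
  qed
  have all: "reach ?E ?V (0, 0, 0) x" if x: "x \<in> ?V" for x
  proof (cases "x = (0, 0, 0)")
    case False
    then obtain j i where ji: "x = (0, j, i)" "1 \<le> j" "j \<le> s" "1 \<le> i" "i \<le> t"
      using x unfolding spider_simps(1) by blast
    then show ?thesis using *[of j "i - 1"] by simp
  qed simp
  have "connected_in ?E ?V"
    unfolding connected_in_def using all by (meson reach_sym reach_trans)
  moreover have "?V \<noteq> {}" by (simp add: spider_simps(1))
  ultimately show ?thesis by (simp add: conn_def)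
qed

lemma graph_spider_forest_graph: "graph (spider_forest_graph legs)"
proof -
  let ?V = "fst (spider_forest_graph legs)"
  define m where "m = Max (insert 0 (length ` set legs))"
  define k where "k = Max (insert 0 (\<Union>l\<in>set legs. set l))"
  have m: "length (legs ! c) \<le> m" if "c < length legs" for c
    unfolding m_def using that by (intro Max_ge) auto
  have k: "legs ! c ! j \<le> k" if "c < length legs" "j < length (legs ! c)" for c j
    unfolding k_def using that by (intro Max_ge) (auto intro!: bexI[of _ "legs ! c"])
  have "?V \<subseteq> {..length legs} \<times> {..m} \<times> {..k}"
  proof
    fix x assume "x \<in> ?V"
    then consider c where "x = (c, 0, 0)" "c < length legs"
      | c j i where "x = (c, j, i)" "c < length legs" "1 \<le> j" "j \<le> length (legs ! c)" "1 \<le> i" "i \<le> legs ! c ! (j - 1)"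
      unfolding spider_forest_graph_def fst_conv by blast
    then show "x \<in> {..length legs} \<times> {..m} \<times> {..k}"
    proof cases
      case 2
      then have "legs ! c ! (j - 1) \<le> k" by (intro k) auto
      then show ?thesis using 2 m[OF 2(2)] by auto
    qed simp
  qed
  then have "finite ?V" using finite_subset by blast
  moreover have "\<exists>u v. e = {u, v} \<and> u \<noteq> v \<and> u \<in> ?V \<and> v \<in> ?V" if "e \<in> snd (spider_forest_graph legs)" for e
  proof -
    from that consider c j where "e = {(c, 0, 0), (c, j, 1)}" "c < length legs" "1 \<le> j" "j \<le> length (legs ! c)" "1 \<le> legs ! c ! (j - 1)"
      | c j i where "e = {(c, j, i), (c, j, Suc i)}" "c < length legs" "1 \<le> j" "j \<le> length (legs ! c)" "1 \<le> i" "Suc i \<le> legs ! c ! (j - 1)"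
      unfolding spider_forest_graph_def snd_conv by blast
    then show ?thesis
    proof cases
      case 1
      then show ?thesis
        by (intro exI[of _ "(c, 0, 0)"] exI[of _ "(c, j, 1)"]) (simp add: spider_forest_graph_def)
    next
      case 2
      then show ?thesis
        by (intro exI[of _ "(c, j, i)"] exI[of _ "(c, j, Suc i)"]) (simp add: spider_forest_graph_def)
    qed
  qed
  ultimately show ?thesis unfolding graph_def by blast
qed

lemma graph_spider: "graph (spider s t)"
  unfolding spider_def by (rule graph_spider_forest_graph)

lemma utw_copies_lower:
  assumes X: "conn (snd X) (fst X)" "graph X" and l: "2 \<le> l"
    and G: "\<And>N. \<exists>G\<in>excl X. rd k (snd G) {} (fst G) \<and> forcing N m G" and c: "c < m"
  shows "\<not> utw_bounded_by (excl (copies l X)) c"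
proof (rule not_utw_if_forcing[where m = "Suc m" and k = "Suc k"])
  fix N
  obtain G where G: "graph G" "\<not> contains_subgraph G X" "rd k (snd G) {} (fst G)" "forcing N m G"
    using G[of N] by (auto simp: excl_def)
  then show "\<exists>G\<in>excl (copies l X). graph G \<and> rd (Suc k) (snd G) {} (fst G) \<and> forcing N (Suc m) G"
    using graph_add_apex[OF G(1)] rd_add_apex[OF G(3)] forcing_add_apex[OF G(1,4)]
      not_contains_copies_add_apex[OF X G(2) l]
    by (intro bexI[of _ "add_apex N G"]) (auto simp: excl_def)
qed (use c in simp)

lemma ex_forcing_path_free:
  assumes "2 ^ h \<le> n"
  shows "\<exists>G\<in>excl (path_graph n). rd h (snd G) {} (fst G) \<and> forcing N h G"
proof -
  obtain G where G: "graph G" "rd h (snd G) {} (fst G)" "forcing N h G"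
     "\<And>xs. pth (snd G) xs \<Longrightarrow> set xs \<subseteq> fst G \<Longrightarrow> length xs < 2 ^ h"
    using ex_forcing_short_paths by blast
  have "\<not> contains_subgraph G (path_graph n)"
    unfolding contains_path_iff using G(4) assms by (meson leD)
  then show ?thesis using G by (intro bexI[of _ G]) (auto simp: excl_def)
qed

lemma ex_forcing_spider_free:
  assumes "3 \<le> s" "2 ^ h \<le> t"
  shows "\<exists>G\<in>excl (spider s t). rd (Suc (Suc h)) (snd G) {} (fst G) \<and> forcing N (Suc (Suc h)) G"
proof -
  obtain G where G: "graph G" "rd h (snd G) {} (fst G)" "forcing N h G"
     "\<And>xs. pth (snd G) xs \<Longrightarrow> set xs \<subseteq> fst G \<Longrightarrow> length xs < 2 ^ h"
    using ex_forcing_short_paths by blast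
  have "(1::nat) \<le> 2 ^ h" by simp
  then have t: "1 \<le> t" using assms(2) by linarith
  have "\<not> contains_subgraph (strip N (2 * N) G) (spider s t)"
  proof (rule not_contains_spider_strip[OF assms(1) t])
    show "length ys < t" if "pth (snd G) ys" "set ys \<subseteq> fst G" for ys
      using G(4)[OF that] assms(2) by simp
  qed
  then show ?thesis
    using graph_strip[OF G(1)] rd_strip[OF G(2)] forcing_strip[OF G(1,3)]
    by (intro bexI[of _ "strip N (2 * N) G"]) (auto simp: excl_def)
qed

lemma is_underlying_twI:
  assumes "utw_bounded_by C c" "\<And>c'. c' < c \<Longrightarrow> \<not> utw_bounded_by C c'"
  shows "is_underlying_tw C c"
  using assms by (simp add: is_underlying_tw_def)

lemma underlying_tw_path:
  assumes "2 ^ Suc c \<le> n" "n < 2 ^ Suc (Suc c)"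
  shows "is_underlying_tw (excl (path_graph n)) c"
proof (rule is_underlying_twI[OF utw_path_upper[OF assms(2)]])
  fix c' assume "c' < c"
  then show "\<not> utw_bounded_by (excl (path_graph n)) c'"
    using ex_forcing_path_free[OF assms(1)]
    by (intro not_utw_if_forcing[where m = "Suc c" and k = "Suc c"]) (auto simp: excl_def)
qed

lemma underlying_tw_copies_path:
  assumes "2 ^ Suc c \<le> n" "n < 2 ^ Suc (Suc c)" "2 \<le> l"
  shows "is_underlying_tw (excl (copies l (path_graph n))) (Suc c)"
proof (rule is_underlying_twI)
  show "utw_bounded_by (excl (copies l (path_graph n))) (Suc c)"
    by (rule utw_copies_upper[OF utw_path_upper[OF assms(2)]]) (simp add: path_graph_def)
  have "(1::nat) \<le> 2 ^ Suc c" by simp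
  then have n: "1 \<le> n" using assms(1) by linarith
  fix c' assume "c' < Suc c"
  then show "\<not> utw_bounded_by (excl (copies l (path_graph n))) c'"
    by (rule utw_copies_lower[OF conn_path_graph[OF n] graph_path_graph assms(3) ex_forcing_path_free[OF assms(1)]])
qed

lemma underlying_tw_spider:
  assumes "3 \<le> s" "2 ^ h \<le> t" "t < 2 ^ Suc h"
  shows "is_underlying_tw (excl (spider s t)) (Suc h)"
proof (rule is_underlying_twI)
  have "(1::nat) \<le> 2 ^ h" by simp
  then have t: "1 \<le> t" using assms(2) by linarith
  show "utw_bounded_by (excl (spider s t)) (Suc h)" by (rule utw_spider_upper[OF t assms(3)])
  fix c' assume "c' < Suc h"
  then show "\<not> utw_bounded_by (excl (spider s t)) c'"
    using ex_forcing_spider_free[OF assms(1,2)]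
    by (intro not_utw_if_forcing[where m = "Suc (Suc h)" and k = "Suc (Suc h)"]) (auto simp: excl_def)
qed

lemma underlying_tw_copies_spider:
  assumes "3 \<le> s" "2 ^ h \<le> t" "t < 2 ^ Suc h" "2 \<le> l"
  shows "is_underlying_tw (excl (copies l (spider s t))) (Suc (Suc h))"
proof (rule is_underlying_twI)
  have "(1::nat) \<le> 2 ^ h" by simp
  then have t: "1 \<le> t" using assms(2) by linarith
  show "utw_bounded_by (excl (copies l (spider s t))) (Suc (Suc h))"
    by (rule utw_copies_upper[OF utw_spider_upper[OF t assms(3)]])
      (use graph_spider[of s t] in \<open>simp add: graph_def\<close>)
  fix c' assume "c' < Suc (Suc h)"
  then show "\<not> utw_bounded_by (excl (copies l (spider s t))) c'"
    by (rule utw_copies_lower[OF conn_spider[OF t] graph_spider assms(4) ex_forcing_spider_free[OF assms(1,2)]])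
qed

section \<open>Spider-forests\<close>

lemma contains_subgraph_trans:
  assumes "contains_subgraph G H" "contains_subgraph H K"
  shows "contains_subgraph G K"
proof -
  obtain f where f: "inj_on f (fst H)" "f ` fst H \<subseteq> fst G" "\<And>u v. {u, v} \<in> snd H \<Longrightarrow> {f u, f v} \<in> snd G"
    using assms(1) unfolding contains_subgraph_def by blast
  obtain g where g: "inj_on g (fst K)" "g ` fst K \<subseteq> fst H" "\<And>u v. {u, v} \<in> snd K \<Longrightarrow> {g u, g v} \<in> snd H"
    using assms(2) unfolding contains_subgraph_def by blast
  show ?thesis
    unfolding contains_subgraph_def
  proof (intro exI[of _ "f \<circ> g"] conjI allI impI)
    show "inj_on (f \<circ> g) (fst K)" using g(1) inj_on_subset[OF f(1) g(2)] by (rule comp_inj_on)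
    show "(f \<circ> g) ` fst K \<subseteq> fst G" using f(2) g(2) by auto
    show "{(f \<circ> g) u, (f \<circ> g) v} \<in> snd G" if "{u, v} \<in> snd K" for u v
      using f(3)[OF g(3)[OF that]] by simp
  qed
qed

lemma contains_subgraph_if_isomorphic:
  assumes "graph H" "isomorphic H K"
  shows "contains_subgraph K H"
proof -
  obtain f where f: "bij_betw f (fst H) (fst K)"
    "\<And>u v. u \<in> fst H \<Longrightarrow> v \<in> fst H \<Longrightarrow> {u, v} \<in> snd H \<longleftrightarrow> {f u, f v} \<in> snd K"
    using assms(2) unfolding isomorphic_def by blast
  show ?thesis
    unfolding contains_subgraph_def
  proof (intro exI[of _ f] conjI allI impI)
    show "inj_on f (fst H)" "f ` fst H \<subseteq> fst K" using f(1) by (auto simp: bij_betw_def)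
    show "{f u, f v} \<in> snd K" if "{u, v} \<in> snd H" for u v
      using f(2) graph_edgeD[OF assms(1) that] that by blast
  qed
qed

lemma spider_forest_graph_edgeE:
  assumes "e \<in> snd (spider_forest_graph legs)"
  obtains c j where "e = {(c, 0, 0), (c, j, 1)}" "c < length legs" "1 \<le> j" "j \<le> length (legs ! c)"
    | c j i where "e = {(c, j, i), (c, j, Suc i)}" "c < length legs" "1 \<le> j" "j \<le> length (legs ! c)"
      "1 \<le> i" "Suc i \<le> legs ! c ! (j - 1)"
  using assms unfolding spider_forest_graph_def snd_conv by blast

lemma copies_spider_contains_spider_forest:
  assumes "length legs \<le> l" "\<And>xs. xs \<in> set legs \<Longrightarrow> length xs \<le> s" "\<And>xs x. xs \<in> set legs \<Longrightarrow> x \<in> set xs \<Longrightarrow> x \<le> t"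
    and t: "1 \<le> t"
  shows "contains_subgraph (copies l (spider s t)) (spider_forest_graph legs)"
  unfolding contains_subgraph_def
proof (intro exI[of _ "\<lambda>(c, j, i). (c, 0, j, i)"] conjI allI impI)
  have le: "c < l" "j \<le> s" "legs ! c ! (j - 1) \<le> t" if "c < length legs" "1 \<le> j" "j \<le> length (legs ! c)" for c j
  proof -
    have m: "legs ! c \<in> set legs" using that(1) by simp
    show "c < l" using that(1) assms(1) by simp
    show "j \<le> s" using assms(2)[OF m] that(3) by simp
    have "legs ! c ! (j - 1) \<in> set (legs ! c)" using that(2,3) by (intro nth_mem) simp
    then show "legs ! c ! (j - 1) \<le> t" using assms(3)[OF m] by blast
  qed
  show "inj_on (\<lambda>(c, j, i). (c, 0, j, i)) (fst (spider_forest_graph legs))" by (auto simp: inj_on_def)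
  show "(\<lambda>(c, j, i). (c, 0, j, i)) ` fst (spider_forest_graph legs) \<subseteq> fst (copies l (spider s t))"
  proof (rule image_subsetI)
    fix x assume "x \<in> fst (spider_forest_graph legs)"
    then consider c where "x = (c, 0, 0)" "c < length legs"
      | c j i where "x = (c, j, i)" "c < length legs" "1 \<le> j" "j \<le> length (legs ! c)" "1 \<le> i" "i \<le> legs ! c ! (j - 1)"
      unfolding spider_forest_graph_def fst_conv by blast
    then show "(\<lambda>(c, j, i). (c, 0, j, i)) x \<in> fst (copies l (spider s t))"
    proof cases
      case 1
      then show ?thesis using assms(1) by (simp add: copies_def spider_simps(1))
    next
      case 2
      then show ?thesis using le[OF 2(2-4)] by (simp add: copies_def spider_simps(1))
    qed
  qed
  have cp: "{(c, u), (c, v)} \<in> snd (copies l (spider s t))" if "c < l" "{u, v} \<in> snd (spider s t)" for c u v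
  proof -
    have "{(c, u), (c, v)} = (\<lambda>v. (c, v)) ` {u, v}" by simp
    then show ?thesis using that unfolding copies_def snd_conv by blast
  qed
  fix u v assume "{u, v} \<in> snd (spider_forest_graph legs)"
  then have "\<exists>c a b. {u, v} = {(c, a), (c, b)} \<and> {(c, 0, a), (c, 0, b)} \<in> snd (copies l (spider s t))"
  proof (cases rule: spider_forest_graph_edgeE)
    case (1 c j)
    have "{(0, 0, 0), (0, j, 1)} \<in> snd (spider s t)"
      unfolding spider_simps(2)[OF t] using 1 le[OF 1(2-4)] by blast
    from cp[OF le(1)[OF 1(2-4)] this] show ?thesis using 1(1)
      by (intro exI[of _ c] exI[of _ "(0, 0)"] exI[of _ "(j, 1)"]) simp
  next
    case (2 c j i)
    have "Suc i \<le> t" using 2(6) le(3)[OF 2(2-4)] by linarith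
    then have "{(0, j, i), (0, j, Suc i)} \<in> snd (spider s t)"
      unfolding spider_simps(2)[OF t] using 2 le[OF 2(2-4)] by blast
    from cp[OF le(1)[OF 2(2-4)] this] show ?thesis using 2(1)
      by (intro exI[of _ c] exI[of _ "(j, i)"] exI[of _ "(j, Suc i)"]) simp
  qed
  then obtain c a b where cab: "{u, v} = {(c, a), (c, b)}" "{(c, 0, a), (c, 0, b)} \<in> snd (copies l (spider s t))"
    by blast
  have "{(\<lambda>(c, j, i). (c, 0 :: nat, j, i)) u, (\<lambda>(c, j, i). (c, 0, j, i)) v} = (\<lambda>(c, j, i). (c, 0, j, i)) ` {u, v}" by simp
  also have "\<dots> = {(c, 0, a), (c, 0, b)}" unfolding cab(1) by (cases a; cases b) simp
  finally show "{(\<lambda>(c, j, i). (c, 0, j, i)) u, (\<lambda>(c, j, i). (c, 0, j, i)) v} \<in> snd (copies l (spider s t))"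
    using cab(2) by simp
qed

text \<open>Each spider-forest lies in several copies of one large spider. The sums serve as crude
  bounds on the number of legs and on their lengths, the successor ensures \<open>1 \<le> t\<close>,
  and \<open>t < 2 ^ t\<close> makes \<open>t\<close> an admissible value for a single
  spider.\<close>

lemma bounded_if_spider_forest:
  assumes "H \<in> \<H>" "spider_forest H"
  shows "bounded_underlying_tw (excl_set \<H>)"
proof -
  obtain legs where H: "graph H" "isomorphic H (spider_forest_graph legs)"
    using assms(2) unfolding spider_forest_def by blast
  define l where "l = length legs"
  define s where "s = (\<Sum>xs\<leftarrow>legs. length xs)"
  define t where "t = Suc (\<Sum>x\<leftarrow>concat legs. x)"
  have c: "contains_subgraph (copies l (spider s t)) H"
  proof (rule contains_subgraph_trans[OF copies_spider_contains_spider_forest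
        contains_subgraph_if_isomorphic[OF H]])
    show "length xs \<le> s" if "xs \<in> set legs" for xs
      unfolding s_def by (rule member_le_sum_list) (use that in auto)
    show "x \<le> t" if "xs \<in> set legs" "x \<in> set xs" for x xs
    proof -
      have "x \<le> (\<Sum>x\<leftarrow>concat legs. x)" by (rule member_le_sum_list) (use that in auto)
      then show ?thesis by (simp add: t_def)
    qed
  qed (simp_all add: l_def t_def)
  have "excl_set \<H> \<subseteq> excl (copies l (spider s t))"
  proof
    fix G assume G: "G \<in> excl_set \<H>"
    then have "\<not> contains_subgraph G H" using assms(1) by (simp add: excl_set_def)
    then have "\<not> contains_subgraph G (copies l (spider s t))" using contains_subgraph_trans c by blast
    then show "G \<in> excl (copies l (spider s t))" using G by (simp add: excl_set_def excl_def)
  qed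
  moreover have "utw_bounded_by (excl (copies l (spider s t))) (Suc t)"
  proof (rule utw_copies_upper[OF utw_spider_upper])
    show "1 \<le> t" by (simp add: t_def)
    show "t < 2 ^ t" by (rule less_exp)
    show "finite (fst (spider s t))" using graph_spider[of s t] by (simp add: graph_def)
  qed
  ultimately show ?thesis unfolding bounded_underlying_tw_def utw_bounded_by_def by (meson subsetD)
qed

text \<open>A vertex is addressed by its root, the child of the root above it, and its depth.\<close>

lemma spider_forestI:
  fixes K :: "'a graph"
  assumes K: "graph K"
    and par: "\<And>x. x \<in> fst K \<Longrightarrow> 0 < d x \<Longrightarrow> par x \<in> fst K \<and> d x = Suc (d (par x)) \<and> {x, par x} \<in> snd K"
    and edge: "\<And>x y. {x, y} \<in> snd K \<Longrightarrow> 0 < d x \<and> par x = y \<or> 0 < d y \<and> par y = x"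
    and one: "\<And>x y. x \<in> fst K \<Longrightarrow> y \<in> fst K \<Longrightarrow> 0 < d x \<Longrightarrow> 0 < d y \<Longrightarrow> par x = par y \<Longrightarrow>
      0 < d (par x) \<Longrightarrow> x = y"
  shows "spider_forest K"
proof -
  define S where "S = fst K"
  have fin: "finite S" using K by (simp add: S_def graph_def)
  \<comment> \<open>Climbing all the way gives the centre of a vertex; stopping one step earlier
    gives the first vertex of its leg.\<close>
  define root where "root x = (par ^^ d x) x" for x
  define top where "top x = (par ^^ (d x - 1)) x" for x
  note par' = par[folded S_def]
  have root0: "root x = x" if "d x = 0" for x using that by (simp add: root_def)
  have root_par: "root (par x) = root x" if "x \<in> S" "0 < d x" for x
  proof -
    have "d x = Suc (d (par x))" using par'[OF that] by simp
    then show ?thesis unfolding root_def by (simp add: funpow_swap1)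
  qed
  have top1: "top x = x" if "d x = 1" for x using that by (simp add: top_def)
  have top_par: "top (par x) = top x" if "x \<in> S" "1 < d x" for x
  proof -
    have "d x = Suc (d (par x))" using par'[of x] that by simp
    then have "d x - 1 = Suc (d (par x) - 1)" using that(2) by simp
    then show ?thesis unfolding top_def by (simp add: funpow_swap1)
  qed
  have rootS: "root x \<in> S \<and> d (root x) = 0" if "x \<in> S" for x
    using that
  proof (induction "d x" arbitrary: x)
    case 0
    then show ?case using root0 by simp
  next
    case (Suc n)
    then have "0 < d x" by simp
    then show ?case using Suc par'[of x] root_par[of x] by (metis old.nat.inject)
  qed
  have topS: "top x \<in> S \<and> d (top x) = 1 \<and> par (top x) = root x" if "x \<in> S" "0 < d x" for x
    using that
  proof (induction "d x" arbitrary: x)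
    case (Suc n)
    show ?case
    proof (cases n)
      case 0
      then have "d x = 1" using Suc.hyps(2) by simp
      then show ?thesis using Suc.prems par'[of x] top1 root0[of "par x"] root_par[of x] by simp
    next
      case (Suc n')
      have x: "1 < d x" "0 < d x" using Suc \<open>Suc n = d x\<close> by simp_all
      have "n = d (par x)" "par x \<in> S" "0 < d (par x)" using par'[OF Suc.prems(1) x(2)] Suc Suc.hyps(2) by simp_all
      then show ?thesis using Suc.hyps(1)[of "par x"] top_par[OF Suc.prems(1) x(1)] root_par[OF Suc.prems(1) x(2)] by simp
    qed
  qed simp
  \<comment> \<open>Away from the centres every vertex has at most one child, so a leg contains at
    most one vertex of each depth.\<close>
  have uniq: "x = y" if "x \<in> S" "y \<in> S" "0 < d x" "d x = d y" "top x = top y" for x y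
    using that
  proof (induction "d x" arbitrary: x y)
    case (Suc n)
    show ?case
    proof (cases n)
      case 0
      then show ?thesis using Suc.prems Suc.hyps(2) top1[of x] top1[of y] by simp
    next
      case (Suc n')
      have x: "1 < d x" "1 < d y" "0 < d x" "0 < d y" using Suc Suc.hyps(2) Suc.prems(4) by simp_all
      have "par x = par y"
      proof (rule Suc.hyps(1))
        show "n = d (par x)" "par x \<in> S" "par y \<in> S" "0 < d (par x)" "d (par x) = d (par y)"
          using par'[OF Suc.prems(1) x(3)] par'[OF Suc.prems(2) x(4)] Suc Suc.hyps(2) Suc.prems(4) by simp_all
        show "top (par x) = top (par y)"
          using top_par[OF Suc.prems(1) x(1)] top_par[OF Suc.prems(2) x(2)] Suc.prems(5) by simp
      qed
      moreover have "0 < d (par x)" using par'[OF Suc.prems(1) x(3)] x(1) by simp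
      ultimately show ?thesis using one[folded S_def, OF Suc.prems(1,2) x(3,4)] by blast
    qed
  qed simp
  \<comment> \<open>Legs have no gaps, so the greatest depth on a leg is its length.\<close>
  have down: "\<exists>y\<in>S. d y = i \<and> top y = top x" if "x \<in> S" "1 \<le> i" "i \<le> d x" for x i
    using that
  proof (induction "d x" arbitrary: x)
    case (Suc n)
    show ?case
    proof (cases "i = d x")
      case True
      then show ?thesis using Suc.prems by blast
    next
      case False
      then have x: "1 < d x" "0 < d x" "i \<le> n" using Suc.prems Suc.hyps(2) by simp_all
      have "n = d (par x)" "par x \<in> S" using par'[OF Suc.prems(1) x(2)] Suc.hyps(2) by simp_all
      then show ?thesis using Suc.hyps(1)[of "par x"] Suc.prems(2) x(3) top_par[OF Suc.prems(1) x(1)] by auto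
    qed
  qed simp
  obtain rs where rs: "set rs = {x \<in> S. d x = 0}" "distinct rs"
    using finite_distinct_list[of "{x \<in> S. d x = 0}"] fin by auto
  have "\<forall>r. \<exists>ys. set ys = {x \<in> S. d x = 1 \<and> par x = r} \<and> distinct ys"
  proof
    fix r
    have "finite {x \<in> S. d x = 1 \<and> par x = r}" using fin by simp
    then show "\<exists>ys. set ys = {x \<in> S. d x = 1 \<and> par x = r} \<and> distinct ys" by (rule finite_distinct_list)
  qed
  then obtain ch where ch: "\<And>r. set (ch r) = {x \<in> S. d x = 1 \<and> par x = r}" "\<And>r. distinct (ch r)" by metis
  define L where "L y = Max (d ` {x \<in> S. 0 < d x \<and> top x = y})" for y
  define legs where "legs = map (\<lambda>r. map L (ch r)) rs"
  have L: "(\<exists>x\<in>S. d x = i \<and> top x = y) \<longleftrightarrow> i \<le> L y" if y: "y \<in> S" "d y = 1" and i: "1 \<le> i" for y i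
  proof
    let ?A = "{x \<in> S. 0 < d x \<and> top x = y}"
    have fA: "finite (d ` ?A)" using fin by simp
    have "y \<in> ?A" using y top1 by simp
    then have "L y \<in> d ` ?A" unfolding L_def using fA by (intro Max_in) auto
    then obtain x where x: "x \<in> S" "0 < d x" "top x = y" "d x = L y" by auto
    show "\<exists>x\<in>S. d x = i \<and> top x = y" if "i \<le> L y" using down[OF x(1) i] that x by simp
    assume "\<exists>x\<in>S. d x = i \<and> top x = y"
    then obtain x' where "x' \<in> S" "d x' = i" "top x' = y" by blast
    then have "i \<in> d ` ?A" using i by auto
    then show "i \<le> L y" unfolding L_def using fA by (rule Max_ge[rotated])
  qed
  define ri where "ri r = (THE c. c < length rs \<and> rs ! c = r)" for r
  define ci where "ci y = (THE j. j < length (ch (par y)) \<and> ch (par y) ! j = y)" for y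
  have ri: "ri (rs ! c) = c" if "c < length rs" for c
    unfolding ri_def using that rs(2) by (intro the_equality) (auto simp: nth_eq_iff_index_eq)
  have ri': "ri r < length rs \<and> rs ! (ri r) = r" if r: "r \<in> S" "d r = 0" for r
  proof -
    have "r \<in> set rs" using r rs(1) by simp
    then obtain c where "c < length rs" "rs ! c = r" by (auto simp: in_set_conv_nth)
    then show ?thesis using ri by auto
  qed
  have ci: "ci (ch r ! j) = j" if j: "j < length (ch r)" for r j
  proof -
    have "ch r ! j \<in> set (ch r)" using j by simp
    then have "par (ch r ! j) = r" using ch(1) by simp
    then show ?thesis unfolding ci_def using j ch(2) by (intro the_equality) (auto simp: nth_eq_iff_index_eq)
  qed
  have ci': "ci y < length (ch (par y)) \<and> ch (par y) ! (ci y) = y" if y: "y \<in> S" "d y = 1" for y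
  proof -
    have "y \<in> set (ch (par y))" using y ch(1) by simp
    then obtain j where "j < length (ch (par y))" "ch (par y) ! j = y" by (auto simp: in_set_conv_nth)
    then show ?thesis using ci by metis
  qed
  \<comment> \<open>The successor matches the counting of legs from 1, and centres receive leg
    number 0.\<close>
  define F where "F x = (ri (root x), if d x = 0 then 0 else Suc (ci (top x)), d x)" for x
  have legs_len: "length legs = length rs" by (simp add: legs_def)
  have legs_c: "length (legs ! c) = length (ch (rs ! c))" if "c < length rs" for c using that by (simp add: legs_def)
  have legs_cj: "legs ! c ! (j - 1) = L (ch (rs ! c) ! (j - 1))" if "c < length rs" "1 \<le> j" "j \<le> length (ch (rs ! c))" for c j
    using that by (simp add: legs_def)
  have chS: "ch (rs ! c) ! (j - 1) \<in> S \<and> d (ch (rs ! c) ! (j - 1)) = 1 \<and> par (ch (rs ! c) ! (j - 1)) = rs ! c"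
    if "1 \<le> j" "j \<le> length (ch (rs ! c))" for c j
  proof -
    have "ch (rs ! c) ! (j - 1) \<in> set (ch (rs ! c))" using that by (intro nth_mem) simp
    then show ?thesis using ch(1) by simp
  qed
  let ?G = "spider_forest_graph legs"
  have addr: "ri (root x) < length rs \<and> rs ! ri (root x) = root x \<and> ci (top x) < length (ch (root x)) \<and>
      ch (root x) ! ci (top x) = top x \<and> d x \<le> L (top x)" if x: "x \<in> S" "0 < d x" for x
  proof -
    have t: "top x \<in> S" "d (top x) = 1" "par (top x) = root x" using topS[OF x] by auto
    have "d x \<le> L (top x)" using L[OF t(1,2), of "d x"] x by auto
    then show ?thesis using ri'[of "root x"] rootS[OF x(1)] ci'[OF t(1,2)] t(3) by simp
  qed
  have inV: "F x \<in> fst ?G" if x: "x \<in> S" for x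
  proof (cases "d x = 0")
    case True
    then show ?thesis using ri'[of x] x root0[of x] by (auto simp: F_def spider_forest_graph_def legs_len)
  next
    case False
    then have a: "ri (root x) < length rs" "rs ! ri (root x) = root x" "ci (top x) < length (ch (root x))"
      "ch (root x) ! ci (top x) = top x" "d x \<le> L (top x)" using addr[OF x] by auto
    then have "legs ! ri (root x) ! ci (top x) = L (top x)" by (simp add: legs_def)
    then show ?thesis using False a legs_c[OF a(1)]
      by (simp add: F_def spider_forest_graph_def legs_len)
  qed
  have inj: "inj_on F S"
  proof (rule inj_onI)
    fix x y assume xy: "x \<in> S" "y \<in> S" "F x = F y"
    then have d: "d x = d y" "ri (root x) = ri (root y)" by (simp_all add: F_def)
    then have r: "root x = root y" using ri' rootS xy(1,2) by metis
    show "x = y"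
    proof (cases "d x = 0")
      case True
      then show ?thesis using d r root0 by metis
    next
      case False
      then have "ci (top x) = ci (top y)" using xy(3) d by (simp add: F_def)
      moreover have "0 < d x" "0 < d y" using False d by auto
      then have "ch (root x) ! ci (top x) = top x" "ch (root y) ! ci (top y) = top y"
        using addr[OF xy(1)] addr[OF xy(2)] by blast+
      ultimately have "top x = top y" using r by metis
      then show ?thesis using uniq[OF xy(1,2)] d False by simp
    qed
  qed
  have onto: "v \<in> F ` S" if "v \<in> fst ?G" for v
  proof -
    from that consider c where "v = (c, 0, 0)" "c < length rs"
      | c j i where "v = (c, j, i)" "c < length rs" "1 \<le> j" "j \<le> length (ch (rs ! c))" "1 \<le> i" "i \<le> L (ch (rs ! c) ! (j - 1))"
      unfolding spider_forest_graph_def fst_conv using legs_len legs_c legs_cj by auto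
    then show ?thesis
    proof cases
      case 1
      have "rs ! c \<in> set rs" using 1(2) by simp
      then have "rs ! c \<in> S" "d (rs ! c) = 0" using rs(1) by auto
      then have "F (rs ! c) = v" "rs ! c \<in> S" using 1 ri root0 by (simp_all add: F_def)
      then show ?thesis by blast
    next
      case 2
      define y where "y = ch (rs ! c) ! (j - 1)"
      have y: "y \<in> S" "d y = 1" "par y = rs ! c" using chS[OF 2(3,4)] by (auto simp: y_def)
      obtain x where x: "x \<in> S" "d x = i" "top x = y" using L[OF y(1,2) 2(5)] 2(6) y_def by blast
      have "root x = rs ! c" using topS[OF x(1)] x 2(5) y(3) by simp
      moreover have "ci y = j - 1" unfolding y_def using ci 2(3,4) by simp
      ultimately have "F x = v" using 2 x ri by (simp add: F_def)
      then show ?thesis using x(1) by blast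
    qed
  qed
  have bij: "bij_betw F S (fst ?G)" using inj inV onto unfolding bij_betw_def by blast
  have parF: "{F x, F (par x)} \<in> snd ?G" if x: "x \<in> S" "0 < d x" for x
  proof -
    have a: "ri (root x) < length rs" "rs ! ri (root x) = root x" "ci (top x) < length (ch (root x))"
      "ch (root x) ! ci (top x) = top x" "d x \<le> L (top x)" using addr[OF x] by auto
    then have leg: "legs ! ri (root x) ! ci (top x) = L (top x)" by (simp add: legs_def)
    have rp: "root (par x) = root x" using root_par[OF x] .
    show ?thesis
    proof (cases "d x = 1")
      case True
      then have "d (par x) = 0" using par'[OF x] by simp
      then have "F (par x) = (ri (root x), 0, 0)" "F x = (ri (root x), Suc (ci (top x)), 1)"
        using True rp by (simp_all add: F_def)
      then have "{F x, F (par x)} = {(ri (root x), 0, 0), (ri (root x), Suc (ci (top x)), 1)}" by auto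
      moreover have "\<dots> \<in> snd ?G"
        unfolding spider_forest_graph_def snd_conv
        using a leg True legs_len legs_c[OF a(1)]
        by (intro UnI1 CollectI exI[of _ "ri (root x)"] exI[of _ "Suc (ci (top x))"]) simp
      ultimately show ?thesis by simp
    next
      case False
      then have d: "1 < d x" using x(2) by simp
      have "d x = Suc (d (par x))" using par'[OF x] by simp
      then have "F (par x) = (ri (root x), Suc (ci (top x)), d (par x))" "F x = (ri (root x), Suc (ci (top x)), Suc (d (par x)))"
        using d rp top_par[OF x(1) d] by (auto simp: F_def)
      then have "{F x, F (par x)} = {(ri (root x), Suc (ci (top x)), d (par x)), (ri (root x), Suc (ci (top x)), Suc (d (par x)))}" by auto
      moreover have "\<dots> \<in> snd ?G"
        unfolding spider_forest_graph_def snd_conv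
        using a leg d legs_len legs_c[OF a(1)] \<open>d x = Suc (d (par x))\<close>
        by (intro UnI2 CollectI exI[of _ "ri (root x)"] exI[of _ "Suc (ci (top x))"] exI[of _ "d (par x)"]) simp
      ultimately show ?thesis by simp
    qed
  qed
  \<comment> \<open>Addresses that look like those of a parent and its child belong to such a pair:
    \<open>par y\<close> has the same root or leg and the same depth as \<open>x\<close>, so
    \<open>uniq\<close> or the root identifies them.\<close>
  have par_if: "par y = x \<and> 0 < d y" if xy: "x \<in> S" "y \<in> S"
    and e: "fst (F x) = fst (F y)" "d y = Suc (d x)" "d x = 0 \<or> fst (snd (F x)) = fst (snd (F y))" for x y
  proof -
    have y0: "0 < d y" using e(2) by simp
    have "ri (root x) = ri (root y)" using e(1) by (simp add: F_def)
    then have r: "root x = root y" using ri' rootS xy by metis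
    have p: "par y \<in> S" "d (par y) = d x" using par'[OF xy(2) y0] e(2) by auto
    have rp: "root (par y) = root x" using root_par[OF xy(2) y0] r by simp
    show ?thesis
    proof (cases "d x = 0")
      case True
      then show ?thesis using rp root0[of x] root0[of "par y"] p y0 by simp
    next
      case False
      then have "ci (top x) = ci (top y)" using e(2,3) by (simp add: F_def)
      moreover have "ch (root x) ! ci (top x) = top x" "ch (root y) ! ci (top y) = top y"
        using addr[OF xy(1)] addr[OF xy(2)] False y0 by blast+
      ultimately have "top x = top y" using r by metis
      then have "top (par y) = top x" using top_par[OF xy(2)] e(2) False by simp
      then show ?thesis using uniq[OF p(1) xy(1)] p False y0 by simp
    qed
  qed
  have iff: "{x, y} \<in> snd K \<longleftrightarrow> {F x, F y} \<in> snd ?G" if xy: "x \<in> S" "y \<in> S" for x y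
  proof
    assume "{x, y} \<in> snd K"
    then show "{F x, F y} \<in> snd ?G" using edge[of x y] parF[OF xy(1)] parF[OF xy(2)] by (auto simp: insert_commute)
  next
    assume "{F x, F y} \<in> snd ?G"
    then have "\<exists>a b. {F x, F y} = {a, b} \<and> fst a = fst b \<and> snd (snd b) = Suc (snd (snd a)) \<and>
        (snd (snd a) = 0 \<or> fst (snd a) = fst (snd b))"
      unfolding spider_forest_graph_def snd_conv
    proof (elim UnE CollectE exE conjE)
      fix c j assume "{F x, F y} = {(c, 0, 0), (c, j, 1)}"
      then show ?thesis by (intro exI[of _ "(c, 0, 0)"] exI[of _ "(c, j, 1)"]) simp
    next
      fix c j i assume "{F x, F y} = {(c, j, i), (c, j, Suc i)}"
      then show ?thesis by (intro exI[of _ "(c, j, i)"] exI[of _ "(c, j, Suc i)"]) simp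
    qed
    then obtain a b where ab: "{F x, F y} = {a, b}" "fst a = fst b" "snd (snd b) = Suc (snd (snd a))"
        "snd (snd a) = 0 \<or> fst (snd a) = fst (snd b)" by blast
    have dF: "snd (snd (F z)) = d z" for z by (simp add: F_def)
    from ab(1) consider "F x = a" "F y = b" | "F x = b" "F y = a" by (auto simp: doubleton_eq_iff)
    then show "{x, y} \<in> snd K"
    proof cases
      case 1
      then have "par y = x \<and> 0 < d y" using par_if[OF xy] ab dF by metis
      then show ?thesis using par'[OF xy(2)] by (auto simp: insert_commute)
    next
      case 2
      then have "par x = y \<and> 0 < d x" using par_if[OF xy(2,1)] ab dF by metis
      then show ?thesis using par'[OF xy(1)] by auto
    qed
  qed
  have "isomorphic K ?G" unfolding isomorphic_def using bij iff unfolding S_def by blast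
  then show ?thesis using K unfolding spider_forest_def by blast
qed

text \<open>The map \<open>\<pi>\<close> comes from a larger graph, so \<open>\<pi> x\<close> might
  be missing from \<open>C\<close>. The vertices from which climbing leads to \<open>x\<close> do
  not include the lower vertex \<open>r\<close>, hence an edge of \<open>C\<close> leaves this set;
  the only possible such edge goes from \<open>x\<close> to its parent.\<close>

lemma ex_parent_if_above_min:
  assumes C: "conn E C" and x: "x \<in> C" and r: "r \<in> C" "\<eta> r < \<eta> x"
    and adj: "\<And>u v. u \<in> C \<Longrightarrow> v \<in> C \<Longrightarrow> {u, v} \<in> E \<Longrightarrow>
      \<pi> u = v \<and> \<eta> u = Suc (\<eta> v) \<or> \<pi> v = u \<and> \<eta> v = Suc (\<eta> u)"
  shows "\<pi> x \<in> C \<and> {x, \<pi> x} \<in> E \<and> \<eta> x = Suc (\<eta> (\<pi> x))"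
proof -
  \<comment> \<open>These are the descendants of \<open>x\<close>; prescribing their heights forces
    \<open>k\<close> to be 0 when the leaving edge goes down.\<close>
  define A where "A = {y. \<exists>k. (\<pi> ^^ k) y = x \<and> \<eta> y = \<eta> x + k}"
  have xA: "x \<in> A" unfolding A_def by (auto intro: exI[of _ 0])
  have rA: "r \<notin> A" using r(2) by (auto simp: A_def)
  obtain u v where uv: "u \<in> A" "u \<in> C" "v \<in> C" "v \<notin> A" "{u, v} \<in> E"
    using conn_cut[OF C x xA r(1) rA] by metis
  obtain k where k: "(\<pi> ^^ k) u = x" "\<eta> u = \<eta> x + k" using uv(1) by (auto simp: A_def)
  from adj[OF uv(2,3,5)] show ?thesis
  proof
    assume u: "\<pi> u = v \<and> \<eta> u = Suc (\<eta> v)"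
    show ?thesis
    proof (cases k)
      case 0
      then show ?thesis using k u uv by auto
    next
      case (Suc k')
      then have "(\<pi> ^^ k') v = x" "\<eta> v = \<eta> x + k'" using k u by (auto simp: funpow_swap1)
      then show ?thesis using uv(4) by (auto simp: A_def)
    qed
  next
    assume "\<pi> v = u \<and> \<eta> v = Suc (\<eta> u)"
    then have "(\<pi> ^^ Suc k) v = x" "\<eta> v = \<eta> x + Suc k" using k by (auto simp: funpow_swap1)
    then show ?thesis using uv(4) unfolding A_def by blast
  qed
qed

text \<open>Within a component the depth is measured from the least height that occurs.\<close>

lemma spider_forest_if_components:
  assumes K: "graph K"
    and ex: "\<And>C. C \<in> comps (snd K) (fst K) \<Longrightarrow> \<exists>\<eta> \<pi>.
      (\<forall>u\<in>C. \<forall>v\<in>C. {u, v} \<in> snd K \<longrightarrow> \<pi> u = v \<and> \<eta> u = Suc (\<eta> v) \<or> \<pi> v = u \<and> \<eta> v = Suc (\<eta> u)) \<and>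
      (\<forall>u\<in>C. \<forall>v\<in>C. 0 < \<eta> u \<longrightarrow> 0 < \<eta> v \<longrightarrow> \<pi> u = \<pi> v \<longrightarrow> 0 < \<eta> (\<pi> u) \<longrightarrow> u = v)"
  shows "spider_forest K"
proof -
  define S where "S = fst K"
  define E where "E = snd K"
  have fin: "finite S" using K by (simp add: S_def graph_def)
  define cp where "cp x = comp_of E S x" for x
  have "\<forall>C\<in>comps E S. \<exists>\<eta>\<pi> :: ('a \<Rightarrow> nat) \<times> ('a \<Rightarrow> 'a).
      (\<forall>u\<in>C. \<forall>v\<in>C. {u, v} \<in> E \<longrightarrow> snd \<eta>\<pi> u = v \<and> fst \<eta>\<pi> u = Suc (fst \<eta>\<pi> v) \<or> snd \<eta>\<pi> v = u \<and> fst \<eta>\<pi> v = Suc (fst \<eta>\<pi> u)) \<and>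
      (\<forall>u\<in>C. \<forall>v\<in>C. 0 < fst \<eta>\<pi> u \<longrightarrow> 0 < fst \<eta>\<pi> v \<longrightarrow> snd \<eta>\<pi> u = snd \<eta>\<pi> v \<longrightarrow> 0 < fst \<eta>\<pi> (snd \<eta>\<pi> u) \<longrightarrow> u = v)" (is "\<forall>C\<in>_. ?P C")
  proof
    fix C assume "C \<in> comps E S"
    from ex[folded S_def E_def, OF this] obtain \<eta> \<pi> where
      "(\<forall>u\<in>C. \<forall>v\<in>C. {u, v} \<in> E \<longrightarrow> \<pi> u = v \<and> \<eta> u = Suc (\<eta> v) \<or> \<pi> v = u \<and> \<eta> v = Suc (\<eta> u)) \<and>
      (\<forall>u\<in>C. \<forall>v\<in>C. 0 < \<eta> u \<longrightarrow> 0 < \<eta> v \<longrightarrow> \<pi> u = \<pi> v \<longrightarrow> 0 < \<eta> (\<pi> u) \<longrightarrow> u = v)"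
      by (elim exE)
    then show "?P C" by (intro exI[of _ "(\<eta>, \<pi>)"]) (simp only: fst_conv snd_conv)
  qed
  from bchoice[OF this] obtain g where g: "\<forall>C\<in>comps E S.
      (\<forall>u\<in>C. \<forall>v\<in>C. {u, v} \<in> E \<longrightarrow> snd (g C) u = v \<and> fst (g C) u = Suc (fst (g C) v) \<or> snd (g C) v = u \<and> fst (g C) v = Suc (fst (g C) u)) \<and>
      (\<forall>u\<in>C. \<forall>v\<in>C. 0 < fst (g C) u \<longrightarrow> 0 < fst (g C) v \<longrightarrow> snd (g C) u = snd (g C) v \<longrightarrow> 0 < fst (g C) (snd (g C) u) \<longrightarrow> u = v)"
    by (elim exE)
  define eta where "eta C = fst (g C)" for C
  define pi where "pi C = snd (g C)" for C
  have adj: "pi C u = v \<and> eta C u = Suc (eta C v) \<or> pi C v = u \<and> eta C v = Suc (eta C u)"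
    if "C \<in> comps E S" "u \<in> C" "v \<in> C" "{u, v} \<in> E" for C u v
    using bspec[OF g that(1)] that(2-4) unfolding eta_def pi_def by blast
  have one: "u = v" if "C \<in> comps E S" "u \<in> C" "v \<in> C" "0 < eta C u" "0 < eta C v" "pi C u = pi C v" "0 < eta C (pi C u)" for C u v
    using bspec[OF g that(1)] that(2-7) unfolding eta_def pi_def by blast
  define m where "m C = Min (eta C ` C)" for C
  have cpC: "cp x \<in> comps E S" "x \<in> cp x" if "x \<in> S" for x
    using that by (auto simp: cp_def comps_def comp_of_def)
  have cp_eq: "cp x = C" if "C \<in> comps E S" "x \<in> C" for x C
  proof -
    have "x \<in> S" using that comps_subset by blast
    then show ?thesis using comps_disjoint[OF that(1) cpC(1)] cpC(2) that(2) by blast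
  qed
  have finC: "finite C" if "C \<in> comps E S" for C using comps_subset[OF that] fin finite_subset by blast
  have mle: "m C \<le> eta C x" if "C \<in> comps E S" "x \<in> C" for x C
    unfolding m_def using finC[OF that(1)] that(2) by simp
  have mr: "\<exists>r\<in>C. eta C r = m C" if C: "C \<in> comps E S" for C
  proof -
    have "m C \<in> eta C ` C"
      unfolding m_def using finC[OF C] conn_ne[OF conn_comps[OF C]] by (intro Min_in) auto
    then show ?thesis by auto
  qed
  define d where "d x = eta (cp x) x - m (cp x)" for x
  define par where "par x = pi (cp x) x" for x
  have parent: "par x \<in> cp x \<and> {x, par x} \<in> E \<and> eta (cp x) x = Suc (eta (cp x) (par x))" if x: "x \<in> S" "0 < d x" for x
  proof -
    note c = cpC[OF x(1)]
    obtain r where r: "r \<in> cp x" "eta (cp x) r = m (cp x)" using mr[OF c(1)] by blast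
    have "eta (cp x) r < eta (cp x) x" using x(2) r(2) by (simp add: d_def)
    then show ?thesis
      unfolding par_def using ex_parent_if_above_min[OF conn_comps[OF c(1)] c(2) r(1)] adj[OF c(1)] by blast
  qed
  show ?thesis
  proof (rule spider_forestI[OF K, where d = d and par = par], unfold S_def[symmetric] E_def[symmetric])
    fix x assume x: "x \<in> S" "0 < d x"
    note p = parent[OF x]
    have eq: "cp (par x) = cp x" using cp_eq cpC(1)[OF x(1)] p by blast
    have "m (cp x) \<le> eta (cp x) (par x)" using mle[OF cpC(1)[OF x(1)]] p by blast
    then have "d x = Suc (d (par x))" using p unfolding d_def eq by simp
    moreover have "par x \<in> S" using p comps_subset[OF cpC(1)[OF x(1)]] by blast
    ultimately show "par x \<in> S \<and> d x = Suc (d (par x)) \<and> {x, par x} \<in> E" using p by blast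
  next
    fix x y assume e: "{x, y} \<in> E"
    then have xy: "x \<in> S" "y \<in> S" using graph_edgeD[OF K] unfolding S_def E_def by blast+
    note c = cpC[OF xy(1)]
    have y: "y \<in> cp x" using comps_closed[OF c xy(2) e] .
    then have eq: "cp y = cp x" using cp_eq c(1) by blast
    have "m (cp x) \<le> eta (cp x) x" "m (cp x) \<le> eta (cp x) y" using mle[OF c(1)] c(2) y by blast+
    then show "0 < d x \<and> par x = y \<or> 0 < d y \<and> par y = x"
      using adj[OF c y e] unfolding d_def par_def eq by auto
  next
    fix x y assume xy: "x \<in> S" "y \<in> S" "0 < d x" "0 < d y" "par x = par y" "0 < d (par x)"
    note px = parent[OF xy(1,3)] and py = parent[OF xy(2,4)]
    have eqx: "cp (par x) = cp x" using cp_eq cpC(1)[OF xy(1)] px by blast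
    have "cp (par y) = cp y" using cp_eq cpC(1)[OF xy(2)] py by blast
    then have eq: "cp y = cp x" using eqx xy(5) by simp
    have "y \<in> cp x" using cpC(2)[OF xy(2)] eq by simp
    moreover have "0 < eta (cp x) x" "0 < eta (cp x) y" using xy(3,4) unfolding d_def eq by auto
    moreover have "pi (cp x) x = pi (cp x) y" using xy(5) unfolding par_def eq .
    moreover have "0 < eta (cp x) (pi (cp x) x)" using xy(6) unfolding d_def eqx by (simp add: par_def)
    ultimately show "x = y" using one[OF cpC(1)[OF xy(1)] cpC(2)[OF xy(1)]] by blast
  qed
qed

text \<open>Spider-forests are recognised on the image inside \<open>subdiv\<close>, where the
  vertices carry coordinates.\<close>

lemma isomorphic_image:
  assumes H: "graph H" and f: "inj_on f (fst H)"
  defines "K \<equiv> (f ` fst H, {{f u, f v} | u v. {u, v} \<in> snd H})"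
  shows "graph K" "isomorphic H K"
proof -
  show "graph K"
    unfolding graph_def
  proof (intro conjI ballI)
    show "finite (fst K)" using H by (simp add: K_def graph_def)
    fix e assume "e \<in> snd K"
    then obtain u v where e: "e = {f u, f v}" "{u, v} \<in> snd H" by (auto simp: K_def)
    have uv: "u \<in> fst H" "v \<in> fst H" "u \<noteq> v" using graph_edgeD[OF H e(2)] by auto
    then have "f u \<noteq> f v" using f by (auto dest: inj_onD)
    then show "\<exists>u v. e = {u, v} \<and> u \<noteq> v \<and> u \<in> fst K \<and> v \<in> fst K"
      using e uv by (intro exI[of _ "f u"] exI[of _ "f v"]) (simp add: K_def)
  qed
  show "isomorphic H K"
    unfolding isomorphic_def
  proof (intro exI[of _ f] conjI ballI)
    show "bij_betw f (fst H) (fst K)" using f by (simp add: K_def bij_betw_def)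
    fix u v assume uv: "u \<in> fst H" "v \<in> fst H"
    show "{u, v} \<in> snd H \<longleftrightarrow> {f u, f v} \<in> snd K"
    proof
      assume "{f u, f v} \<in> snd K"
      then obtain a b where ab: "{f u, f v} = {f a, f b}" "{a, b} \<in> snd H" by (auto simp: K_def)
      have "a \<in> fst H" "b \<in> fst H" using graph_edgeD[OF H ab(2)] by auto
      then have "u = a \<and> v = b \<or> u = b \<and> v = a"
        using ab(1) uv inj_onD[OF f] by (auto simp: doubleton_eq_iff)
      then show "{u, v} \<in> snd H" using ab(2) by (auto simp: insert_commute)
    qed (auto simp: K_def)
  qed
qed

lemma spider_forest_isomorphic:
  assumes "graph H" "isomorphic H K" "spider_forest K"
  shows "spider_forest H"
proof -
  obtain legs where "isomorphic K (spider_forest_graph legs)" using assms(3) unfolding spider_forest_def by blast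
  then obtain g where g: "bij_betw g (fst K) (fst (spider_forest_graph legs))"
    "\<And>u v. u \<in> fst K \<Longrightarrow> v \<in> fst K \<Longrightarrow> {u, v} \<in> snd K \<longleftrightarrow> {g u, g v} \<in> snd (spider_forest_graph legs)"
    unfolding isomorphic_def by blast
  obtain f where f: "bij_betw f (fst H) (fst K)"
    "\<And>u v. u \<in> fst H \<Longrightarrow> v \<in> fst H \<Longrightarrow> {u, v} \<in> snd H \<longleftrightarrow> {f u, f v} \<in> snd K"
    using assms(2) unfolding isomorphic_def by blast
  have "isomorphic H (spider_forest_graph legs)"
    unfolding isomorphic_def
  proof (intro exI[of _ "g \<circ> f"] conjI ballI)
    show "bij_betw (g \<circ> f) (fst H) (fst (spider_forest_graph legs))" using f(1) g(1) by (rule bij_betw_trans)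
    fix u v assume uv: "u \<in> fst H" "v \<in> fst H"
    then have "f u \<in> fst K" "f v \<in> fst K" using f(1) bij_betwE by blast+
    then show "{u, v} \<in> snd H \<longleftrightarrow> {(g \<circ> f) u, (g \<circ> f) v} \<in> snd (spider_forest_graph legs)"
      using f(2)[OF uv] g(2) by simp
  qed
  then show ?thesis using assms(1) unfolding spider_forest_def by blast
qed

section \<open>Subdivided closures of trees\<close>

definition pt :: "nat list \<Rightarrow> nat \<Rightarrow> nat \<Rightarrow> nat" where
  "pt \<sigma> i j = to_nat (\<sigma>, i, j)"

lemma pt_eq [simp]: "pt \<sigma> i j = pt \<sigma>' i' j' \<longleftrightarrow> \<sigma> = \<sigma>' \<and> i = i' \<and> j = j'"
  by (simp add: pt_def)

lemma from_nat_pt [simp]: "from_nat (pt \<sigma> i j) = (\<sigma>, i, j)"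
  by (simp add: pt_def)

text \<open>Branch vertices are the words \<open>\<sigma>\<close> of length at most \<open>h\<close>; each word of length \<open>h\<close> is joined to
  its proper prefix of length \<open>i\<close> by a path with the \<open>p\<close> inner vertices \<open>pt \<sigma> (Suc i) j\<close>.\<close>

definition subdiv :: "nat \<Rightarrow> nat \<Rightarrow> nat \<Rightarrow> nat graph" where
  "subdiv h M p =
    ({pt \<sigma> 0 0 | \<sigma>. set \<sigma> \<subseteq> {..M} \<and> length \<sigma> \<le> h} \<union>
     {pt \<sigma> (Suc i) j | \<sigma> i j. set \<sigma> \<subseteq> {..M} \<and> length \<sigma> = h \<and> i < h \<and> 1 \<le> j \<and> j \<le> p},
     {{pt \<sigma> 0 0, pt \<sigma> (Suc i) 1} | \<sigma> i. set \<sigma> \<subseteq> {..M} \<and> length \<sigma> = h \<and> i < h} \<union>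
     {{pt \<sigma> (Suc i) j, pt \<sigma> (Suc i) (Suc j)} | \<sigma> i j. set \<sigma> \<subseteq> {..M} \<and> length \<sigma> = h \<and> i < h \<and> 1 \<le> j \<and> j < p} \<union>
     {{pt \<sigma> (Suc i) p, pt (take i \<sigma>) 0 0} | \<sigma> i. set \<sigma> \<subseteq> {..M} \<and> length \<sigma> = h \<and> i < h})"

lemma subdiv_vertexE:
  assumes "x \<in> fst (subdiv h M p)"
  obtains \<sigma> where "x = pt \<sigma> 0 0" "set \<sigma> \<subseteq> {..M}" "length \<sigma> \<le> h"
    | \<sigma> i j where "x = pt \<sigma> (Suc i) j" "set \<sigma> \<subseteq> {..M}" "length \<sigma> = h" "i < h" "1 \<le> j" "j \<le> p"
  using assms unfolding subdiv_def fst_conv by blast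

lemma subdiv_edgeE:
  assumes "e \<in> snd (subdiv h M p)"
  obtains \<sigma> i where "e = {pt \<sigma> 0 0, pt \<sigma> (Suc i) 1}" "set \<sigma> \<subseteq> {..M}" "length \<sigma> = h" "i < h"
    | \<sigma> i j where "e = {pt \<sigma> (Suc i) j, pt \<sigma> (Suc i) (Suc j)}" "set \<sigma> \<subseteq> {..M}" "length \<sigma> = h" "i < h" "1 \<le> j" "j < p"
    | \<sigma> i where "e = {pt \<sigma> (Suc i) p, pt (take i \<sigma>) 0 0}" "set \<sigma> \<subseteq> {..M}" "length \<sigma> = h" "i < h"
  using assms unfolding subdiv_def snd_conv by blast

lemma subdiv_vertexI:
  "set \<sigma> \<subseteq> {..M} \<Longrightarrow> length \<sigma> \<le> h \<Longrightarrow> pt \<sigma> 0 0 \<in> fst (subdiv h M p)"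
  "set \<sigma> \<subseteq> {..M} \<Longrightarrow> length \<sigma> = h \<Longrightarrow> i < h \<Longrightarrow> 1 \<le> j \<Longrightarrow> j \<le> p \<Longrightarrow> pt \<sigma> (Suc i) j \<in> fst (subdiv h M p)"
  unfolding subdiv_def fst_conv by blast+

lemma subdiv_edgeI:
  "set \<sigma> \<subseteq> {..M} \<Longrightarrow> length \<sigma> = h \<Longrightarrow> i < h \<Longrightarrow> {pt \<sigma> 0 0, pt \<sigma> (Suc i) 1} \<in> snd (subdiv h M p)"
  "set \<sigma> \<subseteq> {..M} \<Longrightarrow> length \<sigma> = h \<Longrightarrow> i < h \<Longrightarrow> 1 \<le> j \<Longrightarrow> j < p \<Longrightarrow>
    {pt \<sigma> (Suc i) j, pt \<sigma> (Suc i) (Suc j)} \<in> snd (subdiv h M p)"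
  "set \<sigma> \<subseteq> {..M} \<Longrightarrow> length \<sigma> = h \<Longrightarrow> i < h \<Longrightarrow> {pt \<sigma> (Suc i) p, pt (take i \<sigma>) 0 0} \<in> snd (subdiv h M p)"
  unfolding subdiv_def snd_conv by blast+

lemma graph_subdiv:
  assumes p: "1 \<le> p"
  shows "graph (subdiv h M p)"
  unfolding graph_def
proof (intro conjI ballI)
  let ?L = "{\<sigma>. set \<sigma> \<subseteq> {..M} \<and> length \<sigma> \<le> h}"
  have "fst (subdiv h M p) \<subseteq> (\<lambda>(\<sigma>, i, j). pt \<sigma> i j) ` (?L \<times> {..h} \<times> {..p})"
  proof
    fix x assume "x \<in> fst (subdiv h M p)"
    then show "x \<in> (\<lambda>(\<sigma>, i, j). pt \<sigma> i j) ` (?L \<times> {..h} \<times> {..p})"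
    proof (cases rule: subdiv_vertexE)
      case (1 \<sigma>)
      then show ?thesis by (intro image_eqI[of _ _ "(\<sigma>, 0, 0)"]) auto
    next
      case (2 \<sigma> i j)
      then show ?thesis by (intro image_eqI[of _ _ "(\<sigma>, Suc i, j)"]) auto
    qed
  qed
  moreover have "finite ?L" by (rule finite_lists_length_le) simp
  ultimately show "finite (fst (subdiv h M p))" by (meson finite_SigmaI finite_atMost finite_imageI finite_subset)
  fix e assume "e \<in> snd (subdiv h M p)"
  then show "\<exists>u v. e = {u, v} \<and> u \<noteq> v \<and> u \<in> fst (subdiv h M p) \<and> v \<in> fst (subdiv h M p)"
  proof (cases rule: subdiv_edgeE)
    case (1 \<sigma> i)
    then show ?thesis using p
      by (intro exI[of _ "pt \<sigma> 0 0"] exI[of _ "pt \<sigma> (Suc i) 1"]) (simp add: subdiv_vertexI)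
  next
    case (2 \<sigma> i j)
    then show ?thesis
      by (intro exI[of _ "pt \<sigma> (Suc i) j"] exI[of _ "pt \<sigma> (Suc i) (Suc j)"]) (simp add: subdiv_vertexI)
  next
    case (3 \<sigma> i)
    have "set (take i \<sigma>) \<subseteq> {..M}" using 3(2) set_take_subset[of i \<sigma>] by blast
    then show ?thesis using 3 p
      by (intro exI[of _ "pt \<sigma> (Suc i) p"] exI[of _ "pt (take i \<sigma>) 0 0"]) (simp add: subdiv_vertexI)
  qed
qed

text \<open>A discrete intermediate value theorem: an edge leaving the set of values at most
  \<open>k\<close> starts at the value \<open>k\<close>.\<close>

lemma conn_intermediate_values:
  assumes C: "conn E C" and lip: "\<And>u v. u \<in> C \<Longrightarrow> v \<in> C \<Longrightarrow> {u, v} \<in> E \<Longrightarrow> \<psi> v \<le> Suc (\<psi> u)"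
    and ab: "a \<in> C" "b \<in> C" "\<psi> a \<le> k" "k < \<psi> b"
  shows "k \<in> \<psi> ` C"
proof -
  have "a \<in> {x. \<psi> x \<le> k}" "b \<notin> {x. \<psi> x \<le> k}" using ab by auto
  then obtain u v where uv: "u \<in> {x. \<psi> x \<le> k}" "u \<in> C" "v \<in> C" "v \<notin> {x. \<psi> x \<le> k}" "{u, v} \<in> E"
    using conn_cut[OF C ab(1) _ ab(2)] by metis
  then have "\<psi> u = k" using lip[OF uv(2,3,5)] by simp
  then show ?thesis using uv(2) by blast
qed

text \<open>The position along a subdivided edge, from 0 at the word of length \<open>h\<close> to
  \<open>Suc p\<close> at its proper prefix. A branch vertex has the same position on all its
  subdivided edges, so this is a function of the vertex.\<close>

definition thread_pos :: "nat \<Rightarrow> nat \<Rightarrow> nat \<Rightarrow> nat" where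
  "thread_pos h p x = (case from_nat x :: nat list \<times> nat \<times> nat of (\<sigma>, i, j) \<Rightarrow>
     if i = 0 then (if length \<sigma> = h then 0 else Suc p) else j)"

lemma thread_pos_pt [simp]:
  "thread_pos h p (pt \<sigma> 0 0) = (if length \<sigma> = h then 0 else Suc p)"
  "thread_pos h p (pt \<sigma> (Suc i) j) = j"
  by (simp_all add: thread_pos_def)

lemma thread_pos_lipschitz:
  assumes "{u, v} \<in> snd (subdiv h M p)"
  shows "thread_pos h p v \<le> Suc (thread_pos h p u)"
  using assms
proof (cases rule: subdiv_edgeE)
  case (1 \<sigma> i)
  then show ?thesis by (auto simp: doubleton_eq_iff)
next
  case (2 \<sigma> i j)
  then show ?thesis by (auto simp: doubleton_eq_iff)
next
  case (3 \<sigma> i)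
  then show ?thesis by (auto simp: doubleton_eq_iff)
qed

text \<open>A subgraph on at most \<open>p\<close> vertices has no component with branch vertices of both kinds,
  so each component can be rooted towards one end of the subdivided edges.\<close>

lemma spider_forest_if_small:
  assumes H: "graph H" "card (fst H) \<le> p" and c: "contains_subgraph (subdiv h M p) H"
  shows "spider_forest H"
proof -
  let ?E = "snd (subdiv h M p)" and ?V = "fst (subdiv h M p)"
  obtain f where f: "inj_on f (fst H)" "f ` fst H \<subseteq> ?V" "\<And>u v. {u, v} \<in> snd H \<Longrightarrow> {f u, f v} \<in> ?E"
    using c unfolding contains_subgraph_def by blast
  define K where "K = (f ` fst H, {{f u, f v} | u v. {u, v} \<in> snd H})"
  have K: "graph K" "isomorphic H K" using isomorphic_image[OF H(1) f(1)] unfolding K_def by auto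
  have EK: "snd K \<subseteq> ?E" using f(3) by (auto simp: K_def)
  have VK: "fst K \<subseteq> ?V" "finite (fst K)" using f(2) H(1) by (auto simp: K_def graph_def)
  have cK: "card (fst K) \<le> p" using card_image[OF f(1)] H(2) by (simp add: K_def)
  let ?\<psi> = "thread_pos h p"
  have "spider_forest K"
  proof (rule spider_forest_if_components[OF K(1)])
    fix C assume C: "C \<in> comps (snd K) (fst K)"
    have CV: "C \<subseteq> ?V" "C \<subseteq> fst K" using comps_subset[OF C] VK by auto
    have cC: "card C \<le> p" using card_mono[OF VK(2) CV(2)] cK by simp
    have finC: "finite C" using CV(2) VK(2) finite_subset by blast
    have conC: "conn (snd K) C" by (rule conn_comps[OF C])
    have "(\<forall>x\<in>C. ?\<psi> x \<noteq> 0) \<or> (\<forall>x\<in>C. ?\<psi> x \<noteq> Suc p)"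
    proof (rule ccontr)
      assume "\<not> ?thesis"
      then obtain a b where ab: "a \<in> C" "?\<psi> a = 0" "b \<in> C" "?\<psi> b = Suc p" by blast
      \<comment> \<open>A component reaching from position 0 to position \<open>Suc p\<close> takes
        all \<open>p + 1\<close> values up to \<open>p\<close>, more than it has vertices.\<close>
      have "{..p} \<subseteq> ?\<psi> ` C"
      proof
        fix k assume "k \<in> {..p}"
        then show "k \<in> ?\<psi> ` C"
          by (intro conn_intermediate_values[OF conC _ ab(1,3)]) (use ab EK thread_pos_lipschitz in auto)
      qed
      then have "card {..p} \<le> card C" using surj_card_le[OF finC] by blast
      then show False using cC by simp
    qed
    then show "\<exists>\<eta> \<pi>. (\<forall>u\<in>C. \<forall>v\<in>C. {u, v} \<in> snd K \<longrightarrow> \<pi> u = v \<and> \<eta> u = Suc (\<eta> v) \<or> \<pi> v = u \<and> \<eta> v = Suc (\<eta> u)) \<and>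
      (\<forall>u\<in>C. \<forall>v\<in>C. 0 < \<eta> u \<longrightarrow> 0 < \<eta> v \<longrightarrow> \<pi> u = \<pi> v \<longrightarrow> 0 < \<eta> (\<pi> u) \<longrightarrow> u = v)"
    proof
      \<comment> \<open>No proper prefix occurs, so the component is rooted towards a word of length
        \<open>h\<close>: heights are positions, and parents lie one position lower.\<close>
      assume no: "\<forall>x\<in>C. ?\<psi> x \<noteq> Suc p"
      define \<pi> where "\<pi> x = (case from_nat x :: nat list \<times> nat \<times> nat of (\<sigma>, i, j) \<Rightarrow>
        if j \<le> 1 then pt \<sigma> 0 0 else pt \<sigma> i (j - 1))" for x
      have \<pi>: "\<pi> (pt \<sigma> i j) = (if j \<le> 1 then pt \<sigma> 0 0 else pt \<sigma> i (j - 1))" for \<sigma> i j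
        by (simp add: \<pi>_def)
      have 1: "\<pi> u = v \<and> ?\<psi> u = Suc (?\<psi> v) \<or> \<pi> v = u \<and> ?\<psi> v = Suc (?\<psi> u)"
        if uv: "u \<in> C" "v \<in> C" "{u, v} \<in> snd K" for u v
      proof -
        have "{u, v} \<in> ?E" using uv(3) EK by blast
        then show ?thesis
        proof (cases rule: subdiv_edgeE)
          case (1 \<sigma> i)
          then show ?thesis by (auto simp: doubleton_eq_iff \<pi>)
        next
          case (2 \<sigma> i j)
          then show ?thesis by (auto simp: doubleton_eq_iff \<pi>)
        next
          case (3 \<sigma> i)
          then have "pt (take i \<sigma>) 0 0 \<in> C" using uv by (auto simp: doubleton_eq_iff)
          then have "?\<psi> (pt (take i \<sigma>) 0 0) \<noteq> Suc p" using no by blast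
          then show ?thesis using 3 by simp
        qed
      qed
      have inner: "\<exists>\<sigma> i j. x = pt \<sigma> (Suc i) j \<and> length \<sigma> = h \<and> 1 \<le> j" if x: "x \<in> C" "0 < ?\<psi> x" for x
      proof -
        have "x \<in> ?V" using x(1) CV by blast
        then show ?thesis
        proof (cases rule: subdiv_vertexE)
          case (1 \<sigma>)
          then show ?thesis using x no by (auto split: if_splits)
        next
          case (2 \<sigma> i j)
          then show ?thesis by blast
        qed
      qed
      have 2: "u = v" if uv: "u \<in> C" "v \<in> C" "0 < ?\<psi> u" "0 < ?\<psi> v" "\<pi> u = \<pi> v" "0 < ?\<psi> (\<pi> u)" for u v
      proof -
        obtain \<sigma> i j where u: "u = pt \<sigma> (Suc i) j" "length \<sigma> = h" "1 \<le> j" using inner uv by blast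
        obtain \<sigma>' i' j' where v: "v = pt \<sigma>' (Suc i') j'" "length \<sigma>' = h" "1 \<le> j'" using inner uv by blast
        show ?thesis using uv(5,6) u v by (auto simp: \<pi> split: if_splits)
      qed
      show ?thesis by (intro exI[of _ ?\<psi>] exI[of _ \<pi>] conjI ballI impI) (rule 1 2; assumption)+
    next
      \<comment> \<open>No word of length \<open>h\<close> occurs, so the component is rooted
        towards a proper prefix and heights are counted down from \<open>Suc p\<close>.\<close>
      assume no: "\<forall>x\<in>C. ?\<psi> x \<noteq> 0"
      \<comment> \<open>Inner vertices on the way to the prefix of length \<open>i\<close> have
        second coordinate \<open>Suc i\<close>, hence the predecessor in
        \<open>take\<close>.\<close>
      define \<pi> where "\<pi> x = (case from_nat x :: nat list \<times> nat \<times> nat of (\<sigma>, i, j) \<Rightarrow>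
        if j = p then pt (take (i - 1) \<sigma>) 0 0 else pt \<sigma> i (Suc j))" for x
      define \<eta> where "\<eta> x = Suc p - ?\<psi> x" for x
      have \<pi>: "\<pi> (pt \<sigma> i j) = (if j = p then pt (take (i - 1) \<sigma>) 0 0 else pt \<sigma> i (Suc j))" for \<sigma> i j
        by (simp add: \<pi>_def)
      have 1: "\<pi> u = v \<and> \<eta> u = Suc (\<eta> v) \<or> \<pi> v = u \<and> \<eta> v = Suc (\<eta> u)"
        if uv: "u \<in> C" "v \<in> C" "{u, v} \<in> snd K" for u v
      proof -
        have "{u, v} \<in> ?E" using uv(3) EK by blast
        then show ?thesis
        proof (cases rule: subdiv_edgeE)
          case (1 \<sigma> i)
          then have "pt \<sigma> 0 0 \<in> C" using uv by (auto simp: doubleton_eq_iff)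
          then have "?\<psi> (pt \<sigma> 0 0) \<noteq> 0" using no by blast
          then show ?thesis using 1 by simp
        next
          case (2 \<sigma> i j)
          then show ?thesis by (auto simp: doubleton_eq_iff \<pi> \<eta>_def)
        next
          case (3 \<sigma> i)
          then show ?thesis by (auto simp: doubleton_eq_iff \<pi> \<eta>_def)
        qed
      qed
      have inner: "\<exists>\<sigma> i j. x = pt \<sigma> (Suc i) j \<and> length \<sigma> = h \<and> i < h \<and> j \<le> p" if x: "x \<in> C" "0 < \<eta> x" for x
      proof -
        have "x \<in> ?V" using x(1) CV by blast
        then show ?thesis
        proof (cases rule: subdiv_vertexE)
          case (1 \<sigma>)
          then show ?thesis using x no by (auto simp: \<eta>_def split: if_splits)
        next
          case (2 \<sigma> i j)
          then show ?thesis by blast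
        qed
      qed
      have 2: "u = v" if uv: "u \<in> C" "v \<in> C" "0 < \<eta> u" "0 < \<eta> v" "\<pi> u = \<pi> v" "0 < \<eta> (\<pi> u)" for u v
      proof -
        obtain \<sigma> i j where u: "u = pt \<sigma> (Suc i) j" "length \<sigma> = h" "i < h" "j \<le> p" using inner uv by blast
        obtain \<sigma>' i' j' where v: "v = pt \<sigma>' (Suc i') j'" "length \<sigma>' = h" "i' < h" "j' \<le> p" using inner uv by blast
        show ?thesis using uv(5,6) u v by (auto simp: \<pi> \<eta>_def split: if_splits)
      qed
      show ?thesis by (intro exI[of _ \<eta>] exI[of _ \<pi>] conjI ballI impI) (rule 1 2; assumption)+
    qed
  qed
  then show ?thesis using spider_forest_isomorphic[OF H(1) K(2)] by blast
qed

text \<open>The decomposition follows the tree of words: \<open>W \<sigma>\<close> consists of the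
  proper prefixes of \<open>\<sigma>\<close>, and \<open>X \<sigma>\<close> of everything addressed
  by extensions of \<open>\<sigma>\<close>. At a word of length \<open>h\<close> one bag takes its
  \<open>h\<close> proper prefixes, the word itself and the \<open>h * p\<close> inner vertices,
  which gives the width. The number of branches \<open>M\<close> does not enter.\<close>

lemma rd_subdiv: "rd (h + h * p) (snd (subdiv h M p)) {} (fst (subdiv h M p))"
proof -
  let ?E = "snd (subdiv h M p)" and ?V = "fst (subdiv h M p)"
  define W where "W \<sigma> = (\<lambda>i. pt (take i \<sigma>) 0 0) ` {..<length \<sigma>}" for \<sigma>
  define X where "X \<sigma> = {x \<in> ?V. \<exists>\<tau> i j. x = pt \<tau> i j \<and> take (length \<sigma>) \<tau> = \<sigma>}" for \<sigma>
  \<comment> \<open>The words of adjacent vertices are comparable, so the subtrees below different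
    children are not adjacent.\<close>
  have ed: "\<tau> = \<tau>' \<or> (\<exists>q. \<tau>' = take q \<tau>) \<or> (\<exists>q. \<tau> = take q \<tau>')" if e: "{pt \<tau> i j, pt \<tau>' i' j'} \<in> ?E" for \<tau> \<tau>' i j i' j'
    using e
  proof (cases rule: subdiv_edgeE)
    case (1 \<sigma> i)
    then show ?thesis by (auto simp: doubleton_eq_iff)
  next
    case (2 \<sigma> i j)
    then show ?thesis by (auto simp: doubleton_eq_iff)
  next
    case (3 \<sigma> i)
    then show ?thesis by (auto simp: doubleton_eq_iff)
  qed
  have pre: "\<rho> = \<rho>'" if "length \<rho> = n" "length \<rho>' = n" "take n \<tau> = \<rho>" "take n (take q \<tau>) = \<rho>'" for \<rho> \<rho>' \<tau> :: "nat list" and n q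
  proof -
    have "length (take n (take q \<tau>)) = n" unfolding that(4) by (rule that(2))
    then have "n \<le> q" by simp
    then show ?thesis using that by (simp add: min_def)
  qed
  have "rd (h + h * p) ?E (W \<sigma>) (X \<sigma>)" if "m \<le> h" "length \<sigma> = m" "set \<sigma> \<subseteq> {..M}" for m \<sigma>
    using that
  proof (induction arbitrary: \<sigma> rule: inc_induct)
    case base
    have sub: "X \<sigma> \<subseteq> insert (pt \<sigma> 0 0) ((\<lambda>(i, j). pt \<sigma> (Suc i) j) ` ({..<h} \<times> {1..p}))"
    proof
      fix x assume x: "x \<in> X \<sigma>"
      then obtain \<tau> a b where t: "x = pt \<tau> a b" "take h \<tau> = \<sigma>" "x \<in> ?V" using base by (auto simp: X_def)
      from t(3) show "x \<in> insert (pt \<sigma> 0 0) ((\<lambda>(i, j). pt \<sigma> (Suc i) j) ` ({..<h} \<times> {1..p}))"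
      proof (cases rule: subdiv_vertexE)
        case (1 \<rho>)
        then show ?thesis using t by simp
      next
        case (2 \<rho> i j)
        then have "\<rho> = \<sigma>" using t by simp
        then show ?thesis using 2 by (intro insertI2 image_eqI[of _ _ "(i, j)"]) auto
      qed
    qed
    let ?Y = "insert (pt \<sigma> 0 0) ((\<lambda>(i, j). pt \<sigma> (Suc i) j) ` ({..<h} \<times> {1..p}))"
    have finY: "finite ?Y" by simp
    have "card ?Y \<le> Suc (card ((\<lambda>(i, j). pt \<sigma> (Suc i) j) ` ({..<h} \<times> {1..p})))" by (rule card_insert_le_m1) simp_all
    also have "card ((\<lambda>(i, j). pt \<sigma> (Suc i) j) ` ({..<h} \<times> {1..p})) \<le> card ({..<h} \<times> {1..p})" by (rule card_image_le) simp
    finally have "card ?Y \<le> Suc (h * p)" by simp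
    then have "card (X \<sigma>) \<le> Suc (h * p)" using card_mono[OF finY sub] by simp
    moreover have "card (W \<sigma>) \<le> h" unfolding W_def using card_image_le[of "{..<length \<sigma>}"] base by (metis card_lessThan finite_lessThan)
    moreover have "W \<sigma> \<inter> X \<sigma> = {}"
    proof (rule equals0I)
      fix x assume "x \<in> W \<sigma> \<inter> X \<sigma>"
      then obtain i where i: "i < length \<sigma>" "x = pt (take i \<sigma>) 0 0" "take (length \<sigma>) (take i \<sigma>) = \<sigma>"
        by (auto simp: W_def X_def)
      then have "take i \<sigma> = \<sigma>" by simp
      then have "length (take i \<sigma>) = length \<sigma>" by simp
      then show False using i(1) by simp
    qed
    moreover have "finite (X \<sigma>)" using finY sub finite_subset by blast
    ultimately show ?case by (intro rd_small) (auto simp: W_def)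
  next
    case (step m)
    have mh: "m < h" using step.hyps by simp
    have W: "W (\<sigma> @ [a]) = insert (pt \<sigma> 0 0) (W \<sigma>)" for a
    proof -
      have "{..<length (\<sigma> @ [a])} = insert (length \<sigma>) {..<length \<sigma>}" by auto
      then have "W (\<sigma> @ [a]) = insert (pt (take (length \<sigma>) (\<sigma> @ [a])) 0 0) ((\<lambda>i. pt (take i (\<sigma> @ [a])) 0 0) ` {..<length \<sigma>})"
        unfolding W_def by simp
      also have "(\<lambda>i. pt (take i (\<sigma> @ [a])) 0 0) ` {..<length \<sigma>} = W \<sigma>" unfolding W_def by (intro image_cong) auto
      finally show ?thesis by simp
    qed
    have sub: "rd (h + h * p) ?E (insert (pt \<sigma> 0 0) (W \<sigma>)) (X (\<sigma> @ [a]))" if "a \<le> M" for a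
      using step.IH[of "\<sigma> @ [a]"] step.prems that unfolding W by simp
    have neq: "\<rho> \<noteq> \<rho>'" if "\<rho> = \<sigma> @ [a]" "\<rho>' = \<sigma> @ [b]" "a \<noteq> b" for \<rho> \<rho>' a b using that by simp
    have "card (insert (pt \<sigma> 0 0) (W \<sigma>)) \<le> Suc (h + h * p)"
      using rd_finite[OF sub[of 0]] by simp
    then have "rd (h + h * p) ?E (insert (pt \<sigma> 0 0) (W \<sigma>)) (\<Union>a\<in>{..M}. X (\<sigma> @ [a]))"
    proof (intro rd_UNION)
      show "X (\<sigma> @ [a]) \<inter> X (\<sigma> @ [b]) = {}" if "a \<noteq> b" for a b
        unfolding X_def using that by auto
      fix a b x y assume ab: "a \<noteq> b" "x \<in> X (\<sigma> @ [a])" "y \<in> X (\<sigma> @ [b])"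
      show "{x, y} \<notin> ?E"
      proof
        assume e: "{x, y} \<in> ?E"
        obtain \<tau> i j where x: "x = pt \<tau> i j" "take (Suc m) \<tau> = \<sigma> @ [a]" using ab(2) step.prems(1) by (auto simp: X_def)
        obtain \<tau>' i' j' where y: "y = pt \<tau>' i' j'" "take (Suc m) \<tau>' = \<sigma> @ [b]" using ab(3) step.prems(1) by (auto simp: X_def)
        have l: "length (\<sigma> @ [a]) = Suc m" "length (\<sigma> @ [b]) = Suc m" using step.prems(1) by auto
        from ed[OF e[unfolded x(1) y(1)]] consider "\<tau> = \<tau>'" | q where "\<tau>' = take q \<tau>" | q where "\<tau> = take q \<tau>'" by blast
        then have "\<sigma> @ [a] = \<sigma> @ [b]"
        proof cases
          case 1
          then show ?thesis using x(2) y(2) by simp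
        next
          case 2
          then show ?thesis using pre[OF l x(2)] y(2) by blast
        next
          case 3
          then show ?thesis using pre[OF l(2,1) y(2)] x(2) by metis
        qed
        then show False using ab(1) by simp
      qed
    qed (use sub in \<open>auto simp: W_def\<close>)
    moreover have "pt \<sigma> 0 0 \<notin> W \<sigma>"
    proof
      assume "pt \<sigma> 0 0 \<in> W \<sigma>"
      then obtain i where "i < length \<sigma>" "\<sigma> = take i \<sigma>" by (auto simp: W_def)
      then show False by (metis length_take min.absorb_iff2 not_le order_less_imp_le)
    qed
    ultimately have "rd (h + h * p) ?E (W \<sigma>) (insert (pt \<sigma> 0 0) (\<Union>a\<in>{..M}. X (\<sigma> @ [a])))"
      by (rule rd.intro)
    moreover have "insert (pt \<sigma> 0 0) (\<Union>a\<in>{..M}. X (\<sigma> @ [a])) = X \<sigma>"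
    proof
      have "pt \<sigma> 0 0 \<in> X \<sigma>" using subdiv_vertexI(1) step.prems mh unfolding X_def by auto
      moreover have "X (\<sigma> @ [a]) \<subseteq> X \<sigma>" for a
      proof
        fix x assume "x \<in> X (\<sigma> @ [a])"
        then obtain \<tau> i j where t: "x \<in> ?V" "x = pt \<tau> i j" "take (Suc (length \<sigma>)) \<tau> = \<sigma> @ [a]" by (auto simp: X_def)
        have "take (length \<sigma>) \<tau> = take (length \<sigma>) (take (Suc (length \<sigma>)) \<tau>)" by simp
        also have "\<dots> = \<sigma>" unfolding t(3) by simp
        finally show "x \<in> X \<sigma>" using t unfolding X_def by blast
      qed
      ultimately show "insert (pt \<sigma> 0 0) (\<Union>a\<in>{..M}. X (\<sigma> @ [a])) \<subseteq> X \<sigma>" by blast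
      show "X \<sigma> \<subseteq> insert (pt \<sigma> 0 0) (\<Union>a\<in>{..M}. X (\<sigma> @ [a]))"
      proof
        fix x assume "x \<in> X \<sigma>"
        then obtain \<tau> i j where t: "x \<in> ?V" "x = pt \<tau> i j" "take m \<tau> = \<sigma>" using step.prems by (auto simp: X_def)
        have st: "set \<tau> \<subseteq> {..M}" "length \<tau> < h \<longrightarrow> i = 0 \<and> j = 0"
          using t(1) by (cases rule: subdiv_vertexE; use t(2) in simp)+
        show "x \<in> insert (pt \<sigma> 0 0) (\<Union>a\<in>{..M}. X (\<sigma> @ [a]))"
        proof (cases "length \<tau> \<le> m")
          case True
          then have "\<tau> = \<sigma>" "length \<tau> < h" using t(3) mh by auto
          then show ?thesis using t(2) st by simp
        next
          case False
          then have "take (Suc m) \<tau> = \<sigma> @ [\<tau> ! m]" using t(3) by (simp add: take_Suc_conv_app_nth)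
          moreover have "\<tau> ! m \<in> set \<tau>" using False by simp
          then have tM: "\<tau> ! m \<in> {..M}" using st(1) by blast
          moreover have "length (\<sigma> @ [\<tau> ! m]) = Suc m" using step.prems by simp
          ultimately have "x \<in> X (\<sigma> @ [\<tau> ! m])" using t unfolding X_def by auto
          then show ?thesis using tM by blast
        qed
      qed
    qed
    ultimately show ?case by simp
  qed
  from this[of 0 "[]"] have "rd (h + h * p) ?E (W []) (X [])" by simp
  moreover have "W [] = {}" by (simp add: W_def)
  moreover have "X [] = ?V"
  proof
    show "?V \<subseteq> X []"
    proof
      fix x assume x: "x \<in> ?V"
      then have "\<exists>\<tau> i j. x = pt \<tau> i j" by (cases rule: subdiv_vertexE) blast+
      then show "x \<in> X []" using x by (simp add: X_def)
    qed
  qed (auto simp: X_def)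
  ultimately show ?thesis by simp
qed

lemma card_fibres_le:
  assumes "finite V" "finite Z" "\<And>x. card {v \<in> V. \<phi> v = x} \<le> N"
  shows "card {v \<in> V. \<phi> v \<in> Z} \<le> card Z * N"
proof -
  have "{v \<in> V. \<phi> v \<in> Z} = (\<Union>z\<in>Z. {v \<in> V. \<phi> v = z})" by blast
  then have "card {v \<in> V. \<phi> v \<in> Z} \<le> (\<Sum>z\<in>Z. card {v \<in> V. \<phi> v = z})" using card_UN_le[OF assms(2)] by metis
  also have "\<dots> \<le> (\<Sum>z\<in>Z. N)" by (rule sum_mono) (rule assms(3))
  finally show ?thesis by simp
qed

lemma conn_thread:
  assumes "set \<tau> \<subseteq> {..M}" "length \<tau> = h" "i < h" "1 \<le> p"
  shows "conn (snd (subdiv h M p)) (insert (pt \<tau> 0 0) (insert (pt (take i \<tau>) 0 0) (pt \<tau> (Suc i) ` {1..p})))"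
proof -
  let ?P = "path_graph (Suc (Suc p))"
  define g where "g k = (if k = 0 then pt \<tau> 0 0 else if k \<le> p then pt \<tau> (Suc i) k else pt (take i \<tau>) 0 0)" for k
  have e: "{g k, g (Suc k)} \<in> snd (subdiv h M p)" if k: "Suc k < Suc (Suc p)" for k
  proof -
    consider "k = 0" | "1 \<le> k" "k < p" | "1 \<le> k" "k = p" using k by linarith
    then show ?thesis
      by cases (use assms subdiv_edgeI[OF assms(1-3)] in \<open>auto simp: g_def\<close>)
  qed
  have "conn (snd (subdiv h M p)) (g ` fst ?P)"
  proof (rule conn_image[OF conn_path_graph])
    fix u v assume "{u, v} \<in> snd ?P"
    then obtain k where k: "{u, v} = {k, Suc k}" "Suc k < Suc (Suc p)" by (auto simp: path_graph_def)
    then have "{g u, g v} = {g k, g (Suc k)}" by (auto simp: doubleton_eq_iff)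
    then show "g u = g v \<or> {g u, g v} \<in> snd (subdiv h M p)" using e[OF k(2)] by simp
  qed simp
  moreover have "g ` fst ?P = insert (pt \<tau> 0 0) (insert (pt (take i \<tau>) 0 0) (pt \<tau> (Suc i) ` {1..p}))"
  proof -
    have "fst ?P = insert 0 (insert (Suc p) {1..p})" by (auto simp: path_graph_def)
    moreover have "g ` {1..p} = pt \<tau> (Suc i) ` {1..p}" by (intro image_cong) (auto simp: g_def)
    moreover have "g 0 = pt \<tau> 0 0" "g (Suc p) = pt (take i \<tau>) 0 0" by (simp_all add: g_def)
    ultimately show ?thesis by (simp only: image_insert)
  qed
  ultimately show ?thesis by simp
qed

text \<open>The prefixes of a suitable word lie in distinct parts. Since boundedly many vertices meet
  any \<open>c + 1\<close> given parts, some extension of the word links all of them outside these parts.\<close>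

lemma tpw_subdiv:
  assumes p: "1 \<le> p" and h: "h = Suc (Suc c)" and M: "M = (h + Suc c) * N"
  shows "N < tpw c (subdiv h M p)"
proof (rule ccontr)
  let ?G = "subdiv h M p"
  let ?E = "snd ?G" and ?V = "fst ?G"
  assume "\<not> N < tpw c ?G"
  then have N: "tpw c ?G \<le> N" by simp
  have fin: "finite ?V" using graph_subdiv[OF p] by (simp add: graph_def)
  from ex_tpw_partition[OF fin, of c] obtain H :: "nat graph" and \<phi> where
    H: "graph H" "tw H \<le> c" "H_partition ?G H \<phi>" "\<forall>x. card {v \<in> ?V. \<phi> v = x} \<le> tpw c ?G"
    by blast
  have fib: "card {v \<in> ?V. \<phi> v = x} \<le> N" for x using H(4) N le_trans by blast
  \<comment> \<open>The word is chosen letter by letter: among the \<open>M + 1\<close> children one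
    avoids all parts of the shorter prefixes.\<close>
  have "\<exists>\<sigma>. length \<sigma> = m \<and> set \<sigma> \<subseteq> {..M} \<and> inj_on (\<lambda>i. \<phi> (pt (take i \<sigma>) 0 0)) {..m}" if "m < h" for m
    using that
  proof (induction m)
    case 0
    show ?case by (intro exI[of _ "[]"]) simp
  next
    case (Suc m)
    then obtain \<sigma> where s: "length \<sigma> = m" "set \<sigma> \<subseteq> {..M}" "inj_on (\<lambda>i. \<phi> (pt (take i \<sigma>) 0 0)) {..m}" by auto
    define Z where "Z = (\<lambda>i. \<phi> (pt (take i \<sigma>) 0 0)) ` {..m}"
    have Z: "finite Z" "card Z \<le> Suc m" using card_image_le[of "{..m}"] by (auto simp: Z_def)
    have "card {v \<in> ?V. \<phi> v \<in> Z} \<le> card Z * N" by (rule card_fibres_le[OF fin Z(1) fib])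
    \<comment> \<open>The sum in \<open>M\<close> covers both applications: at most \<open>h\<close>
      parts of prefixes here, and at most \<open>Suc c\<close> separating parts below.\<close>
    also have "\<dots> \<le> M" unfolding M using Z(2) Suc.prems by (intro mult_le_mono) auto
    finally have c: "card {v \<in> ?V. \<phi> v \<in> Z} \<le> M" .
    have "\<exists>a\<le>M. {pt (\<sigma> @ [a]) 0 0} \<inter> {v \<in> ?V. \<phi> v \<in> Z} = {}"
      by (rule ex_avoiding_index[OF fin _ _ c]) (use fin in auto)
    then obtain a where a: "a \<le> M" "pt (\<sigma> @ [a]) 0 0 \<notin> {v \<in> ?V. \<phi> v \<in> Z}" by blast
    have "pt (\<sigma> @ [a]) 0 0 \<in> ?V" using s a(1) Suc.prems by (intro subdiv_vertexI) auto
    then have new: "\<phi> (pt (\<sigma> @ [a]) 0 0) \<notin> Z" using a(2) by blast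
    have tk: "take i (\<sigma> @ [a]) = take i \<sigma>" if "i \<in> {..m}" for i using that s(1) by simp
    have "inj_on (\<lambda>i. \<phi> (pt (take i (\<sigma> @ [a])) 0 0)) {..m}"
      using s(3) tk by (simp add: inj_on_def)
    moreover have "(\<lambda>i. \<phi> (pt (take i (\<sigma> @ [a])) 0 0)) ` {..m} = Z" unfolding Z_def by (intro image_cong) (use tk in auto)
    moreover have "{..Suc m} = insert (Suc m) {..m}" by auto
    moreover have "take (Suc m) (\<sigma> @ [a]) = \<sigma> @ [a]" using s(1) by simp
    ultimately have "inj_on (\<lambda>i. \<phi> (pt (take i (\<sigma> @ [a])) 0 0)) {..Suc m}" using new by simp
    then show ?case using s a(1) by (intro exI[of _ "\<sigma> @ [a]"]) simp
  qed
  from this[of "Suc c"] obtain \<sigma> where s: "length \<sigma> = Suc c" "set \<sigma> \<subseteq> {..M}"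
    "inj_on (\<lambda>i. \<phi> (pt (take i \<sigma>) 0 0)) {..Suc c}" using h by auto
  define K where "K = (\<lambda>i. \<phi> (pt (take i \<sigma>) 0 0)) ` {..Suc c}"
  have cK: "card K = Suc (Suc c)" unfolding K_def using card_image[OF s(3)] by simp
  have VH: "\<phi> v \<in> fst H" if "v \<in> ?V" for v using H(3) that by (simp add: H_partition_def)
  have pre: "pt (take i \<sigma>) 0 0 \<in> ?V" for i
    using s h set_take_subset[of i \<sigma>] by (intro subdiv_vertexI) auto
  have "rd c (snd H) {} (fst H)" using tw_le_iff_rd[OF H(1)] H(2) by blast
  then have "card K \<le> Suc c"
  proof (rule rd_linked_card)
    show "K \<subseteq> {} \<union> fst H" using VH pre by (auto simp: K_def)
    show "{} \<union> fst H \<subseteq> fst H" by simp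
    show "\<forall>x\<in>fst H. \<forall>y\<in>fst H. {x, y} \<in> snd H \<longrightarrow> y \<in> {} \<union> fst H" by simp
    fix Z x y assume Z: "finite Z" "card Z \<le> Suc c" and xy: "x \<in> K - Z" "y \<in> K - Z"
    define Y where "Y a = {v \<in> ?V. \<exists>i j. v = pt (\<sigma> @ [a]) i j}" for a
    have "card {v \<in> ?V. \<phi> v \<in> Z} \<le> card Z * N" by (rule card_fibres_le[OF fin Z(1) fib])
    also have "\<dots> \<le> M" unfolding M using Z(2) by (intro mult_le_mono) auto
    finally have c: "card {v \<in> ?V. \<phi> v \<in> Z} \<le> M" .
    have "\<exists>a\<le>M. Y a \<inter> {v \<in> ?V. \<phi> v \<in> Z} = {}"
      by (rule ex_avoiding_index[OF fin _ _ c]) (use fin in \<open>auto simp: Y_def\<close>)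
    then obtain a where a: "a \<le> M" "Y a \<inter> {v \<in> ?V. \<phi> v \<in> Z} = {}" by blast
    define \<tau> where "\<tau> = \<sigma> @ [a]"
    have t: "set \<tau> \<subseteq> {..M}" "length \<tau> = h" using s a(1) h by (auto simp: \<tau>_def)
    \<comment> \<open>All these sets contain the branch vertex of \<open>\<tau>\<close>, so the
      union of two is connected; its image in the host links two prefix parts outside
      \<open>Z\<close>.\<close>
    define T where "T i = insert (pt \<tau> 0 0) (insert (pt (take i \<tau>) 0 0) (pt \<tau> (Suc i) ` {1..p}))" for i
    have T: "conn ?E (T i)" "T i \<subseteq> ?V" "\<phi> (pt (take i \<sigma>) 0 0) \<notin> Z \<Longrightarrow> \<phi> ` T i \<inter> Z = {}"
      "pt (take i \<sigma>) 0 0 \<in> T i" if i: "i \<le> Suc c" for i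
    proof -
      have ih: "i < h" using i h by simp
      show "conn ?E (T i)" unfolding T_def by (rule conn_thread[OF t ih p])
      have tk: "take i \<tau> = take i \<sigma>" using i s(1) by (simp add: \<tau>_def)
      have ins: "insert (pt \<tau> 0 0) (pt \<tau> (Suc i) ` {1..p}) \<subseteq> Y a"
        using subdiv_vertexI(1)[of \<tau> M h p] subdiv_vertexI(2)[of \<tau> M h i _ p] t ih by (auto simp: Y_def \<tau>_def)
      have Teq: "T i = insert (pt (take i \<sigma>) 0 0) (insert (pt \<tau> 0 0) (pt \<tau> (Suc i) ` {1..p}))"
        unfolding T_def tk by (rule insert_commute)
      show "pt (take i \<sigma>) 0 0 \<in> T i" unfolding Teq by simp
      have YV: "Y a \<subseteq> ?V" by (auto simp: Y_def)
      then show "T i \<subseteq> ?V" using ins pre unfolding Teq by blast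
      show "\<phi> ` T i \<inter> Z = {}" if "\<phi> (pt (take i \<sigma>) 0 0) \<notin> Z"
        using that ins a(2) YV unfolding Teq by blast
    qed
    obtain i j where ij: "i \<le> Suc c" "j \<le> Suc c" "x = \<phi> (pt (take i \<sigma>) 0 0)" "y = \<phi> (pt (take j \<sigma>) 0 0)"
      using xy unfolding K_def by auto
    have "conn ?E (T i \<union> T j)"
      by (rule conn_Un[OF T(1)[OF ij(1)] T(1)[OF ij(2)]]) (auto simp: T_def)
    then have "conn (snd H) (\<phi> ` (T i \<union> T j))"
      by (rule conn_image) (use H(3) in \<open>auto simp: H_partition_def\<close>)
    then have "reach (snd H) (\<phi> ` (T i \<union> T j)) x y"
      unfolding conn_def connected_in_def using T(4)[OF ij(1)] T(4)[OF ij(2)] ij(3,4) by blast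
    moreover have "\<phi> ` (T i \<union> T j) \<subseteq> fst H - Z"
    proof -
      have "\<phi> ` T i \<inter> Z = {}" "\<phi> ` T j \<inter> Z = {}" using T(3) ij xy by auto
      then show ?thesis using T(2)[OF ij(1)] T(2)[OF ij(2)] VH by blast
    qed
    ultimately show "reach (snd H) (fst H - Z) x y" by (rule reach_mono[OF _ subset_refl])
  qed
  then show False using cK by simp
qed

text \<open>\<open>p\<close> exceeds the order of every excluded graph, so one of them could occur
  in \<open>subdiv\<close> only as a spider-forest. For fixed \<open>c\<close> the treewidth bound
  is independent of \<open>N\<close>, whereas the width of the partitions is not bounded.\<close>

lemma spider_forest_if_bounded:
  assumes fin: "finite \<H>" "\<forall>H\<in>\<H>. graph H" and b: "bounded_underlying_tw (excl_set \<H>)"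
  shows "\<exists>H\<in>\<H>. spider_forest H"
proof (rule ccontr)
  assume no: "\<not> ?thesis"
  obtain c where c: "utw_bounded_by (excl_set \<H>) c" using b unfolding bounded_underlying_tw_def by blast
  define p where "p = Suc (\<Sum>H\<in>\<H>. card (fst H))"
  define h where "h = Suc (Suc c)"
  have p: "1 \<le> p" by (simp add: p_def)
  have "\<not> utw_bounded_by (excl_set \<H>) c"
  proof (rule not_utw_bounded_byI[where T = "h + h * p"])
    fix N
    define G where "G = subdiv h ((h + Suc c) * N) p"
    have gG: "graph G" unfolding G_def by (rule graph_subdiv[OF p])
    have "\<not> contains_subgraph G H" if H: "H \<in> \<H>" for H
    proof
      assume "contains_subgraph G H"
      moreover have "card (fst H) \<le> (\<Sum>H\<in>\<H>. card (fst H))" by (rule member_le_sum[OF H]) (use fin in auto)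
      ultimately have "spider_forest H"
        using spider_forest_if_small[of H p] fin(2) H by (auto simp: G_def p_def)
      then show False using no H by blast
    qed
    then have "G \<in> excl_set \<H>" using gG by (simp add: excl_set_def)
    moreover have "tw G \<le> h + h * p" by (rule tw_le_if_rd[OF gG]) (simp add: G_def rd_subdiv)
    moreover have "N < tpw c G" unfolding G_def by (rule tpw_subdiv[OF p h_def refl])
    ultimately show "\<exists>G\<in>excl_set \<H>. tw G \<le> h + h * p \<and> N < tpw c G" by blast
  qed
  then show False using c by blast
qed

lemma floor_log2:
  assumes "1 \<le> n"
  shows "2 ^ nat \<lfloor>log 2 (real n)\<rfloor> \<le> n" "n < 2 ^ Suc (nat \<lfloor>log 2 (real n)\<rfloor>)"
proof -
  define h where "h = nat \<lfloor>log 2 (real n)\<rfloor>"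
  \<comment> \<open>The logarithm is nonnegative, so \<open>nat\<close> truncates nothing.\<close>
  have "0 \<le> log 2 (real n)" using assms by simp
  then have h: "real h \<le> log 2 (real n)" "log 2 (real n) < real (Suc h)"
    unfolding h_def by linarith+
  have "2 powr real h \<le> real n" using h(1) assms by (simp add: le_log_iff)
  then show "2 ^ h \<le> n" by (simp add: powr_realpow)
  have "real n < 2 powr real (Suc h)" using h(2) assms by (simp add: log_less_iff)
  then have "real n < real (2 ^ Suc h)" by (simp add: powr_realpow del: of_nat_Suc power_Suc)
  then show "n < 2 ^ Suc h" by linarith
qed

theorem theorem7p1:
  fixes l n s t :: nat and \<H> :: "nat graph set"
  assumes "n \<ge> 3" and "s \<ge> 3" and "l \<ge> 2" and "t \<ge> 1"
    and "finite \<H>" and "\<forall>H\<in>\<H>. graph H"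
  shows "(bounded_underlying_tw (excl_set \<H>) \<longleftrightarrow> (\<exists>H\<in>\<H>. spider_forest H))
    \<and> is_underlying_tw (excl (path_graph n)) (nat \<lfloor>log 2 (real n)\<rfloor> - 1)
    \<and> is_underlying_tw (excl (copies l (path_graph n))) (nat \<lfloor>log 2 (real n)\<rfloor>)
    \<and> is_underlying_tw (excl (spider s t)) (nat \<lfloor>log 2 (real t)\<rfloor> + 1)
    \<and> is_underlying_tw (excl (copies l (spider s t))) (nat \<lfloor>log 2 (real t)\<rfloor> + 2)"
proof (intro conjI)
  show "bounded_underlying_tw (excl_set \<H>) \<longleftrightarrow> (\<exists>H\<in>\<H>. spider_forest H)"
    using spider_forest_if_bounded[OF assms(5,6)] bounded_if_spider_forest by blast
  define g where "g = nat \<lfloor>log 2 (real n)\<rfloor>"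
  define h where "h = nat \<lfloor>log 2 (real t)\<rfloor>"
  have g: "2 ^ g \<le> n" "n < 2 ^ Suc g" using floor_log2[of n] assms(1) by (simp_all add: g_def)
  have h: "2 ^ h \<le> t" "t < 2 ^ Suc h" using floor_log2[of t] assms(4) by (simp_all add: h_def)
  \<comment> \<open>Since \<open>n \<ge> 3\<close>, the logarithm is at least 1 and the subtraction
    in the value for paths is exact.\<close>
  have "g \<noteq> 0" using g(2) assms(1) by (cases g) auto
  then obtain c where c: "g = Suc c" by (cases g) auto
  show "is_underlying_tw (excl (path_graph n)) (nat \<lfloor>log 2 (real n)\<rfloor> - 1)"
    using underlying_tw_path[OF g[unfolded c]] c by (simp add: g_def)
  show "is_underlying_tw (excl (copies l (path_graph n))) (nat \<lfloor>log 2 (real n)\<rfloor>)"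
    using underlying_tw_copies_path[OF g[unfolded c] assms(3)] c by (simp add: g_def)
  show "is_underlying_tw (excl (spider s t)) (nat \<lfloor>log 2 (real t)\<rfloor> + 1)"
    using underlying_tw_spider[OF assms(2) h] by (simp add: h_def)
  show "is_underlying_tw (excl (copies l (spider s t))) (nat \<lfloor>log 2 (real t)\<rfloor> + 2)"
    using underlying_tw_copies_spider[OF assms(2) h assms(3)] by (simp add: h_def)
qed

end
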